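(* Let $G$ be a finite digraph and let $\mathrm{hj}(G)=\{r_1<\dots<r_n\}$ be the set of homotopy jumping points of $G$. Then the magnitude-path spectral sequence $E(G)$ can be decomposed into a direct sum of spectral sequences $$E(G)=\bigoplus_{k=1}^n E(G)_{[k]}\oplus E(G)_{[\infty]}$$ such that $E^{1+r_k}(G)_{[k]}=0$ for every $1\le k\le n$, and for any $1\leq j\leq n$ there is an isomorphism of spectral sequences $$E(M_{r_j}(G))\cong\bigoplus_{k=j+1}^n E(G)_{[k]}\oplus E(G)_{[\infty]}.$$ In particular, $E(M_{\mathrm{stab}}(G))\cong E(G)_{[\infty]}$.
   Context: Quasimetric spaces. A quasimetric space is a set $X$ with $d:X\times X\to[0,+\infty]$ satisfying the triangle inequality and $d(x,y)=0\iff x=y$ (not necessarily symmetric). A map $\varphi:X\to Y$ is short if $d(\varphi(x),\varphi(x'))\le d(x,x')$. The set of short maps $X\to Y$ is a quasimetric space with $d(\varphi,\psi)=\sup_x d(\varphi(x),\psi(x))$. For real $r\ge0$, $\sim_r$ is the smallest equivalence relation on short maps $X\to Y$ such that $d(\varphi,\psi)\le r$ implies $\varphi\sim_r\psi$. Spaces $X,Y$ are $r$-homotopy equivalent if there are short maps $\varphi:X\to Y$, $\psi:Y\to X$ with $\psi\varphi\sim_r1_X$, $\varphi\psi\sim_r1_Y$. A subset $A\subseteq X$ (with induced distance and inclusion $\iota$) is an $r$-deformation retract if there is a short map $\rho:X\to A$ with $\rho\iota=1_A$ and $\iota\rho\sim_r1_X$. A finite space is $r$-minimal if it has no $r$-deformation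 retract other than itself. Every finite quasimetric space $X$ has an $r$-deformation retract that is $r$-minimal; it is unique up to isometry among $r$-minimal finite spaces $r$-homotopy equivalent to $X$, and is denoted $M_r(X)$. Homotopy jumping points. For a finite (non-empty) $X$, the function $c_X(r)=|M_r(X)|/|X|$, $r\in[0,+\infty)$, is non-increasing with finitely many values; $\mathrm{hj}(X)=\{r_1<\dots<r_n\}$ is the finite set of reals $r_i>0$ such that $c_X(r_i)<c_X(r)$ for all $0\le r<r_i$. Put $M_{\mathrm{stab}}(X)=M_{r_n}(X)$ if $n>0$ and $M_{\mathrm{stab}}(X)=X$ if $n=0$. Digraphs. A digraph is a pair $G=(G_0,G_1)$ with $G_1\subseteq G_0\times G_0$ and $(g,g)\in G_1$ for all $g\in G_0$. A morphism is a map on vertices sending arrows to arrows. $\mathrm Q(G)$ is the quasimetric space on $G_0$ with $d(g,g')$ the infimum of lengths of directed paths from $g$ to $g'$. The functor $\mathrm Q$ is full and faithful, and digraphs are identified with the corresponding quasimetric spaces. Every retract of $\mathrm Q(G)$ is $\mathrm Q(H)$ for a unique subdigraph $H\subseteq G$ that is a retract of $G$; hence for finite $G$ there is a digraph $M_r(G)$, unique up to isomorphism, with $\mathrm Q(M_r(G))=M_r(\mathrm Q(G))$. Set $\mathrm{hj}(G)=\mathrm{hj}(\mathrm Q(G))$ and define $M_{\mathrm{stab}}(G)$ by the corresponding construction. (The homotopy jumping points of a finite digraph are positive integers.) Magnitude-path spectral sequence. Let $\mathbb K$ be a commutative ring. $\mathrm{RC}(G)$ is the chain complex with $\mathrm{RC}_n(G)$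 the free $\mathbb K$-module on tuples $(g_0,\dots,g_n)$ of vertices with $g_i\ne g_{i+1}$ and $d(g_i,g_{i+1})<+\infty$, with differential $\partial(g_0,\dots,g_n)=\sum_{i=0}^n(-1)^i(g_0,\dots,\hat g_i,\dots,g_n)$, where tuples with a consecutive repetition are set equal to $0$. It is filtered by the subcomplexes $F_\ell\mathrm{RC}(G)$, $\ell\in\mathbb Z$, spanned by tuples with $\sum_i d(g_i,g_{i+1})\le\ell$. $E(G)$ is the spectral sequence associated with this filtered chain complex, with pages $E^r(G)$, and first page $E^1_{\ell,n-\ell}(G)=H_n(F_\ell\mathrm{RC}(G)/F_{\ell-1}\mathrm{RC}(G))$. $E^{r}(G)_{[k]}$ denotes the $r$-th page of the summand $E(G)_{[k]}$. *)

theory Defs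
  imports
    "HOL-Algebra.Module"
    "HOL-Algebra.AbelCoset"
    "HOL-Library.Extended_Nonnegative_Real"
    "HOL-Library.Extended_Nat"
begin

section \<open>Quasimetric spaces and \<open>r\<close>-homotopy\<close>

record 'a qspace =
  points :: "'a set"
  qdist :: "'a \<Rightarrow> 'a \<Rightarrow> ennreal"

definition quasimetric :: "'a qspace \<Rightarrow> bool" where
  "quasimetric X \<longleftrightarrow>
     (\<forall>x\<in>points X. \<forall>y\<in>points X. qdist X x y = 0 \<longleftrightarrow> x = y) \<and>
     (\<forall>x\<in>points X. \<forall>y\<in>points X. \<forall>z\<in>points X. qdist X x z \<le> qdist X x y + qdist X y z)"

definition qsubspace :: "'a qspace \<Rightarrow> 'a set \<Rightarrow> 'a qspace" where
  "qsubspace X A = \<lparr>points = A, qdist = qdist X\<rparr>"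

text \<open>Short maps are extensional, so that equality of functions is equality of maps.\<close>

definition short_maps :: "'a qspace \<Rightarrow> 'b qspace \<Rightarrow> ('a \<Rightarrow> 'b) set" where
  "short_maps X Y = {\<phi> \<in> points X \<rightarrow>\<^sub>E points Y.
     \<forall>x\<in>points X. \<forall>x'\<in>points X. qdist Y (\<phi> x) (\<phi> x') \<le> qdist X x x'}"

definition map_dist :: "'a qspace \<Rightarrow> 'b qspace \<Rightarrow> ('a \<Rightarrow> 'b) \<Rightarrow> ('a \<Rightarrow> 'b) \<Rightarrow> ennreal" where
  "map_dist X Y \<phi> \<psi> = (SUP x\<in>points X. qdist Y (\<phi> x) (\<psi> x))"

definition id_map :: "'a qspace \<Rightarrow> 'a \<Rightarrow> 'a" where
  "id_map X = (\<lambda>x\<in>points X. x)"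

definition r_homotopic ::
    "real \<Rightarrow> 'a qspace \<Rightarrow> 'b qspace \<Rightarrow> (('a \<Rightarrow> 'b) \<times> ('a \<Rightarrow> 'b)) set" where
  "r_homotopic r X Y =
     \<Inter>{E. equiv (short_maps X Y) E \<and>
         {(\<phi>, \<psi>) \<in> short_maps X Y \<times> short_maps X Y. map_dist X Y \<phi> \<psi> \<le> ennreal r} \<subseteq> E}"

definition r_homotopy_equivalent :: "real \<Rightarrow> 'a qspace \<Rightarrow> 'b qspace \<Rightarrow> bool" where
  "r_homotopy_equivalent r X Y \<longleftrightarrow>
     (\<exists>\<phi>\<in>short_maps X Y. \<exists>\<psi>\<in>short_maps Y X.
        (compose (points X) \<psi> \<phi>, id_map X) \<in> r_homotopic r X X \<and>
        (compose (points Y) \<phi> \<psi>, id_map Y) \<in> r_homotopic r Y Y)"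

text \<open>The inclusion of \<open>A\<close> into \<open>X\<close> is \<open>id_map (qsubspace X A)\<close>.\<close>

definition r_deformation_retract :: "real \<Rightarrow> 'a qspace \<Rightarrow> 'a set \<Rightarrow> bool" where
  "r_deformation_retract r X A \<longleftrightarrow>
     A \<subseteq> points X \<and>
     (\<exists>\<rho>\<in>short_maps X (qsubspace X A).
        compose A \<rho> (id_map (qsubspace X A)) = id_map (qsubspace X A) \<and>
        (compose (points X) (id_map (qsubspace X A)) \<rho>, id_map X) \<in> r_homotopic r X X)"

definition r_minimal :: "real \<Rightarrow> 'a qspace \<Rightarrow> bool" where
  "r_minimal r X \<longleftrightarrow>
     finite (points X) \<and> (\<forall>A. r_deformation_retract r X A \<longrightarrow> A = points X)"

text \<open>
  \<open>is_M r X M\<close> says that \<open>M\<close> is (a representative of) \<open>M\<^sub>r(X)\<close>, which is defined only up to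
  isometry. For \<open>X\<close> finite a representative exists among the subspaces of \<open>X\<close>;
  see \<open>ex_is_M\<close> below, and \<open>ex_is_M_digraph\<close> for digraphs.
\<close>

definition is_M :: "real \<Rightarrow> 'a qspace \<Rightarrow> 'b qspace \<Rightarrow> bool" where
  "is_M r X M \<longleftrightarrow> quasimetric M \<and> r_minimal r M \<and> r_homotopy_equivalent r X M"

definition M_ratio :: "'a qspace \<Rightarrow> real \<Rightarrow> real" where
  "M_ratio X r =
     real (card (points (SOME M :: 'a qspace. is_M r X M))) / real (card (points X))"

definition hj :: "'a qspace \<Rightarrow> real set" where
  "hj X = {r. 0 < r \<and> (\<forall>s. 0 \<le> s \<and> s < r \<longrightarrow> M_ratio X r < M_ratio X s)}"


section \<open>Digraphs\<close>

record 'v digraph =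
  verts :: "'v set"
  arrows :: "('v \<times> 'v) set"

definition is_digraph :: "'v digraph \<Rightarrow> bool" where
  "is_digraph G \<longleftrightarrow> arrows G \<subseteq> verts G \<times> verts G \<and> (\<forall>g\<in>verts G. (g, g) \<in> arrows G)"

text \<open>There is a directed path of length \<open>m\<close> from \<open>g\<close> to \<open>g'\<close> iff \<open>(g, g') \<in> arrows G ^^ m\<close>.\<close>

definition Q :: "'v digraph \<Rightarrow> 'v qspace" where
  "Q G = \<lparr>points = verts G,
          qdist = (\<lambda>g g'. INF m\<in>{m. (g, g') \<in> arrows G ^^ m}. of_nat m)\<rparr>"

definition is_M_digraph :: "real \<Rightarrow> 'v digraph \<Rightarrow> 'w digraph \<Rightarrow> bool" where
  "is_M_digraph r G H \<longleftrightarrow> is_digraph H \<and> is_M r (Q G) (Q H)"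

definition is_M_stab_digraph :: "'v digraph \<Rightarrow> 'v digraph \<Rightarrow> bool" where
  "is_M_stab_digraph G H \<longleftrightarrow>
     (if hj (Q G) = {} then H = G else is_M_digraph (Max (hj (Q G))) G H)"


section \<open>Modules\<close>

text \<open>
  The record type of modules extends that of rings; the multiplicative fields are irrelevant for
  modules and left undefined.
\<close>

definition linear_maps ::
    "'k ring \<Rightarrow> ('k, 'a) module \<Rightarrow> ('k, 'b) module \<Rightarrow> ('a \<Rightarrow> 'b) set" where
  "linear_maps R M N = {f \<in> carrier M \<rightarrow> carrier N.
     (\<forall>x\<in>carrier M. \<forall>y\<in>carrier M. f (x \<oplus>\<^bsub>M\<^esub> y) = f x \<oplus>\<^bsub>N\<^esub> f y) \<and>
     (\<forall>a\<in>carrier R. \<forall>x\<in>carrier M. f (a \<odot>\<^bsub>M\<^esub> x) = a \<odot>\<^bsub>N\<^esub> f x)}"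

definition linear_isos ::
    "'k ring \<Rightarrow> ('k, 'a) module \<Rightarrow> ('k, 'b) module \<Rightarrow> ('a \<Rightarrow> 'b) set" where
  "linear_isos R M N = {f \<in> linear_maps R M N. bij_betw f (carrier M) (carrier N)}"

definition quotient_module :: "('k, 'a) module \<Rightarrow> 'a set \<Rightarrow> ('k, 'a set) module" where
  "quotient_module M N =
     \<lparr>carrier = a_rcosets\<^bsub>M\<^esub> N, mult = undefined, one = undefined,
      zero = N, add = (\<lambda>C D. C <+>\<^bsub>M\<^esub> D),
      smult = (\<lambda>a C. \<Union>x\<in>C. N +>\<^bsub>M\<^esub> (a \<odot>\<^bsub>M\<^esub> x))\<rparr>"

text \<open>The free module on the basis \<open>T\<close>.\<close>

definition free_module :: "'k ring \<Rightarrow> 't set \<Rightarrow> ('k, 't \<Rightarrow> 'k) module" where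
  "free_module R T =
     \<lparr>carrier = {c. (\<forall>t. c t \<in> carrier R) \<and> {t. c t \<noteq> \<zero>\<^bsub>R\<^esub>} \<subseteq> T \<and> finite {t. c t \<noteq> \<zero>\<^bsub>R\<^esub>}},
      mult = undefined, one = undefined,
      zero = (\<lambda>t. \<zero>\<^bsub>R\<^esub>), add = (\<lambda>c c' t. c t \<oplus>\<^bsub>R\<^esub> c' t),
      smult = (\<lambda>a c t. a \<otimes>\<^bsub>R\<^esub> c t)\<rparr>"


section \<open>Spectral sequences\<close>

text \<open>
  A spectral sequence starts at page 1 (the values at page 0 are ignored) and is bigraded
  homologically: \<open>ss_diff E r p q\<close> maps \<open>E\<^sup>r\<^sub>p\<^sub>,\<^sub>q\<close> to \<open>E\<^sup>r\<close> in bidegree \<open>(p - r, q + r - 1)\<close>.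
  The isomorphism from the homology of page \<open>r\<close> at \<open>(p, q)\<close> to the next page, \<open>ss_next E r p q\<close>,
  is part of the data.
\<close>

record ('k, 'e) spectral_seq =
  ss_page :: "nat \<Rightarrow> int \<Rightarrow> int \<Rightarrow> ('k, 'e) module"
  ss_diff :: "nat \<Rightarrow> int \<Rightarrow> int \<Rightarrow> 'e \<Rightarrow> 'e"
  ss_next :: "nat \<Rightarrow> int \<Rightarrow> int \<Rightarrow> 'e set \<Rightarrow> 'e"

definition ss_cycles :: "('k, 'e) spectral_seq \<Rightarrow> nat \<Rightarrow> int \<Rightarrow> int \<Rightarrow> 'e set" where
  "ss_cycles E r p q = {x \<in> carrier (ss_page E r p q).
     ss_diff E r p q x = \<zero>\<^bsub>ss_page E r (p - int r) (q + int r - 1)\<^esub>}"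

definition ss_boundaries :: "('k, 'e) spectral_seq \<Rightarrow> nat \<Rightarrow> int \<Rightarrow> int \<Rightarrow> 'e set" where
  "ss_boundaries E r p q =
     ss_diff E r (p + int r) (q - int r + 1) ` carrier (ss_page E r (p + int r) (q - int r + 1))"

definition ss_homology ::
    "('k, 'e) spectral_seq \<Rightarrow> nat \<Rightarrow> int \<Rightarrow> int \<Rightarrow> ('k, 'e set) module" where
  "ss_homology E r p q =
     quotient_module ((ss_page E r p q)\<lparr>carrier := ss_cycles E r p q\<rparr>) (ss_boundaries E r p q)"

definition ss_class ::
    "('k, 'e) spectral_seq \<Rightarrow> nat \<Rightarrow> int \<Rightarrow> int \<Rightarrow> 'e \<Rightarrow> 'e set" where
  "ss_class E r p q x = ss_boundaries E r p q +>\<^bsub>ss_page E r p q\<^esub> x"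

definition spectral_sequence :: "'k ring \<Rightarrow> ('k, 'e) spectral_seq \<Rightarrow> bool" where
  "spectral_sequence R E \<longleftrightarrow> (\<forall>r p q. 1 \<le> r \<longrightarrow>
     Module.module R (ss_page E r p q) \<and>
     ss_diff E r p q \<in>
       linear_maps R (ss_page E r p q) (ss_page E r (p - int r) (q + int r - 1)) \<and>
     ss_boundaries E r p q \<subseteq> ss_cycles E r p q \<and>
     ss_next E r p q \<in> linear_isos R (ss_homology E r p q) (ss_page E (Suc r) p q))"

definition ss_isos ::
    "'k ring \<Rightarrow> ('k, 'e) spectral_seq \<Rightarrow> ('k, 'f) spectral_seq \<Rightarrow>
     (nat \<Rightarrow> int \<Rightarrow> int \<Rightarrow> 'e \<Rightarrow> 'f) set" where
  "ss_isos R E F = {f. \<forall>r p q. 1 \<le> r \<longrightarrow>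
     f r p q \<in> linear_isos R (ss_page E r p q) (ss_page F r p q) \<and>
     (\<forall>x\<in>carrier (ss_page E r p q).
        f r (p - int r) (q + int r - 1) (ss_diff E r p q x) = ss_diff F r p q (f r p q x)) \<and>
     (\<forall>x\<in>ss_cycles E r p q.
        f (Suc r) p q (ss_next E r p q (ss_class E r p q x)) =
        ss_next F r p q (ss_class F r p q (f r p q x)))}"

definition ss_isomorphic ::
    "'k ring \<Rightarrow> ('k, 'e) spectral_seq \<Rightarrow> ('k, 'f) spectral_seq \<Rightarrow> bool" where
  "ss_isomorphic R E F \<longleftrightarrow> ss_isos R E F \<noteq> {}"

definition direct_sum :: "'i set \<Rightarrow> ('i \<Rightarrow> ('k, 'a) module) \<Rightarrow> ('k, 'i \<Rightarrow> 'a) module" where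
  "direct_sum I M =
     \<lparr>carrier = {x \<in> Pi\<^sub>E I (\<lambda>i. carrier (M i)). finite {i \<in> I. x i \<noteq> \<zero>\<^bsub>M i\<^esub>}},
      mult = undefined, one = undefined,
      zero = (\<lambda>i\<in>I. \<zero>\<^bsub>M i\<^esub>), add = (\<lambda>x y. \<lambda>i\<in>I. x i \<oplus>\<^bsub>M i\<^esub> y i),
      smult = (\<lambda>a x. \<lambda>i\<in>I. a \<odot>\<^bsub>M i\<^esub> x i)\<rparr>"

text \<open>
  In the last component, \<open>(\<lambda>x. x i) ` h\<close> is the projection of a homology class \<open>h\<close> of the direct
  sum to a homology class of the summand \<open>S i\<close>.
\<close>

definition ss_direct_sum ::
    "'i set \<Rightarrow> ('i \<Rightarrow> ('k, 'e) spectral_seq) \<Rightarrow> ('k, 'i \<Rightarrow> 'e) spectral_seq" where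
  "ss_direct_sum I S =
     \<lparr>ss_page = (\<lambda>r p q. direct_sum I (\<lambda>i. ss_page (S i) r p q)),
      ss_diff = (\<lambda>r p q x. \<lambda>i\<in>I. ss_diff (S i) r p q (x i)),
      ss_next = (\<lambda>r p q h. \<lambda>i\<in>I. ss_next (S i) r p q ((\<lambda>x. x i) ` h))\<rparr>"


section \<open>The magnitude-path spectral sequence\<close>

definition tuple_length :: "'a qspace \<Rightarrow> 'a list \<Rightarrow> ennreal" where
  "tuple_length X t = (\<Sum>i<length t - 1. qdist X (t ! i) (t ! Suc i))"

definition regular_tuples :: "'a qspace \<Rightarrow> int \<Rightarrow> 'a list set" where
  "regular_tuples X n = {t. t \<noteq> [] \<and> int (length t) = n + 1 \<and> set t \<subseteq> points X \<and>
     (\<forall>i. Suc i < length t \<longrightarrow>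
        t ! i \<noteq> t ! Suc i \<and> qdist X (t ! i) (t ! Suc i) < \<infinity>)}"

definition RC :: "'k ring \<Rightarrow> 'a qspace \<Rightarrow> int \<Rightarrow> ('k, 'a list \<Rightarrow> 'k) module" where
  "RC R X n = free_module R (regular_tuples X n)"

definition RC_filt :: "'k ring \<Rightarrow> 'a qspace \<Rightarrow> int \<Rightarrow> int \<Rightarrow> ('a list \<Rightarrow> 'k) set" where
  "RC_filt R X l n = {c \<in> carrier (RC R X n).
     \<forall>t. c t \<noteq> \<zero>\<^bsub>R\<^esub> \<longrightarrow> enn2ereal (tuple_length X t) \<le> ereal (of_int l)}"

definition delete_nth :: "nat \<Rightarrow> 'a list \<Rightarrow> 'a list" where
  "delete_nth i t = take i t @ drop (Suc i) t"

text \<open>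
  \<open>boundary_coeff R X n t s\<close> is the coefficient of the basis tuple \<open>s\<close> in the boundary of the
  basis tuple \<open>t\<close> of degree \<open>n\<close>.
\<close>

definition boundary_coeff ::
    "'k ring \<Rightarrow> 'a qspace \<Rightarrow> int \<Rightarrow> 'a list \<Rightarrow> 'a list \<Rightarrow> 'k" where
  "boundary_coeff R X n t s =
     (if s \<in> regular_tuples X (n - 1)
      then \<Oplus>\<^bsub>R\<^esub>i\<in>{i. i < length t \<and> delete_nth i t = s}. (\<ominus>\<^bsub>R\<^esub> \<one>\<^bsub>R\<^esub>) [^]\<^bsub>R\<^esub> i
      else \<zero>\<^bsub>R\<^esub>)"

definition boundary ::
    "'k ring \<Rightarrow> 'a qspace \<Rightarrow> int \<Rightarrow> ('a list \<Rightarrow> 'k) \<Rightarrow> ('a list \<Rightarrow> 'k)" where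
  "boundary R X n c =
     (\<lambda>s. \<Oplus>\<^bsub>R\<^esub>t\<in>{t. c t \<noteq> \<zero>\<^bsub>R\<^esub>}. c t \<otimes>\<^bsub>R\<^esub> boundary_coeff R X n t s)"

text \<open>
  The pages of the spectral sequence of the filtered complex \<open>F = RC_filt R X\<close> are
  \<open>E\<^sup>r\<^sub>p\<^sub>,\<^sub>q = Z\<^sup>r\<^sub>p\<^sub>,\<^sub>q / (Z\<^sup>r\<^sup>-\<^sup>1\<^sub>p\<^sub>-\<^sub>1\<^sub>,\<^sub>q\<^sub>+\<^sub>1 + \<partial>Z\<^sup>r\<^sup>-\<^sup>1\<^sub>p\<^sub>+\<^sub>r\<^sub>-\<^sub>1\<^sub>,\<^sub>q\<^sub>-\<^sub>r\<^sub>+\<^sub>2)\<close> with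
  \<open>Z\<^sup>r\<^sub>p\<^sub>,\<^sub>q = {c \<in> F\<^sub>p RC\<^sub>p\<^sub>+\<^sub>q. \<partial>c \<in> F\<^sub>p\<^sub>-\<^sub>r RC\<^sub>p\<^sub>+\<^sub>q\<^sub>-\<^sub>1}\<close>, and the differential is induced by \<open>\<partial>\<close>.
\<close>

definition mpss_Z :: "'k ring \<Rightarrow> 'a qspace \<Rightarrow> nat \<Rightarrow> int \<Rightarrow> int \<Rightarrow> ('a list \<Rightarrow> 'k) set" where
  "mpss_Z R X r p q =
     {c \<in> RC_filt R X p (p + q). boundary R X (p + q) c \<in> RC_filt R X (p - int r) (p + q - 1)}"

definition mpss_B :: "'k ring \<Rightarrow> 'a qspace \<Rightarrow> nat \<Rightarrow> int \<Rightarrow> int \<Rightarrow> ('a list \<Rightarrow> 'k) set" where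
  "mpss_B R X r p q =
     mpss_Z R X (r - 1) (p - 1) (q + 1) <+>\<^bsub>RC R X (p + q)\<^esub>
     boundary R X (p + q + 1) ` mpss_Z R X (r - 1) (p + int r - 1) (q - int r + 2)"

text \<open>
  A class in the homology of page \<open>r\<close> at \<open>(p, q)\<close> is a set \<open>h\<close> of elements of
  \<open>E\<^sup>r\<^sub>p\<^sub>,\<^sub>q\<close>, each of which is a set of chains. The canonical isomorphism to \<open>E\<^sup>r\<^sup>+\<^sup>1\<^sub>p\<^sub>,\<^sub>q\<close> sends the class
  of \<open>[c]\<close>, where \<open>c \<in> Z\<^sup>r\<^sup>+\<^sup>1\<^sub>p\<^sub>,\<^sub>q\<close>, to \<open>[c]\<close>; this coset consists of all the chains in
  \<open>Z\<^sup>r\<^sup>+\<^sup>1\<^sub>p\<^sub>,\<^sub>q\<close> that belong to some member of \<open>h\<close>.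
\<close>

definition mpss_space :: "'k ring \<Rightarrow> 'a qspace \<Rightarrow> ('k, ('a list \<Rightarrow> 'k) set) spectral_seq" where
  "mpss_space R X =
     \<lparr>ss_page = (\<lambda>r p q. quotient_module
        ((RC R X (p + q))\<lparr>carrier := mpss_Z R X r p q\<rparr>) (mpss_B R X r p q)),
      ss_diff = (\<lambda>r p q C. \<Union>c\<in>C.
        mpss_B R X r (p - int r) (q + int r - 1) +>\<^bsub>RC R X (p + q - 1)\<^esub> boundary R X (p + q) c),
      ss_next = (\<lambda>r p q h. \<Union>h \<inter> mpss_Z R X (Suc r) p q)\<rparr>"

definition mpss :: "'k ring \<Rightarrow> 'v digraph \<Rightarrow> ('k, ('v list \<Rightarrow> 'k) set) spectral_seq" where
  "mpss R G = mpss_space R (Q G)"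


section \<open>Existence of \<open>M\<^sub>r\<close> and finiteness of \<open>hj\<close>\<close>

lemma qsubspace_simps [simp]:
  "points (qsubspace X A) = A" "qdist (qsubspace X A) = qdist X"
  by (simp_all add: qsubspace_def)

lemma quasimetric_qsubspace: "quasimetric X \<Longrightarrow> A \<subseteq> points X \<Longrightarrow> quasimetric (qsubspace X A)"
  unfolding quasimetric_def by (simp add: subset_iff)

lemma id_map_short: "A \<subseteq> points X \<Longrightarrow> id_map (qsubspace X A) \<in> short_maps (qsubspace X A) X"
  by (auto simp: short_maps_def id_map_def)

lemma id_short [simp]: "id_map X \<in> short_maps X X"
  by (auto simp: short_maps_def id_map_def)

lemma compose_short:
  assumes "f \<in> short_maps X Y" "g \<in> short_maps Y Z"
  shows "compose (points X) g f \<in> short_maps X Z"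
proof -
  have "qdist Z (g (f x)) (g (f x')) \<le> qdist X x x'" if "x \<in> points X" "x' \<in> points X" for x x'
  proof -
    have "f x \<in> points Y" "f x' \<in> points Y" "qdist Y (f x) (f x') \<le> qdist X x x'"
      using assms(1) that by (auto simp: short_maps_def)
    moreover from this have "qdist Z (g (f x)) (g (f x')) \<le> qdist Y (f x) (f x')"
      using assms(2) by (simp add: short_maps_def)
    ultimately show ?thesis by (meson order_trans)
  qed
  moreover have "compose (points X) g f \<in> points X \<rightarrow>\<^sub>E points Z"
    using assms by (auto simp: short_maps_def compose_def)
  ultimately show ?thesis by (simp add: short_maps_def compose_eq)
qed

lemma equiv_r_homotopic: "equiv (short_maps X Y) (r_homotopic r X Y)"
proof (rule equivI)
  let ?S = "short_maps X Y"
  let ?F = "{E. equiv ?S E \<and>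
    {(\<phi>, \<psi>) \<in> ?S \<times> ?S. map_dist X Y \<phi> \<psi> \<le> ennreal r} \<subseteq> E}"
  have top: "?S \<times> ?S \<in> ?F"
    by (auto simp: equiv_def refl_on_def sym_def trans_def)
  show "r_homotopic r X Y \<subseteq> ?S \<times> ?S" 
    using top unfolding r_homotopic_def by blast
  show "refl_on ?S (r_homotopic r X Y)"
    using top unfolding r_homotopic_def equiv_def refl_on_def by blast
  show "sym (r_homotopic r X Y)"
    unfolding r_homotopic_def equiv_def sym_def by blast
  show "trans (r_homotopic r X Y)"
    unfolding r_homotopic_def equiv_def by (rule transI) (blast dest: transD)
qed

lemma r_homotopic_base:
  "\<phi> \<in> short_maps X Y \<Longrightarrow> \<psi> \<in> short_maps X Y \<Longrightarrow> map_dist X Y \<phi> \<psi> \<le> ennreal r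
    \<Longrightarrow> (\<phi>, \<psi>) \<in> r_homotopic r X Y"
  unfolding r_homotopic_def by blast

lemma r_homotopic_induct:
  assumes "(\<phi>, \<psi>) \<in> r_homotopic r X Y" "equiv (short_maps X Y) E"
    and "\<And>\<phi> \<psi>. \<phi> \<in> short_maps X Y \<Longrightarrow> \<psi> \<in> short_maps X Y \<Longrightarrow>
      map_dist X Y \<phi> \<psi> \<le> ennreal r \<Longrightarrow> (\<phi>, \<psi>) \<in> E"
  shows "(\<phi>, \<psi>) \<in> E"
  using assms unfolding r_homotopic_def by blast

lemma r_homotopic_compose:
  assumes "(\<phi>, \<psi>) \<in> r_homotopic r X Y" "\<beta> \<in> short_maps W X" "\<alpha> \<in> short_maps Y Z"
  shows "(compose (points W) \<alpha> (compose (points W) \<phi> \<beta>),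
          compose (points W) \<alpha> (compose (points W) \<psi> \<beta>)) \<in> r_homotopic r W Z"
proof -
  let ?c = "\<lambda>\<phi>. compose (points W) \<alpha> (compose (points W) \<phi> \<beta>)"
  let ?E = "{(\<phi>, \<psi>) \<in> short_maps X Y \<times> short_maps X Y. (?c \<phi>, ?c \<psi>) \<in> r_homotopic r W Z}"
  have cs: "?c \<phi> \<in> short_maps W Z" if "\<phi> \<in> short_maps X Y" for \<phi>
    using that assms(2,3) compose_short by metis
  note e = equiv_r_homotopic[of W Z r]
  have "equiv (short_maps X Y) ?E"
  proof (rule equivI)
    show "refl_on (short_maps X Y) ?E"
      using e cs by (auto simp: refl_on_def equiv_def)
    show "sym ?E" using e by (auto simp: sym_def equiv_def)
    show "trans ?E" using e unfolding equiv_def by (auto intro!: transI dest: transD)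
  qed auto
  moreover have "(\<phi>, \<psi>) \<in> ?E"
    if s: "\<phi> \<in> short_maps X Y" "\<psi> \<in> short_maps X Y" and d: "map_dist X Y \<phi> \<psi> \<le> ennreal r" for \<phi> \<psi>
  proof -
    have "qdist Z (?c \<phi> w) (?c \<psi> w) \<le> ennreal r" if w: "w \<in> points W" for w
    proof -
      have b: "\<beta> w \<in> points X" using w assms(2) by (auto simp: short_maps_def)
      have "qdist Z (\<alpha> (\<phi> (\<beta> w))) (\<alpha> (\<psi> (\<beta> w))) \<le> qdist Y (\<phi> (\<beta> w)) (\<psi> (\<beta> w))"
        using s b assms(3) by (auto simp: short_maps_def PiE_iff)
      also have "\<dots> \<le> map_dist X Y \<phi> \<psi>" unfolding map_dist_def using b by (rule SUP_upper)
      also note d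
      finally show ?thesis using w by (simp add: compose_eq)
    qed
    then have "map_dist W Z (?c \<phi>) (?c \<psi>) \<le> ennreal r"
      unfolding map_dist_def by (rule SUP_least)
    then show ?thesis using s cs by (auto intro: r_homotopic_base)
  qed
  ultimately have "(\<phi>, \<psi>) \<in> ?E" using r_homotopic_induct[OF assms(1)] by blast
  then show ?thesis by auto
qed

lemma r_deformation_retract_refl: "r_deformation_retract r X (points X)"
proof -
  have [simp]: "qsubspace X (points X) = X" by (simp add: qsubspace_def)
  have [simp]: "compose (points X) (id_map X) (id_map X) = id_map X"
    by (auto simp: compose_def id_map_def)
  have "(id_map X, id_map X) \<in> r_homotopic r X X"
    using equiv_r_homotopic[of X X r] by (auto simp: equiv_def refl_on_def)
  then show ?thesis unfolding r_deformation_retract_def by (auto intro!: bexI[of _ "id_map X"])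
qed

lemma r_deformation_retract_equivalent:
  assumes "r_deformation_retract r X A"
  shows "r_homotopy_equivalent r X (qsubspace X A)"
proof -
  let ?i = "id_map (qsubspace X A)"
  obtain \<rho> where A: "A \<subseteq> points X" and \<rho>: "\<rho> \<in> short_maps X (qsubspace X A)"
    "compose A \<rho> ?i = ?i" "(compose (points X) ?i \<rho>, id_map X) \<in> r_homotopic r X X"
    using assms unfolding r_deformation_retract_def by blast
  have "(?i, ?i) \<in> r_homotopic r (qsubspace X A) (qsubspace X A)"
    using equiv_r_homotopic id_short by (metis equiv_def refl_on_def)
  then show ?thesis using \<rho> id_map_short[OF A] unfolding r_homotopy_equivalent_def
    by (intro bexI[of _ \<rho>] bexI[of _ ?i]) auto
qed

lemma r_deformation_retract_trans:
  assumes "r_deformation_retract r X A" "r_deformation_retract r (qsubspace X A) B"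
  shows "r_deformation_retract r X B"
proof -
  let ?i = "id_map (qsubspace X A)" and ?j = "id_map (qsubspace X B)"
  have [simp]: "qsubspace (qsubspace X A) B = qsubspace X B" by (simp add: qsubspace_def)
  obtain \<rho> where A: "A \<subseteq> points X" and \<rho>: "\<rho> \<in> short_maps X (qsubspace X A)"
    "compose A \<rho> ?i = ?i" "(compose (points X) ?i \<rho>, id_map X) \<in> r_homotopic r X X"
    using assms(1) unfolding r_deformation_retract_def by blast
  obtain \<sigma> where B: "B \<subseteq> A" and \<sigma>: "\<sigma> \<in> short_maps (qsubspace X A) (qsubspace X B)"
    "compose B \<sigma> ?j = ?j" "(compose A ?j \<sigma>, ?i) \<in> r_homotopic r (qsubspace X A) (qsubspace X A)"
    using assms(2) unfolding r_deformation_retract_def by auto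
  let ?\<tau> = "compose (points X) \<sigma> \<rho>"
  have rA: "\<rho> x \<in> A" if "x \<in> points X" for x using \<rho>(1) that by (auto simp: short_maps_def)
  have sB: "\<sigma> x \<in> B" if "x \<in> A" for x using \<sigma>(1) that by (auto simp: short_maps_def)
  have r1: "\<rho> x = x" if "x \<in> A" for x
    using fun_cong[OF \<rho>(2), of x] that by (simp add: compose_def id_map_def)
  have s1: "\<sigma> x = x" if "x \<in> B" for x
    using fun_cong[OF \<sigma>(2), of x] that by (simp add: compose_def id_map_def)
  have t1: "?\<tau> \<in> short_maps X (qsubspace X B)" using compose_short[OF \<rho>(1) \<sigma>(1)] .
  have t2: "compose B ?\<tau> ?j = ?j"
    using A B r1 s1 by (auto simp: compose_def id_map_def fun_eq_iff)
  have "(compose (points X) ?i (compose (points X) (compose A ?j \<sigma>) \<rho>),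
         compose (points X) ?i (compose (points X) ?i \<rho>)) \<in> r_homotopic r X X"
    using r_homotopic_compose[OF \<sigma>(3) \<rho>(1) id_map_short[OF A]] by simp
  moreover have "compose (points X) ?i (compose (points X) (compose A ?j \<sigma>) \<rho>) =
      compose (points X) ?j ?\<tau>"
    using rA sB B by (auto simp: compose_def id_map_def fun_eq_iff)
  moreover have "compose (points X) ?i (compose (points X) ?i \<rho>) = compose (points X) ?i \<rho>"
    using rA by (auto simp: compose_def id_map_def fun_eq_iff)
  ultimately have "(compose (points X) ?j ?\<tau>, id_map X) \<in> r_homotopic r X X"
    using \<rho>(3) equiv_r_homotopic[of X X r] by (metis equiv_def transD)
  then show ?thesis using A B t1 t2 unfolding r_deformation_retract_def by blast
qed

lemma ex_r_minimal_retract: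
  assumes "finite (points X)"
  shows "\<exists>A. r_deformation_retract r X A \<and> r_minimal r (qsubspace X A)"
proof -
  obtain A where A: "r_deformation_retract r X A"
    and least: "\<And>B. r_deformation_retract r X B \<Longrightarrow> card A \<le> card B"
    using ex_has_least_nat[of "r_deformation_retract r X" "points X" card]
      r_deformation_retract_refl by blast
  have fin: "finite A" using A assms finite_subset unfolding r_deformation_retract_def by blast
  have "B = A" if B: "r_deformation_retract r (qsubspace X A) B" for B
  proof -
    have "B \<subseteq> A" using B unfolding r_deformation_retract_def by simp
    then show ?thesis using least[OF r_deformation_retract_trans[OF A B]] fin
      by (simp add: card_seteq)
  qed
  then show ?thesis using A fin unfolding r_minimal_def by auto
qed

lemma ex_is_M:
  assumes "quasimetric X" "finite (points X)"
  shows "\<exists>A\<subseteq>points X. is_M r X (qsubspace X A)"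
  using ex_r_minimal_retract[OF assms(2)] r_deformation_retract_equivalent
    quasimetric_qsubspace[OF assms(1)]
  unfolding is_M_def by (metis r_deformation_retract_def)

lemma finite_hj: "finite (hj X)"
proof -
  let ?N = "real (card (points X))"
  let ?m = "\<lambda>r. card (points (SOME M :: 'a qspace. is_M r X M))"
  have less: "?m r < ?m s" if "r \<in> hj X" "0 \<le> s" "s < r" for r s
    using that by (auto simp: hj_def M_ratio_def divide_less_cancel)
  have "?m ` hj X \<subseteq> {..?m 0}"
    using less[of _ 0] by (force simp: hj_def)
  moreover have "inj_on ?m (hj X)"
  proof (rule linorder_inj_onI)
    fix r s assume "r < s" "r \<in> hj X" "s \<in> hj X"
    then show "?m r \<noteq> ?m s" using less[of s r] by (force simp: hj_def)
  qed auto
  ultimately show ?thesis using finite_imageD finite_subset by blast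
qed

lemma Q_simps [simp]: "points (Q G) = verts G"
  by (simp add: Q_def)

lemma Q_dist_le: "(g, g') \<in> arrows G ^^ m \<Longrightarrow> qdist (Q G) g g' \<le> of_nat m"
  by (auto simp: Q_def intro: INF_lower)

lemma Q_dist_attained:
  assumes "qdist (Q G) g g' < \<infinity>"
  obtains m where "(g, g') \<in> arrows G ^^ m" "qdist (Q G) g g' = of_nat m"
proof -
  let ?M = "{m. (g, g') \<in> arrows G ^^ m}"
  have ne: "?M \<noteq> {}"
  proof
    assume "?M = {}"
    then have "qdist (Q G) g g' = (INF m\<in>({}::nat set). of_nat m)" unfolding Q_def by simp
    then show False using assms by simp
  qed
  define m where "m = (LEAST m. m \<in> ?M)"
  have m: "m \<in> ?M" using ne unfolding m_def by (metis LeastI ex_in_conv)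
  have "of_nat m \<le> qdist (Q G) g g'"
    by (auto simp: Q_def m_def intro!: INF_greatest Least_le)
  then show ?thesis using m Q_dist_le[of g g' m G] that by force
qed

lemma quasimetric_Q: "quasimetric (Q G)"
proof -
  have "g = g'" if zero: "qdist (Q G) g g' = 0" for g g'
  proof -
    obtain m where "(g, g') \<in> arrows G ^^ m" "qdist (Q G) g g' = of_nat m"
      using zero by (metis Q_dist_attained infinity_ennreal_def ennreal_zero_less_top)
    then show ?thesis using zero by auto
  qed
  moreover have "qdist (Q G) g g = 0" for g using Q_dist_le[of g g 0 G] by simp
  moreover have "qdist (Q G) x z \<le> qdist (Q G) x y + qdist (Q G) y z" for x y z
  proof (cases "qdist (Q G) x y < \<infinity> \<and> qdist (Q G) y z < \<infinity>")
    case True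
    then obtain k l where "(x, y) \<in> arrows G ^^ k" "qdist (Q G) x y = of_nat k"
      "(y, z) \<in> arrows G ^^ l" "qdist (Q G) y z = of_nat l"
      by (metis Q_dist_attained)
    then show ?thesis using Q_dist_le[of x z "k + l" G] by (auto simp: relpow_add)
  qed (auto simp: less_top[symmetric])
  ultimately show ?thesis unfolding quasimetric_def by blast
qed

lemma Q_retract:
  assumes G: "is_digraph G" and A: "A \<subseteq> verts G"
    and \<rho>: "\<rho> \<in> short_maps (Q G) (qsubspace (Q G) A)" "\<And>a. a \<in> A \<Longrightarrow> \<rho> a = a"
    and a: "a \<in> A" "b \<in> A"
  shows "qdist (Q \<lparr>verts = A, arrows = arrows G \<inter> A \<times> A\<rparr>) a b = qdist (Q G) a b"
proof -
  let ?H = "\<lparr>verts = A, arrows = arrows G \<inter> A \<times> A\<rparr>"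
  have arr: "(\<rho> x, \<rho> y) \<in> arrows ?H" if xy: "(x, y) \<in> arrows G" for x y
  proof -
    have v: "x \<in> verts G" "y \<in> verts G" using xy G by (auto simp: is_digraph_def)
    then have \<rho>A: "\<rho> x \<in> A" "\<rho> y \<in> A" using \<rho>(1) by (auto simp: short_maps_def)
    have le: "qdist (Q G) (\<rho> x) (\<rho> y) \<le> 1"
      using \<rho>(1) v Q_dist_le[of x y 1 G] xy by (force simp: short_maps_def intro: order_trans)
    then have "qdist (Q G) (\<rho> x) (\<rho> y) < \<infinity>" by (auto intro: le_less_trans)
    then obtain m where m: "(\<rho> x, \<rho> y) \<in> arrows G ^^ m" "qdist (Q G) (\<rho> x) (\<rho> y) = of_nat m"
      by (rule Q_dist_attained)
    then have "m = 0 \<or> m = 1" using le by (cases m) (auto simp flip: of_nat_Suc)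
    then show ?thesis using m(1) \<rho>A A G by (auto simp: is_digraph_def)
  qed
  have 1: "(\<rho> x, \<rho> y) \<in> arrows ?H ^^ m" if "(x, y) \<in> arrows G ^^ m" for x y m
    using that
  proof (induction m arbitrary: y)
    case (Suc m)
    then obtain z where "(x, z) \<in> arrows G ^^ m" "(z, y) \<in> arrows G" by (auto elim: relpow_Suc_E)
    then show ?case using Suc.IH arr by (blast intro: relpow_Suc_I)
  qed simp
  have "arrows ?H ^^ m \<subseteq> arrows G ^^ m" for m by (induction m) auto
  moreover have "(a, b) \<in> arrows ?H ^^ m" if "(a, b) \<in> arrows G ^^ m" for m
    using 1[OF that] \<rho>(2) a by simp
  ultimately have "{m. (a, b) \<in> arrows ?H ^^ m} = {m. (a, b) \<in> arrows G ^^ m}" by auto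
  then show ?thesis by (simp add: Q_def)
qed

lemma short_maps_cong:
  assumes "points X = points X'" "points Y = points Y'"
    and "\<And>x y. x \<in> points X \<Longrightarrow> y \<in> points X \<Longrightarrow> qdist X x y = qdist X' x y"
    and "\<And>x y. x \<in> points Y \<Longrightarrow> y \<in> points Y \<Longrightarrow> qdist Y x y = qdist Y' x y"
  shows "short_maps X Y = short_maps X' Y'"
proof -
  have "(\<forall>x\<in>points X. \<forall>x'\<in>points X. qdist Y (\<phi> x) (\<phi> x') \<le> qdist X x x') \<longleftrightarrow>
      (\<forall>x\<in>points X'. \<forall>x'\<in>points X'. qdist Y' (\<phi> x) (\<phi> x') \<le> qdist X' x x')"
    if "\<phi> \<in> points X \<rightarrow>\<^sub>E points Y" for \<phi>
    using that assms by (auto simp: PiE_iff)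
  then show ?thesis unfolding short_maps_def using assms(1,2) by auto
qed

lemma r_homotopic_cong:
  assumes "points X = points X'" "points Y = points Y'"
    and "\<And>x y. x \<in> points X \<Longrightarrow> y \<in> points X \<Longrightarrow> qdist X x y = qdist X' x y"
    and "\<And>x y. x \<in> points Y \<Longrightarrow> y \<in> points Y \<Longrightarrow> qdist Y x y = qdist Y' x y"
  shows "r_homotopic r X Y = r_homotopic r X' Y'"
proof -
  note s = short_maps_cong[OF assms]
  have "map_dist X Y \<phi> \<psi> = map_dist X' Y' \<phi> \<psi>"
    if "\<phi> \<in> short_maps X Y" "\<psi> \<in> short_maps X Y" for \<phi> \<psi>
    unfolding map_dist_def assms(1)[symmetric]
    using that by (intro SUP_cong refl assms(4)) (auto simp: short_maps_def PiE_iff)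
  then have "{(\<phi>, \<psi>) \<in> short_maps X Y \<times> short_maps X Y. map_dist X Y \<phi> \<psi> \<le> ennreal r} =
      {(\<phi>, \<psi>) \<in> short_maps X' Y' \<times> short_maps X' Y'. map_dist X' Y' \<phi> \<psi> \<le> ennreal r}"
    by (auto simp: s)
  then show ?thesis by (simp add: r_homotopic_def s)
qed

lemma is_M_cong:
  assumes p: "points M = points M'"
    and d: "\<And>x y. x \<in> points M \<Longrightarrow> y \<in> points M \<Longrightarrow> qdist M x y = qdist M' x y"
    and M: "is_M r X M"
  shows "is_M r X M'"
proof -
  have q: "quasimetric M'"
    using M p d unfolding is_M_def quasimetric_def by metis
  have i: "id_map M = id_map M'" "id_map (qsubspace M A) = id_map (qsubspace M' A)" for A
    using p by (simp_all add: id_map_def)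
  have "r_deformation_retract r M' A \<longleftrightarrow> r_deformation_retract r M A" for A
  proof (cases "A \<subseteq> points M")
    case True
    have "short_maps M (qsubspace M A) = short_maps M' (qsubspace M' A)"
      using p d True by (intro short_maps_cong) auto
    moreover have "r_homotopic r M M = r_homotopic r M' M'"
      using p d by (intro r_homotopic_cong) auto
    ultimately show ?thesis unfolding r_deformation_retract_def i p by simp
  qed (simp add: r_deformation_retract_def p)
  then have m: "r_minimal r M'" using M p unfolding is_M_def r_minimal_def by simp
  have "short_maps X M = short_maps X M'"
    using p d by (intro short_maps_cong) auto
  moreover have "short_maps M X = short_maps M' X"
    using p d by (intro short_maps_cong) auto
  moreover have "r_homotopic r M M = r_homotopic r M' M'"
    using p d by (intro r_homotopic_cong) auto
  ultimately have "r_homotopy_equivalent r X M'"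
    using M p i unfolding is_M_def r_homotopy_equivalent_def by simp
  then show ?thesis using q m by (simp add: is_M_def)
qed

lemma ex_is_M_digraph:
  assumes "is_digraph G" "finite (verts G)"
  shows "\<exists>H. is_M_digraph r G H \<and> verts H \<subseteq> verts G \<and> arrows H \<subseteq> arrows G"
proof -
  obtain A where A: "r_deformation_retract r (Q G) A" "r_minimal r (qsubspace (Q G) A)"
    using ex_r_minimal_retract[of "Q G"] assms(2) by auto
  then obtain \<rho> where AG: "A \<subseteq> verts G" and \<rho>: "\<rho> \<in> short_maps (Q G) (qsubspace (Q G) A)"
    "compose A \<rho> (id_map (qsubspace (Q G) A)) = id_map (qsubspace (Q G) A)"
    unfolding r_deformation_retract_def by auto
  have r1: "\<rho> a = a" if "a \<in> A" for a
    using fun_cong[OF \<rho>(2), of a] that by (simp add: compose_def id_map_def)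
  let ?H = "\<lparr>verts = A, arrows = arrows G \<inter> A \<times> A\<rparr>"
  have "is_M r (Q G) (qsubspace (Q G) A)"
    using A r_deformation_retract_equivalent quasimetric_qsubspace[OF quasimetric_Q] AG
    unfolding is_M_def by (metis Q_simps)
  then have "is_M r (Q G) (Q ?H)"
    by (rule is_M_cong[rotated 2]) (auto simp: Q_retract[OF assms(1) AG \<rho>(1) r1])
  moreover have "is_digraph ?H" using assms(1) AG by (auto simp: is_digraph_def)
  ultimately show ?thesis using AG unfolding is_M_digraph_def
    by (intro exI[of _ ?H]) auto
qed

end

theory Submission
  imports Defs "HOL-Library.Poly_Mapping"
begin

text \<open>
  The decomposition already exists on chains. Write \<open>X\<close> for the quasimetric space of \<open>G\<close>. Choose
  subspaces \<open>X = A\<^sub>0 \<supseteq> A\<^sub>1 \<supseteq> \<dots> \<supseteq> A\<^sub>n\<close> such that \<open>A\<^sub>k\<close> is a minimal \<open>r\<^sub>k\<close>-deformation retract of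
  \<open>A\<^sub>k\<^sub>-\<^sub>1\<close>; since the \<open>r\<^sub>k\<close> increase, \<open>A\<^sub>k\<close> is also an \<open>r\<^sub>k\<close>-deformation retract of \<open>X\<close>. The composed
  retractions are idempotent short maps \<open>s\<^sub>k\<close> from \<open>X\<close> onto \<open>A\<^sub>k\<close>, and \<open>s\<^sub>j s\<^sub>k = s\<^sub>l\<close> for \<open>l = max j k\<close>
  (\<open>ex_retraction_tower\<close>). Let \<open>P\<^sub>k\<close> be the filtered chain map of \<open>RC(X)\<close> induced by \<open>s\<^sub>k\<close>. Then
  \<open>1 = (P\<^sub>0 - P\<^sub>1) + \<dots> + (P\<^sub>n\<^sub>-\<^sub>1 - P\<^sub>n) + P\<^sub>n\<close> is a sum of orthogonal idempotents, so \<open>RC(X)\<close> is, as a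
  filtered complex, the direct sum of the subcomplexes that these idempotents fix. The summands
  of the theorem are the spectral sequences of these subcomplexes. Passing from a filtered complex
  to its spectral sequence preserves finite direct sums
  (\<open>filtered_decomposition_ss_isomorphic\<close>).

  The summand of index \<open>k\<close> dies at page \<open>1 + r\<^sub>k\<close> because \<open>P\<^sub>k\<^sub>-\<^sub>1 - P\<^sub>k\<close> acts on it as the identity
  and is null-homotopic. Two short maps at distance at most \<open>r\<close> induce homotopic chain maps, by the
  prism operator, which lengthens a tuple by at most \<open>r\<close>; lengths in a digraph are integers, so the
  filtration degree of the homotopy is at most the integral part \<open>m\<close> of \<open>r\<close>
  (\<open>r_homotopic_chain_homotopy\<close>). An identity map that is null-homotopic through a homotopy of
  filtration degree \<open>m\<close> forces page \<open>m + 1\<close> to vanish (\<open>page_trivial_if_contractible\<close>).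

  Any digraph that represents \<open>M\<^sub>r\<close> of \<open>G\<close> for \<open>r = r\<^sub>j\<close> is isometric to \<open>A\<^sub>j\<close>
  (\<open>minimal_retract_isometric\<close>): the two composites of a homotopy equivalence between finite
  minimal spaces are homotopic to identities, some power of such an endomap is idempotent, its
  image is a deformation retract and hence the whole space, so this power is the identity. Along
  the isometry the complex of the digraph becomes the image of \<open>P\<^sub>j\<close>, which is the sum of the
  subcomplexes with index greater than \<open>j\<close>.

  The chain level identities are verified for integral formal sums of arbitrary lists, where the
  boundary and the prism operator satisfy simple recursions, and are then carried over to chains
  with coefficients in \<open>R\<close> and to regular tuples (\<open>realize\<close>).
\<close>

section \<open>Subquotients of modules\<close>

text \<open>The module laws of a quotient are the images of the laws of the module; this avoids
  verifying them for sums and multiples of cosets.\<close>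

lemma module_surjective_image:
  assumes "Module.module R M" and f: "carrier N = f ` carrier M" "f \<zero>\<^bsub>M\<^esub> = \<zero>\<^bsub>N\<^esub>"
    and add: "\<And>x y. x \<in> carrier M \<Longrightarrow> y \<in> carrier M \<Longrightarrow> f (x \<oplus>\<^bsub>M\<^esub> y) = f x \<oplus>\<^bsub>N\<^esub> f y"
    and smult: "\<And>a x. a \<in> carrier R \<Longrightarrow> x \<in> carrier M \<Longrightarrow> f (a \<odot>\<^bsub>M\<^esub> x) = a \<odot>\<^bsub>N\<^esub> f x"
  shows "Module.module R N"
proof -
  interpret M: Module.module R M by fact
  have ex: "\<exists>y\<in>carrier N. y \<oplus>\<^bsub>N\<^esub> z = \<zero>\<^bsub>N\<^esub>" if z: "z \<in> carrier N" for z
  proof -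
    obtain x where x: "x \<in> carrier M" "z = f x" using z f(1) by auto
    have "f (\<ominus>\<^bsub>M\<^esub> x) \<oplus>\<^bsub>N\<^esub> f x = \<zero>\<^bsub>N\<^esub>"
      using add[of "\<ominus>\<^bsub>M\<^esub> x" x] x f(2) by (simp add: M.M.l_neg)
    then show ?thesis using x f(1) by auto
  qed
  have "abelian_group N"
    by (rule abelian_groupI)
      (use f(1) f(2)[symmetric] ex in \<open>auto simp flip: add simp: M.M.a_ac\<close>)
  then show ?thesis
    by (intro moduleI) (use f(1) in \<open>auto simp flip: add smult
      simp: M.smult_l_distr M.smult_r_distr M.smult_assoc1 M.R.is_cring\<close>)
qed

lemma a_r_coset_update_carrier [simp]: "a_r_coset (M\<lparr>carrier := Z\<rparr>) = a_r_coset M"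
  by (simp add: a_r_coset_def r_coset_def fun_eq_iff)

lemma set_add_update_carrier [simp]: "set_add (M\<lparr>carrier := Z\<rparr>) = set_add M"
  by (simp add: set_add_def set_mult_def fun_eq_iff)

lemma mem_a_r_coset: "y \<in> N +>\<^bsub>M\<^esub> x \<longleftrightarrow> (\<exists>h\<in>N. y = h \<oplus>\<^bsub>M\<^esub> x)"
  by (auto simp: a_r_coset_def')

lemma mem_set_add: "x \<in> A <+>\<^bsub>M\<^esub> B \<longleftrightarrow> (\<exists>a\<in>A. \<exists>b\<in>B. x = a \<oplus>\<^bsub>M\<^esub> b)"
  by (auto simp: set_add_def')

context Module.module
begin

lemma submodule_zero: "submodule N R M \<Longrightarrow> \<zero>\<^bsub>M\<^esub> \<in> N"
  by (metis submodule.axioms(1) subgroup.one_closed monoid.select_convs(2))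

lemma submodule_sub: "submodule N R M \<Longrightarrow> x \<in> N \<Longrightarrow> x \<in> carrier M"
  using submoduleE(1) by blast

lemma submodule_minus: "submodule N R M \<Longrightarrow> x \<in> N \<Longrightarrow> y \<in> N \<Longrightarrow> x \<ominus>\<^bsub>M\<^esub> y \<in> N"
  unfolding a_minus_def using submoduleE(3,5) by blast

lemma submodule_abelian_subgroup:
  assumes "submodule N R M" shows "abelian_subgroup N M"
  using assms M.a_comm_group by (intro abelian_subgroupI2) (auto dest: submodule.axioms)

lemma submodule_in_submodule:
  assumes Z: "submodule Z R M" and N: "submodule N R M" "N \<subseteq> Z"
  shows "submodule N R (M\<lparr>carrier := Z\<rparr>)"
proof -
  interpret Z: Module.module R "M\<lparr>carrier := Z\<rparr>"
    using submodule.submodule_is_module[OF Z module_axioms] .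
  have "Module.module R (M\<lparr>carrier := Z\<rparr>\<lparr>carrier := N\<rparr>)"
    using submodule.submodule_is_module[OF N(1) module_axioms] by simp
  then show ?thesis using N(2) by (intro Z.module_incl_imp_submodule) auto
qed

lemma set_add_submodule:
  assumes A: "submodule A R M" and B: "submodule B R M"
  shows "submodule (A <+>\<^bsub>M\<^esub> B) R M"
proof (rule submoduleI)
  note s = submodule_sub[OF A] submodule_sub[OF B]
  show "A <+>\<^bsub>M\<^esub> B \<subseteq> carrier M" by (auto simp: mem_set_add s)
  show "\<zero>\<^bsub>M\<^esub> \<in> A <+>\<^bsub>M\<^esub> B"
    using submodule_zero[OF A] submodule_zero[OF B] by (force simp: mem_set_add)
  show "\<ominus>\<^bsub>M\<^esub> x \<in> A <+>\<^bsub>M\<^esub> B" if x: "x \<in> A <+>\<^bsub>M\<^esub> B" for x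
  proof -
    obtain a b where ab: "a \<in> A" "b \<in> B" "x = a \<oplus>\<^bsub>M\<^esub> b" using x by (auto simp: mem_set_add)
    then have "\<ominus>\<^bsub>M\<^esub> x = \<ominus>\<^bsub>M\<^esub> a \<oplus>\<^bsub>M\<^esub> \<ominus>\<^bsub>M\<^esub> b" by (simp add: s M.minus_add)
    then show ?thesis using ab submoduleE(3)[OF A] submoduleE(3)[OF B] by (auto simp: mem_set_add)
  qed
  show "x \<oplus>\<^bsub>M\<^esub> y \<in> A <+>\<^bsub>M\<^esub> B" if x: "x \<in> A <+>\<^bsub>M\<^esub> B" "y \<in> A <+>\<^bsub>M\<^esub> B" for x y
  proof -
    obtain a b where ab: "a \<in> A" "b \<in> B" "x = a \<oplus>\<^bsub>M\<^esub> b" using x by (auto simp: mem_set_add)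
    obtain a' b' where ab': "a' \<in> A" "b' \<in> B" "y = a' \<oplus>\<^bsub>M\<^esub> b'" using x by (auto simp: mem_set_add)
    have "x \<oplus>\<^bsub>M\<^esub> y = (a \<oplus>\<^bsub>M\<^esub> a') \<oplus>\<^bsub>M\<^esub> (b \<oplus>\<^bsub>M\<^esub> b')"
      using ab ab' by (simp add: s M.a_ac)
    then show ?thesis using ab ab' submoduleE(5)[OF A] submoduleE(5)[OF B]
      unfolding mem_set_add by blast
  qed
  show "k \<odot>\<^bsub>M\<^esub> x \<in> A <+>\<^bsub>M\<^esub> B" if x: "k \<in> carrier R" "x \<in> A <+>\<^bsub>M\<^esub> B" for k x
  proof -
    obtain a b where ab: "a \<in> A" "b \<in> B" "x = a \<oplus>\<^bsub>M\<^esub> b" using x by (auto simp: mem_set_add)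
    then have "k \<odot>\<^bsub>M\<^esub> x = k \<odot>\<^bsub>M\<^esub> a \<oplus>\<^bsub>M\<^esub> k \<odot>\<^bsub>M\<^esub> b" by (simp add: s x smult_r_distr)
    then show ?thesis using ab x submoduleE(4)[OF A] submoduleE(4)[OF B]
      unfolding mem_set_add by blast
  qed
qed

lemma coset_add:
  assumes "submodule N R M" "x \<in> carrier M" "y \<in> carrier M"
  shows "(N +>\<^bsub>M\<^esub> x) <+>\<^bsub>M\<^esub> (N +>\<^bsub>M\<^esub> y) = N +>\<^bsub>M\<^esub> (x \<oplus>\<^bsub>M\<^esub> y)"
  by (rule abelian_subgroup.a_rcos_sum[OF submodule_abelian_subgroup]) (fact assms)+

lemma coset_zero:
  assumes "submodule N R M" shows "N +>\<^bsub>M\<^esub> \<zero>\<^bsub>M\<^esub> = N"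
  using submoduleE(1)[OF assms] by simp

lemma coset_eq_iff:
  assumes "submodule N R M" "x \<in> carrier M" "y \<in> carrier M"
  shows "N +>\<^bsub>M\<^esub> x = N +>\<^bsub>M\<^esub> y \<longleftrightarrow> x \<ominus>\<^bsub>M\<^esub> y \<in> N"
proof -
  interpret N: abelian_subgroup N M using submodule_abelian_subgroup[OF assms(1)] .
  have "N +>\<^bsub>M\<^esub> x = N +>\<^bsub>M\<^esub> y \<longleftrightarrow> x \<in> N +>\<^bsub>M\<^esub> y"
    using N.a_repr_independence' N.a_repr_independenceD assms by metis
  then show ?thesis using N.a_rcos_module assms by (simp add: a_minus_def)
qed

lemma coset_eq_zero_iff:
  assumes "submodule N R M" "x \<in> carrier M"
  shows "N +>\<^bsub>M\<^esub> x = N \<longleftrightarrow> x \<in> N"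
proof -
  have "x \<ominus>\<^bsub>M\<^esub> \<zero>\<^bsub>M\<^esub> = x" using assms(2) by (simp add: a_minus_def)
  then show ?thesis
    using coset_eq_iff[OF assms M.zero_closed] coset_zero[OF assms(1)] by simp
qed

lemma coset_smult:
  assumes N: "submodule N R M" and a: "a \<in> carrier R" "x \<in> carrier M"
  shows "(\<Union>y\<in>N +>\<^bsub>M\<^esub> x. N +>\<^bsub>M\<^esub> (a \<odot>\<^bsub>M\<^esub> y)) = N +>\<^bsub>M\<^esub> (a \<odot>\<^bsub>M\<^esub> x)"
proof -
  have "N +>\<^bsub>M\<^esub> (a \<odot>\<^bsub>M\<^esub> (h \<oplus>\<^bsub>M\<^esub> x)) = N +>\<^bsub>M\<^esub> (a \<odot>\<^bsub>M\<^esub> x)" if h: "h \<in> N" for h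
  proof -
    have hM: "h \<in> carrier M" using submodule_sub[OF N h] .
    have "a \<odot>\<^bsub>M\<^esub> (h \<oplus>\<^bsub>M\<^esub> x) \<ominus>\<^bsub>M\<^esub> a \<odot>\<^bsub>M\<^esub> x = a \<odot>\<^bsub>M\<^esub> h"
      using a hM by (simp add: smult_r_distr a_minus_def M.a_assoc M.r_neg)
    then show ?thesis using coset_eq_iff[OF N] hM a submoduleE(4)[OF N] h by simp
  qed
  moreover have "N \<noteq> {}" using submoduleE(2)[OF N] .
  ultimately show ?thesis by (auto simp: a_r_coset_def')
qed

end

lemma subquotient_simps:
  fixes M :: "('k, 'a) module"
  assumes M: "Module.module R M" and Z: "submodule Z R M" and N: "submodule N R M"
  shows "carrier (quotient_module (M\<lparr>carrier := Z\<rparr>) N) = (\<lambda>x. N +>\<^bsub>M\<^esub> x) ` Z"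
    and "\<zero>\<^bsub>quotient_module (M\<lparr>carrier := Z\<rparr>) N\<^esub> = N"
    and "x \<in> Z \<Longrightarrow> y \<in> Z \<Longrightarrow>
      (N +>\<^bsub>M\<^esub> x) \<oplus>\<^bsub>quotient_module (M\<lparr>carrier := Z\<rparr>) N\<^esub> (N +>\<^bsub>M\<^esub> y) = N +>\<^bsub>M\<^esub> (x \<oplus>\<^bsub>M\<^esub> y)"
    and "a \<in> carrier R \<Longrightarrow> x \<in> Z \<Longrightarrow>
      a \<odot>\<^bsub>quotient_module (M\<lparr>carrier := Z\<rparr>) N\<^esub> (N +>\<^bsub>M\<^esub> x) = N +>\<^bsub>M\<^esub> (a \<odot>\<^bsub>M\<^esub> x)"
proof -
  interpret M: Module.module R M by fact
  have cs: "a_rcosets\<^bsub>M\<lparr>carrier := Z\<rparr>\<^esub> N = (\<lambda>x. N +>\<^bsub>M\<^esub> x) ` Z"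
    by (auto simp: A_RCOSETS_def RCOSETS_def a_r_coset_def r_coset_def)
  show "carrier (quotient_module (M\<lparr>carrier := Z\<rparr>) N) = (\<lambda>x. N +>\<^bsub>M\<^esub> x) ` Z"
    "\<zero>\<^bsub>quotient_module (M\<lparr>carrier := Z\<rparr>) N\<^esub> = N"
    by (simp_all add: quotient_module_def cs)
  show "x \<in> Z \<Longrightarrow> y \<in> Z \<Longrightarrow>
      (N +>\<^bsub>M\<^esub> x) \<oplus>\<^bsub>quotient_module (M\<lparr>carrier := Z\<rparr>) N\<^esub> (N +>\<^bsub>M\<^esub> y) = N +>\<^bsub>M\<^esub> (x \<oplus>\<^bsub>M\<^esub> y)"
    using M.coset_add[OF N] M.submodule_sub[OF Z] by (simp add: quotient_module_def)
  show "a \<in> carrier R \<Longrightarrow> x \<in> Z \<Longrightarrow>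
      a \<odot>\<^bsub>quotient_module (M\<lparr>carrier := Z\<rparr>) N\<^esub> (N +>\<^bsub>M\<^esub> x) = N +>\<^bsub>M\<^esub> (a \<odot>\<^bsub>M\<^esub> x)"
    using M.coset_smult[OF N] M.submodule_sub[OF Z] by (simp add: quotient_module_def)
qed

lemma subquotient_module:
  fixes M :: "('k, 'a) module"
  assumes M: "Module.module R M" and Z: "submodule Z R M" and N: "submodule N R M"
  shows "Module.module R (quotient_module (M\<lparr>carrier := Z\<rparr>) N)"
  using submodule.submodule_is_module[OF Z M]
  by (rule module_surjective_image[where f = "\<lambda>x. N +>\<^bsub>M\<^esub> x"])
    (simp_all add: subquotient_simps[OF assms] module.coset_zero[OF M N])

subsection \<open>Linear maps\<close>

locale linear_map = M: Module.module R M + N: Module.module R N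
  for R :: "'k ring" and M :: "('k, 'a) module" and N :: "('k, 'b) module" +
  fixes f
  assumes linear: "f \<in> linear_maps R M N"
begin

lemma closed [simp]: "x \<in> carrier M \<Longrightarrow> f x \<in> carrier N"
  using linear by (auto simp: linear_maps_def)

lemma add: "x \<in> carrier M \<Longrightarrow> y \<in> carrier M \<Longrightarrow> f (x \<oplus>\<^bsub>M\<^esub> y) = f x \<oplus>\<^bsub>N\<^esub> f y"
  using linear by (auto simp: linear_maps_def)

lemma smult: "a \<in> carrier R \<Longrightarrow> x \<in> carrier M \<Longrightarrow> f (a \<odot>\<^bsub>M\<^esub> x) = a \<odot>\<^bsub>N\<^esub> f x"
  using linear by (auto simp: linear_maps_def)

lemma abelian_group_hom: "abelian_group_hom M N f"
  using M.M.abelian_group_axioms N.M.abelian_group_axioms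
  by (intro abelian_group_homI group_hom.intro group_hom_axioms.intro)
    (auto simp: add hom_def abelian_group.a_group)

lemma zero: "f \<zero>\<^bsub>M\<^esub> = \<zero>\<^bsub>N\<^esub>"
  using abelian_group_hom.hom_zero[OF abelian_group_hom] .

lemma neg: "x \<in> carrier M \<Longrightarrow> f (\<ominus>\<^bsub>M\<^esub> x) = \<ominus>\<^bsub>N\<^esub> f x"
  using abelian_group_hom.hom_a_inv[OF abelian_group_hom] .

lemma minus: "x \<in> carrier M \<Longrightarrow> y \<in> carrier M \<Longrightarrow> f (x \<ominus>\<^bsub>M\<^esub> y) = f x \<ominus>\<^bsub>N\<^esub> f y"
  by (simp add: a_minus_def add neg)

lemma image_submodule:
  assumes H: "submodule H R M" shows "submodule (f ` H) R N"
proof (rule N.submoduleI)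
  note s = M.submodule_sub[OF H]
  show "f ` H \<subseteq> carrier N" using s by auto
  show "\<zero>\<^bsub>N\<^esub> \<in> f ` H" using M.submodule_zero[OF H] zero by force
  show "\<ominus>\<^bsub>N\<^esub> a \<in> f ` H" if "a \<in> f ` H" for a
    using that M.submoduleE(3)[OF H] s by (auto simp flip: neg)
  show "a \<oplus>\<^bsub>N\<^esub> b \<in> f ` H" if "a \<in> f ` H" "b \<in> f ` H" for a b
    using that M.submoduleE(5)[OF H] s by (auto simp flip: add)
  show "a \<odot>\<^bsub>N\<^esub> b \<in> f ` H" if "a \<in> carrier R" "b \<in> f ` H" for a b
    using that M.submoduleE(4)[OF H] s by (auto simp flip: smult)
qed

lemma preimage_submodule:
  assumes H: "submodule H R M" and K: "submodule K R N"
  shows "submodule {x \<in> H. f x \<in> K} R M"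
proof (rule M.submoduleI)
  note s = M.submodule_sub[OF H]
  show "{x \<in> H. f x \<in> K} \<subseteq> carrier M" using s by auto
  show "\<zero>\<^bsub>M\<^esub> \<in> {x \<in> H. f x \<in> K}"
    using M.submodule_zero[OF H] N.submodule_zero[OF K] zero by force
qed (use M.submodule_sub[OF H] M.submoduleE(3-5)[OF H] N.submoduleE(3-5)[OF K]
    in \<open>auto simp: add neg smult\<close>)

text \<open>The maps induced on quotients are defined by unions over all representatives; all of them
  contribute the same coset.\<close>

lemma image_coset:
  assumes B: "submodule B R M" and C: "submodule C R N" and BC: "f ` B \<subseteq> C"
    and x: "x \<in> carrier M"
  shows "(\<Union>y\<in>B +>\<^bsub>M\<^esub> x. C +>\<^bsub>N\<^esub> f y) = C +>\<^bsub>N\<^esub> f x"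
proof -
  have "C +>\<^bsub>N\<^esub> f (b \<oplus>\<^bsub>M\<^esub> x) = C +>\<^bsub>N\<^esub> f x" if b: "b \<in> B" for b
  proof -
    have bM: "b \<in> carrier M" using M.submodule_sub[OF B b] .
    have "f (b \<oplus>\<^bsub>M\<^esub> x) \<ominus>\<^bsub>N\<^esub> f x = f b"
      using x bM by (simp add: add a_minus_def N.M.a_assoc N.M.r_neg)
    then show ?thesis using N.coset_eq_iff[OF C] bM x BC b by auto
  qed
  then show ?thesis using M.submoduleE(2)[OF B] by (auto simp: a_r_coset_def')
qed

end

section \<open>The spectral sequence of a filtered complex\<close>

text \<open>
  The cycles, boundaries and pages below are indexed by the filtration degree \<open>p\<close> and by the degree
  \<open>n = p + q\<close> of chains instead of \<open>q\<close>, so that the index of the ambient chain module does not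
  involve the page.
\<close>

record ('k, 'c) filtered_cx =
  chain :: "int \<Rightarrow> ('k, 'c) module"
  filt :: "int \<Rightarrow> int \<Rightarrow> 'c set"
  bdry :: "int \<Rightarrow> 'c \<Rightarrow> 'c"

definition cyc :: "('k, 'c) filtered_cx \<Rightarrow> nat \<Rightarrow> int \<Rightarrow> int \<Rightarrow> 'c set" where
  "cyc F r p n = {c \<in> filt F p n. bdry F n c \<in> filt F (p - int r) (n - 1)}"

definition bnd :: "('k, 'c) filtered_cx \<Rightarrow> nat \<Rightarrow> int \<Rightarrow> int \<Rightarrow> 'c set" where
  "bnd F r p n = cyc F (r - 1) (p - 1) n <+>\<^bsub>chain F n\<^esub>
     bdry F (n + 1) ` cyc F (r - 1) (p + int r - 1) (n + 1)"

definition cls :: "('k, 'c) filtered_cx \<Rightarrow> nat \<Rightarrow> int \<Rightarrow> int \<Rightarrow> 'c \<Rightarrow> 'c set" where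
  "cls F r p n c = bnd F r p n +>\<^bsub>chain F n\<^esub> c"

definition page :: "('k, 'c) filtered_cx \<Rightarrow> nat \<Rightarrow> int \<Rightarrow> int \<Rightarrow> ('k, 'c set) module" where
  "page F r p n = quotient_module ((chain F n)\<lparr>carrier := cyc F r p n\<rparr>) (bnd F r p n)"

definition fc_ss :: "('k, 'c) filtered_cx \<Rightarrow> ('k, 'c set) spectral_seq" where
  "fc_ss F =
     \<lparr>ss_page = (\<lambda>r p q. page F r p (p + q)),
      ss_diff = (\<lambda>r p q C. \<Union>c\<in>C. cls F r (p - int r) (p + q - 1) (bdry F (p + q) c)),
      ss_next = (\<lambda>r p q h. \<Union>h \<inter> cyc F (Suc r) p (p + q))\<rparr>"

locale filtered_complex =
  fixes R :: "'k ring" and F :: "('k, 'c) filtered_cx"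
  assumes chain_module: "Module.module R (chain F n)"
    and filt_submodule: "submodule (filt F p n) R (chain F n)"
    and filt_Suc: "filt F (p - 1) n \<subseteq> filt F p n"
    and bdry_linear: "bdry F n \<in> linear_maps R (chain F n) (chain F (n - 1))"
    and bdry_filt: "c \<in> filt F p n \<Longrightarrow> bdry F n c \<in> filt F p (n - 1)"
    and bdry_bdry: "c \<in> carrier (chain F n) \<Longrightarrow>
      bdry F (n - 1) (bdry F n c) = \<zero>\<^bsub>chain F (n - 1 - 1)\<^esub>"
begin

sublocale C: Module.module R "chain F n" for n
  by (rule chain_module)

sublocale d: linear_map R "chain F n" "chain F (n - 1)" "bdry F n" for n
  by unfold_locales (rule bdry_linear)

lemma filt_mono:
  assumes "p \<le> p'" shows "filt F p n \<subseteq> filt F p' n"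
proof -
  have "filt F (p' - int k) n \<subseteq> filt F p' n" for k
  proof (induction k)
    case (Suc k)
    have "filt F (p' - int (Suc k)) n \<subseteq> filt F (p' - int k) n"
      using filt_Suc[of "p' - int k" n] by (simp add: algebra_simps)
    then show ?case using Suc by blast
  qed simp
  from this[of "nat (p' - p)"] show ?thesis using assms by simp
qed

lemma filt_sub: "c \<in> filt F p n \<Longrightarrow> c \<in> carrier (chain F n)"
  using C.submodule_sub[OF filt_submodule] .

lemma cyc_submodule: "submodule (cyc F r p n) R (chain F n)"
  unfolding cyc_def by (rule d.preimage_submodule[OF filt_submodule filt_submodule])

lemma cyc_closed:
  shows cyc_zero: "\<zero>\<^bsub>chain F n\<^esub> \<in> cyc F r p n"
    and cyc_add: "x \<in> cyc F r p n \<Longrightarrow> y \<in> cyc F r p n \<Longrightarrow> x \<oplus>\<^bsub>chain F n\<^esub> y \<in> cyc F r p n"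
    and cyc_minus: "x \<in> cyc F r p n \<Longrightarrow> y \<in> cyc F r p n \<Longrightarrow> x \<ominus>\<^bsub>chain F n\<^esub> y \<in> cyc F r p n"
    and cyc_smult: "a \<in> carrier R \<Longrightarrow> x \<in> cyc F r p n \<Longrightarrow> a \<odot>\<^bsub>chain F n\<^esub> x \<in> cyc F r p n"
  by (rule C.submodule_zero C.submoduleE(4,5) C.submodule_minus; (rule cyc_submodule | assumption))+

lemma bnd_submodule: "submodule (bnd F r p n) R (chain F n)"
  unfolding bnd_def
  using d.image_submodule[OF cyc_submodule, of "n + 1"]
  by (intro C.set_add_submodule cyc_submodule) simp

lemma cyc_sub: "c \<in> cyc F r p n \<Longrightarrow> c \<in> carrier (chain F n)"
  by (rule C.submodule_sub[OF cyc_submodule])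

lemma mem_bnd: "x \<in> bnd F r p n \<longleftrightarrow> (\<exists>a\<in>cyc F (r - 1) (p - 1) n.
    \<exists>b\<in>cyc F (r - 1) (p + int r - 1) (n + 1). x = a \<oplus>\<^bsub>chain F n\<^esub> bdry F (n + 1) b)"
  by (auto simp: bnd_def mem_set_add)

lemma bdry_closed':
  "c \<in> carrier (chain F (n + 1)) \<Longrightarrow> bdry F (n + 1) c \<in> carrier (chain F n)"
  using d.closed[of c "n + 1"] by simp

lemma bdry_bdry': "c \<in> carrier (chain F (n + 1)) \<Longrightarrow> bdry F n (bdry F (n + 1) c) = \<zero>\<^bsub>chain F (n - 1)\<^esub>"
  using bdry_bdry[of c "n + 1"] by simp

lemma cyc_bdry:
  assumes "c \<in> cyc F r p n" shows "bdry F n c \<in> cyc F s (p - int r) (n - 1)"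
  using assms bdry_bdry cyc_sub[OF assms] C.submodule_zero[OF filt_submodule]
  by (auto simp: cyc_def)

lemma cyc_bdry':
  assumes "c \<in> cyc F r p (n + 1)" shows "bdry F (n + 1) c \<in> cyc F s (p - int r) n"
  using cyc_bdry[OF assms] by simp

lemma cyc_mono:
  assumes "p \<le> p'" "p - int r \<le> p' - int r'" shows "cyc F r p n \<subseteq> cyc F r' p' n"
  using assms filt_mono unfolding cyc_def by blast

lemma bdry_mem_bnd:
  assumes b: "b \<in> cyc F (r - 1) (p + int r - 1) (n + 1)"
  shows "bdry F (n + 1) b \<in> bnd F r p n"
  unfolding mem_bnd
proof (intro bexI)
  show "bdry F (n + 1) b = \<zero>\<^bsub>chain F n\<^esub> \<oplus>\<^bsub>chain F n\<^esub> bdry F (n + 1) b"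
    using bdry_closed'[OF cyc_sub[OF b]] by simp
qed (use b cyc_zero in auto)

lemma cyc_mem_bnd:
  assumes a: "a \<in> cyc F (r - 1) (p - 1) n"
  shows "a \<in> bnd F r p n"
  unfolding mem_bnd
proof (intro bexI)
  have "bdry F (n + 1) \<zero>\<^bsub>chain F (n + 1)\<^esub> = \<zero>\<^bsub>chain F n\<^esub>" using d.zero[of "n + 1"] by simp
  then show "a = a \<oplus>\<^bsub>chain F n\<^esub> bdry F (n + 1) \<zero>\<^bsub>chain F (n + 1)\<^esub>"
    using cyc_sub[OF a] by simp
qed (use a cyc_zero in auto)

lemma bdry_bnd:
  assumes "c \<in> bnd F r p n" "1 \<le> r"
  shows "bdry F n c \<in> bnd F r (p - int r) (n - 1)"
proof -
  obtain a b where a: "a \<in> cyc F (r - 1) (p - 1) n" and b: "b \<in> cyc F (r - 1) (p + int r - 1) (n + 1)"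
    and c: "c = a \<oplus>\<^bsub>chain F n\<^esub> bdry F (n + 1) b" using assms by (auto simp: mem_bnd)
  have "bdry F n c = bdry F n a"
    using cyc_sub[OF a] cyc_sub[OF b] c by (simp add: d.add bdry_bdry' bdry_closed')
  then show ?thesis using bdry_mem_bnd[of a r "p - int r" "n - 1"] a by simp
qed

lemma page_carrier: "carrier (page F r p n) = cls F r p n ` cyc F r p n"
  unfolding page_def cls_def by (rule subquotient_simps[OF chain_module cyc_submodule bnd_submodule])

lemma page_zero: "\<zero>\<^bsub>page F r p n\<^esub> = bnd F r p n"
  unfolding page_def cls_def by (rule subquotient_simps[OF chain_module cyc_submodule bnd_submodule])

lemma page_add: "x \<in> cyc F r p n \<Longrightarrow> y \<in> cyc F r p n \<Longrightarrow>
    cls F r p n x \<oplus>\<^bsub>page F r p n\<^esub> cls F r p n y = cls F r p n (x \<oplus>\<^bsub>chain F n\<^esub> y)"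
  unfolding page_def cls_def by (rule subquotient_simps[OF chain_module cyc_submodule bnd_submodule])

lemma page_smult: "a \<in> carrier R \<Longrightarrow> x \<in> cyc F r p n \<Longrightarrow>
    a \<odot>\<^bsub>page F r p n\<^esub> cls F r p n x = cls F r p n (a \<odot>\<^bsub>chain F n\<^esub> x)"
  unfolding page_def cls_def by (rule subquotient_simps[OF chain_module cyc_submodule bnd_submodule])

lemma page_module: "Module.module R (page F r p n)"
  unfolding page_def by (rule subquotient_module[OF chain_module cyc_submodule bnd_submodule])

sublocale P: Module.module R "page F r p n" for r p n
  by (rule page_module)

lemma cls_eq_iff: "x \<in> cyc F r p n \<Longrightarrow> y \<in> cyc F r p n \<Longrightarrow>
    cls F r p n x = cls F r p n y \<longleftrightarrow> x \<ominus>\<^bsub>chain F n\<^esub> y \<in> bnd F r p n"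
  unfolding cls_def by (rule C.coset_eq_iff[OF bnd_submodule cyc_sub cyc_sub])

lemma cls_eq_zero_iff: "x \<in> cyc F r p n \<Longrightarrow> cls F r p n x = \<zero>\<^bsub>page F r p n\<^esub> \<longleftrightarrow> x \<in> bnd F r p n"
  unfolding cls_def page_zero by (rule C.coset_eq_zero_iff[OF bnd_submodule cyc_sub])

lemma cls_closed: "x \<in> cyc F r p n \<Longrightarrow> cls F r p n x \<in> carrier (page F r p n)"
  by (simp add: page_carrier)

lemma ss_page [simp]: "ss_page (fc_ss F) r p q = page F r p (p + q)"
  by (simp add: fc_ss_def)

lemma diff_cls:
  assumes "x \<in> cyc F r p (p + q)" "1 \<le> r"
  shows "ss_diff (fc_ss F) r p q (cls F r p (p + q) x) =
    cls F r (p - int r) (p + q - 1) (bdry F (p + q) x)"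
  unfolding fc_ss_def cls_def
  using d.image_coset[OF bnd_submodule bnd_submodule, of "p + q" r p r "p - int r" x]
    bdry_bnd assms cyc_sub by (auto simp: image_subset_iff)

lemma shift_degrees: "p - int r + (q + int r - 1) = p + q - 1" "p + int r + (q - int r + 1) = p + q + 1"
  by simp_all

lemma ss_diff_linear:
  assumes "1 \<le> r"
  shows "ss_diff (fc_ss F) r p q \<in> linear_maps R (ss_page (fc_ss F) r p q)
    (ss_page (fc_ss F) r (p - int r) (q + int r - 1))"
proof -
  have "bdry F (p + q) x \<in> cyc F r (p - int r) (p + q - 1)" if "x \<in> cyc F r p (p + q)" for x
    using cyc_bdry[OF that] .
  then show ?thesis
    using assms cyc_add cyc_smult cyc_sub[of _ r p "p + q"]
    by (auto simp: linear_maps_def shift_degrees page_carrier page_add page_smult diff_cls d.add d.smult)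
qed

text \<open>A class is a cycle iff it has a representative whose boundary drops one filtration step
  further. If the boundary of \<open>c\<close> vanishes on the page, it is \<open>a\<close> plus the boundary of some \<open>b\<close> of
  lower filtration, and subtracting \<open>b\<close> from \<open>c\<close> does not change the class of \<open>c\<close>.\<close>

lemma ss_cycles:
  assumes "1 \<le> r"
  shows "ss_cycles (fc_ss F) r p q = cls F r p (p + q) ` cyc F (Suc r) p (p + q)"
proof (intro Set.equalityI Set.subsetI)
  fix C assume "C \<in> ss_cycles (fc_ss F) r p q"
  then obtain c where c: "c \<in> cyc F r p (p + q)" "C = cls F r p (p + q) c"
    and "cls F r (p - int r) (p + q - 1) (bdry F (p + q) c) =
      \<zero>\<^bsub>page F r (p - int r) (p + q - 1)\<^esub>"
    using assms by (auto simp: ss_cycles_def page_carrier diff_cls shift_degrees)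
  then have "bdry F (p + q) c \<in> bnd F r (p - int r) (p + q - 1)"
    using cyc_bdry[OF c(1), of r] by (simp add: cls_eq_zero_iff)
  then obtain a b where a: "a \<in> cyc F (r - 1) (p - int r - 1) (p + q - 1)"
    and b: "b \<in> cyc F (r - 1) (p - 1) (p + q)"
    and e: "bdry F (p + q) c = a \<oplus>\<^bsub>chain F (p + q - 1)\<^esub> bdry F (p + q) b"
    by (auto simp: mem_bnd)
  note s = cyc_sub[OF a] cyc_sub[OF b] cyc_sub[OF c(1)]
  let ?c = "c \<ominus>\<^bsub>chain F (p + q)\<^esub> b"
  have "bdry F (p + q) ?c = a"
    using s e by (simp add: a_minus_def d.add d.neg C.M.a_assoc C.M.r_neg)
  moreover have "?c \<in> filt F p (p + q)"
  proof (rule C.submodule_minus[OF filt_submodule])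
    show "c \<in> filt F p (p + q)" "b \<in> filt F p (p + q)"
      using b c(1) filt_Suc by (auto simp: cyc_def)
  qed
  ultimately have c': "?c \<in> cyc F (Suc r) p (p + q)"
    using a by (auto simp: cyc_def algebra_simps)
  have "?c \<in> cyc F r p (p + q)" using cyc_mono[of p p "Suc r" r] c' by auto
  moreover have "b \<in> bnd F r p (p + q)" using cyc_mem_bnd b by blast
  moreover have "c \<ominus>\<^bsub>chain F (p + q)\<^esub> ?c = b"
    using s by (simp add: a_minus_def C.M.minus_add C.M.a_assoc[symmetric] C.M.r_neg)
  ultimately have "C = cls F r p (p + q) ?c" using c by (simp add: cls_eq_iff)
  then show "C \<in> cls F r p (p + q) ` cyc F (Suc r) p (p + q)" using c' by blast
next
  fix C assume "C \<in> cls F r p (p + q) ` cyc F (Suc r) p (p + q)"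
  then obtain c where c: "c \<in> cyc F (Suc r) p (p + q)" "C = cls F r p (p + q) c" by blast
  have c': "c \<in> cyc F r p (p + q)" using cyc_mono[of p p "Suc r" r] c(1) by auto
  have "bdry F (p + q) c \<in> bnd F r (p - int r) (p + q - 1)"
    using cyc_bdry[OF c(1), of "r - 1"] by (intro cyc_mem_bnd) (simp add: algebra_simps)
  then show "C \<in> ss_cycles (fc_ss F) r p q"
    using c c' assms cyc_bdry[OF c', of r]
    by (simp add: ss_cycles_def cls_closed diff_cls shift_degrees cls_eq_zero_iff)
qed

lemma ss_boundaries:
  assumes "1 \<le> r"
  shows "ss_boundaries (fc_ss F) r p q =
    (\<lambda>b. cls F r p (p + q) (bdry F (p + q + 1) b)) ` cyc F r (p + int r) (p + q + 1)"
  using diff_cls[of _ r "p + int r" "q - int r + 1"] assms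
  by (auto simp: ss_boundaries_def page_carrier image_image shift_degrees)

lemma ss_boundaries_cycles:
  assumes "1 \<le> r"
  shows "ss_boundaries (fc_ss F) r p q \<subseteq> ss_cycles (fc_ss F) r p q"
  using cyc_bdry'[of _ r "p + int r" "p + q" "Suc r"] assms
  by (auto simp: ss_boundaries ss_cycles)

lemma ss_diff_linear_map:
  assumes "1 \<le> r"
  shows "linear_map R (page F r p (p + q)) (page F r (p - int r) (p + q - 1))
    (ss_diff (fc_ss F) r p q)"
  using ss_diff_linear[OF assms, of p q] page_module
  by (simp add: shift_degrees linear_map_def linear_map_axioms_def)

lemma ss_cycles_submodule:
  assumes "1 \<le> r"
  shows "submodule (ss_cycles (fc_ss F) r p q) R (page F r p (p + q))"
proof -
  have "submodule {\<zero>\<^bsub>page F r (p - int r) (p + q - 1)\<^esub>} R (page F r (p - int r) (p + q - 1))"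
    by (rule P.submoduleI) simp_all
  then show ?thesis
    using linear_map.preimage_submodule[OF ss_diff_linear_map[OF assms] P.carrier_is_submodule]
    by (fastforce simp add: ss_cycles_def shift_degrees)
qed

lemma ss_boundaries_submodule:
  assumes "1 \<le> r"
  shows "submodule (ss_boundaries (fc_ss F) r p q) R (page F r p (p + q))"
  using linear_map.image_submodule[OF ss_diff_linear_map[OF assms, of "p + int r" "q - int r + 1"]
      P.carrier_is_submodule]
  by (simp add: ss_boundaries_def)

lemma ss_class_cls:
  "ss_class (fc_ss F) r p q (cls F r p (p + q) c) =
    ss_boundaries (fc_ss F) r p q +>\<^bsub>page F r p (p + q)\<^esub> cls F r p (p + q) c"
  by (simp add: ss_class_def)

text \<open>The homology class of \<open>c\<close>, flattened to a set of chains, is the sum of \<open>c\<close>, the boundaries of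
  page \<open>r\<close> and the boundaries that the differential of page \<open>r\<close> adds. What survives the
  intersection with the cycles of page \<open>r + 1\<close> is the coset of \<open>c\<close> on that page, because the
  component \<open>u\<close> of lower filtration then has to be a cycle of page \<open>r + 1\<close> itself.\<close>

lemma next_cls:
  assumes r: "1 \<le> r" and c: "c \<in> cyc F (Suc r) p (p + q)"
  shows "ss_next (fc_ss F) r p q (ss_class (fc_ss F) r p q (cls F r p (p + q) c)) =
    cls F (Suc r) p (p + q) c"
proof -
  let ?n = "p + q"
  have c': "c \<in> cyc F r p ?n" using cyc_mono[of p p "Suc r" r] c(1) by auto
  have "ss_class (fc_ss F) r p q (cls F r p ?n c) =
      (\<lambda>b. cls F r p ?n (bdry F (?n + 1) b \<oplus>\<^bsub>chain F ?n\<^esub> c)) ` cyc F r (p + int r) (?n + 1)"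
    using cyc_bdry'[of _ r "p + int r" ?n r] c' r
    by (auto simp: ss_class_cls ss_boundaries a_r_coset_def' page_add)
  then have U: "y \<in> \<Union>(ss_class (fc_ss F) r p q (cls F r p ?n c)) \<longleftrightarrow>
    (\<exists>x\<in>bnd F r p ?n. \<exists>b\<in>cyc F r (p + int r) (?n + 1).
       y = x \<oplus>\<^bsub>chain F ?n\<^esub> (bdry F (?n + 1) b \<oplus>\<^bsub>chain F ?n\<^esub> c))" for y
    by (auto simp: cls_def mem_a_r_coset)
  have "y \<in> \<Union>(ss_class (fc_ss F) r p q (cls F r p ?n c)) \<and> y \<in> cyc F (Suc r) p ?n \<longleftrightarrow>
    y \<in> cls F (Suc r) p ?n c" for y
  proof
    assume "y \<in> \<Union>(ss_class (fc_ss F) r p q (cls F r p ?n c)) \<and> y \<in> cyc F (Suc r) p ?n"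
    then obtain x b where x: "x \<in> bnd F r p ?n" and b: "b \<in> cyc F r (p + int r) (?n + 1)"
      and y: "y = x \<oplus>\<^bsub>chain F ?n\<^esub> (bdry F (?n + 1) b \<oplus>\<^bsub>chain F ?n\<^esub> c)" "y \<in> cyc F (Suc r) p ?n"
      using U by blast
    obtain u v where u: "u \<in> cyc F (r - 1) (p - 1) ?n"
      and v: "v \<in> cyc F (r - 1) (p + int r - 1) (?n + 1)"
      and xuv: "x = u \<oplus>\<^bsub>chain F ?n\<^esub> bdry F (?n + 1) v" using x by (auto simp: mem_bnd)
    let ?w = "v \<oplus>\<^bsub>chain F (?n + 1)\<^esub> b"
    note s = cyc_sub[OF u] cyc_sub[OF v] cyc_sub[OF b] cyc_sub[OF c] cyc_sub[OF y(2)]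
    have "v \<in> cyc F r (p + int r) (?n + 1)"
      using v r cyc_mono[of "p + int r - 1" "p + int r" "r - 1" r] by auto
    then have w: "?w \<in> cyc F r (p + int r) (?n + 1)"
      using b cyc_add by blast
    have y': "y = u \<oplus>\<^bsub>chain F ?n\<^esub> bdry F (?n + 1) ?w \<oplus>\<^bsub>chain F ?n\<^esub> c"
      using s y(1) xuv d.add[of v "?n + 1" b] by (simp add: C.M.a_assoc bdry_closed')
    have u0: "u = y \<ominus>\<^bsub>chain F ?n\<^esub> c \<ominus>\<^bsub>chain F ?n\<^esub> bdry F (?n + 1) ?w"
      using s by (simp add: y' a_minus_def C.M.a_assoc C.M.r_neg bdry_closed')
    have "bdry F (?n + 1) ?w \<in> cyc F (Suc r) p ?n"
      using cyc_bdry'[OF w, of "Suc r"] by simp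
    then have "u \<in> cyc F (Suc r) p ?n"
      unfolding u0 using y(2) c by (intro cyc_minus)
    then have u': "u \<in> cyc F r (p - 1) ?n" using u by (auto simp: cyc_def algebra_simps)
    then show "y \<in> cls F (Suc r) p ?n c"
      unfolding cls_def mem_a_r_coset using w y' u'
      by (intro bexI[of _ "u \<oplus>\<^bsub>chain F ?n\<^esub> bdry F (?n + 1) ?w"]) (auto simp: mem_bnd)
  next
    assume "y \<in> cls F (Suc r) p ?n c"
    then obtain u b where u: "u \<in> cyc F r (p - 1) ?n" and b: "b \<in> cyc F r (p + int r) (?n + 1)"
      and y: "y = u \<oplus>\<^bsub>chain F ?n\<^esub> bdry F (?n + 1) b \<oplus>\<^bsub>chain F ?n\<^esub> c"
      by (auto simp: cls_def mem_a_r_coset mem_bnd)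
    note s = cyc_sub[OF u] cyc_sub[OF b] cyc_sub[OF c]
    have "u \<in> bnd F r p ?n" using u cyc_mono[of "p - 1" "p - 1" r "r - 1"] r
      by (intro cyc_mem_bnd) auto
    moreover have "y = u \<oplus>\<^bsub>chain F ?n\<^esub> (bdry F (?n + 1) b \<oplus>\<^bsub>chain F ?n\<^esub> c)"
      using s y by (simp add: C.M.a_assoc bdry_closed')
    moreover have "y \<in> cyc F (Suc r) p ?n"
    proof -
      have "u \<in> cyc F (Suc r) p ?n" using u cyc_mono[of "p - 1" p r "Suc r"] by auto
      moreover have "bdry F (?n + 1) b \<in> cyc F (Suc r) p ?n"
        using cyc_bdry'[OF b, of "Suc r"] by simp
      ultimately show ?thesis unfolding y
        using c by (intro cyc_add)
    qed
    ultimately show "y \<in> \<Union>(ss_class (fc_ss F) r p q (cls F r p ?n c)) \<and> y \<in> cyc F (Suc r) p ?n"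
      using U b by blast
  qed
  then show ?thesis by (auto simp: fc_ss_def)
qed

text \<open>
  By \<open>next_cls\<close>, the map from the homology of page \<open>r\<close> to page \<open>r + 1\<close> sends the class of \<open>c\<close> to the
  class of \<open>c\<close> for every cycle \<open>c\<close> of page \<open>r + 1\<close>, which makes it linear and surjective. It is
  injective because a boundary of page \<open>r + 1\<close> is a boundary of page \<open>r\<close> plus \<open>\<partial>b\<close> for a cycle \<open>b\<close>
  of page \<open>r\<close>, and the class of \<open>\<partial>b\<close> is a value of the differential.
\<close>

lemma spectral_sequence: "spectral_sequence R (fc_ss F)"
proof -
  have "ss_next (fc_ss F) r p q \<in> linear_isos R (ss_homology (fc_ss F) r p q)
    (ss_page (fc_ss F) (Suc r) p q)"
    if r: "1 \<le> r" for r p q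
  proof -
    let ?n = "p + q"
    note sq = subquotient_simps[OF page_module ss_cycles_submodule[OF r, of p q]
      ss_boundaries_submodule[OF r, of p q]]
    let ?h = "\<lambda>c. ss_boundaries (fc_ss F) r p q +>\<^bsub>page F r p ?n\<^esub> cls F r p ?n c"
    have H: "ss_homology (fc_ss F) r p q =
      quotient_module ((page F r p ?n)\<lparr>carrier := ss_cycles (fc_ss F) r p q\<rparr>) (ss_boundaries (fc_ss F) r p q)"
      by (simp add: ss_homology_def)
    have car: "carrier (ss_homology (fc_ss F) r p q) = ?h ` cyc F (Suc r) p ?n"
      unfolding H sq by (simp add: ss_cycles[OF r] image_image)
    have nx: "ss_next (fc_ss F) r p q (?h c) = cls F (Suc r) p ?n c" if "c \<in> cyc F (Suc r) p ?n" for c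
      using next_cls[OF r that] by (simp add: ss_class_cls)
    note cy = subsetD[OF cyc_mono[of p p "Suc r" r ?n, simplified]]
    have zc: "cls F r p ?n c \<in> ss_cycles (fc_ss F) r p q" if "c \<in> cyc F (Suc r) p ?n" for c
      using that by (simp add: ss_cycles[OF r])
    have add: "?h x \<oplus>\<^bsub>ss_homology (fc_ss F) r p q\<^esub> ?h y = ?h (x \<oplus>\<^bsub>chain F ?n\<^esub> y)"
      if "x \<in> cyc F (Suc r) p ?n" "y \<in> cyc F (Suc r) p ?n" for x y
      unfolding H using that zc by (simp add: sq page_add cy)
    have smult: "a \<odot>\<^bsub>ss_homology (fc_ss F) r p q\<^esub> ?h x = ?h (a \<odot>\<^bsub>chain F ?n\<^esub> x)"
      if "a \<in> carrier R" "x \<in> cyc F (Suc r) p ?n" for a x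
      unfolding H using that zc by (simp add: sq page_smult cy)
    have inj: "inj_on (ss_next (fc_ss F) r p q) (?h ` cyc F (Suc r) p ?n)"
    proof (rule inj_onI)
      fix X Y assume "X \<in> ?h ` cyc F (Suc r) p ?n" "Y \<in> ?h ` cyc F (Suc r) p ?n"
      then obtain x y where x: "x \<in> cyc F (Suc r) p ?n" "X = ?h x"
        and y: "y \<in> cyc F (Suc r) p ?n" "Y = ?h y" by blast
      assume "ss_next (fc_ss F) r p q X = ss_next (fc_ss F) r p q Y"
      then have "x \<ominus>\<^bsub>chain F ?n\<^esub> y \<in> bnd F (Suc r) p ?n"
        using x y by (simp add: nx cls_eq_iff)
      then obtain a b where a: "a \<in> cyc F r (p - 1) ?n" and b: "b \<in> cyc F r (p + int r) (?n + 1)"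
        and e: "x \<ominus>\<^bsub>chain F ?n\<^esub> y = a \<oplus>\<^bsub>chain F ?n\<^esub> bdry F (?n + 1) b"
        by (auto simp: mem_bnd)
      have a': "a \<in> bnd F r p ?n" using a cyc_mono[of "p - 1" "p - 1" r "r - 1"] r
        by (intro cyc_mem_bnd) auto
      have b': "bdry F (?n + 1) b \<in> cyc F r p ?n" using cyc_bdry'[OF b, of r] by simp
      note s = cyc_sub[OF a] cyc_sub[OF b'] cyc_sub[OF x(1)] cyc_sub[OF y(1)]
      let ?b = "bdry F (?n + 1) b"
      have "x = (x \<ominus>\<^bsub>chain F ?n\<^esub> y) \<oplus>\<^bsub>chain F ?n\<^esub> y"
        using s by (simp add: a_minus_def C.M.a_assoc C.M.l_neg)
      then have xe: "x = a \<oplus>\<^bsub>chain F ?n\<^esub> (?b \<oplus>\<^bsub>chain F ?n\<^esub> y)"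
        using s by (simp add: e C.M.a_assoc)
      have by': "?b \<oplus>\<^bsub>chain F ?n\<^esub> y \<in> cyc F r p ?n"
        using cyc_add b' cy[OF y(1)] by blast
      have "x \<ominus>\<^bsub>chain F ?n\<^esub> (?b \<oplus>\<^bsub>chain F ?n\<^esub> y) = a"
        using s by (subst xe) (simp add: a_minus_def C.M.a_assoc C.M.r_neg)
      then have "cls F r p ?n x = cls F r p ?n (?b \<oplus>\<^bsub>chain F ?n\<^esub> y)"
        using cls_eq_iff[OF cy[OF x(1)] by'] a' by simp
      also have "\<dots> = cls F r p ?n ?b \<oplus>\<^bsub>page F r p ?n\<^esub> cls F r p ?n y"
        using b' cy[OF y(1)] by (simp add: page_add)
      finally have "cls F r p ?n x \<ominus>\<^bsub>page F r p ?n\<^esub> cls F r p ?n y = cls F r p ?n ?b"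
        using cls_closed[OF b'] cls_closed[OF cy[OF y(1)]]
          by (simp add: a_minus_def P.M.a_assoc P.M.r_neg)
      then have "cls F r p ?n x \<ominus>\<^bsub>page F r p ?n\<^esub> cls F r p ?n y \<in> ss_boundaries (fc_ss F) r p q"
        using b r by (auto simp: ss_boundaries)
      then show "X = Y" using x y cls_closed[OF cy]
        by (simp add: P.coset_eq_iff[OF ss_boundaries_submodule[OF r]])
    qed
    have "bij_betw (ss_next (fc_ss F) r p q) (carrier (ss_homology (fc_ss F) r p q))
      (carrier (page F (Suc r) p ?n))"
      unfolding bij_betw_def car page_carrier using inj nx by (auto simp: image_iff)
    moreover have "ss_next (fc_ss F) r p q \<in>
      linear_maps R (ss_homology (fc_ss F) r p q) (page F (Suc r) p ?n)"
      using cyc_add cyc_smult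
      by (auto simp: linear_maps_def car nx cls_closed add smult page_add page_smult)
    ultimately show ?thesis by (simp add: linear_isos_def)
  qed
  then show ?thesis
    unfolding spectral_sequence_def
    using ss_diff_linear ss_boundaries_cycles page_module by auto
qed

end

section \<open>Filtered chain maps\<close>

definition page_map ::
    "('k, 'd) filtered_cx \<Rightarrow> (int \<Rightarrow> 'c \<Rightarrow> 'd) \<Rightarrow> nat \<Rightarrow> int \<Rightarrow> int \<Rightarrow> 'c set \<Rightarrow> 'd set" where
  "page_map F' f r p q C = (\<Union>c\<in>C. cls F' r p (p + q) (f (p + q) c))"

locale filtered_map = F: filtered_complex R F + F': filtered_complex R F'
  for R :: "'k ring" and F :: "('k, 'c) filtered_cx" and F' :: "('k, 'd) filtered_cx" +
  fixes f :: "int \<Rightarrow> 'c \<Rightarrow> 'd"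
  assumes linear: "f n \<in> linear_maps R (chain F n) (chain F' n)"
    and filt: "c \<in> filt F p n \<Longrightarrow> f n c \<in> filt F' p n"
    and commute: "c \<in> carrier (chain F n) \<Longrightarrow> f (n - 1) (bdry F n c) = bdry F' n (f n c)"
begin

lemma linear_map: "linear_map R (chain F n) (chain F' n) (f n)"
  using linear F.chain_module F'.chain_module by (simp add: linear_map_def linear_map_axioms_def)

lemmas closed = linear_map.closed[OF linear_map]
  and add = linear_map.add[OF linear_map]
  and minus = linear_map.minus[OF linear_map]
  and smult = linear_map.smult[OF linear_map]

lemma cyc: "c \<in> cyc F r p n \<Longrightarrow> f n c \<in> cyc F' r p n"
  using filt commute[of c n, symmetric] F.filt_sub by (auto simp: cyc_def)

lemma bnd: 
  assumes c: "c \<in> bnd F r p n" shows "f n c \<in> bnd F' r p n"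
proof -
  obtain a b where ab: "a \<in> cyc F (r - 1) (p - 1) n" "b \<in> cyc F (r - 1) (p + int r - 1) (n + 1)"
    "c = a \<oplus>\<^bsub>chain F n\<^esub> bdry F (n + 1) b" using c by (auto simp: F.mem_bnd)
  note s = F.cyc_sub[OF ab(1)] F.cyc_sub[OF ab(2)]
  have "f n c = f n a \<oplus>\<^bsub>chain F' n\<^esub> bdry F' (n + 1) (f (n + 1) b)"
    using s ab(3) commute[OF s(2)] by (simp add: add F.bdry_closed')
  then show ?thesis unfolding F'.mem_bnd using cyc ab(1,2) by blast
qed

lemma page_map_cls:
  assumes "c \<in> cyc F r p (p + q)"
  shows "page_map F' f r p q (cls F r p (p + q) c) = cls F' r p (p + q) (f (p + q) c)"
  unfolding page_map_def cls_def
  using bnd F.cyc_sub[OF assms]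
  by (intro linear_map.image_coset[OF linear_map F.bnd_submodule F'.bnd_submodule]) auto

lemma page_map_linear: "page_map F' f r p q \<in> linear_maps R (page F r p (p + q)) (page F' r p (p + q))"
  using F.cyc_add F.cyc_smult F.cyc_sub
  by (auto simp: linear_maps_def F.page_carrier F'.page_carrier page_map_cls cyc F.page_add
      F'.page_add F.page_smult F'.page_smult add smult)

lemma page_map_diff:
  assumes "x \<in> carrier (page F r p (p + q))" "1 \<le> r"
  shows "page_map F' f r (p - int r) (q + int r - 1) (ss_diff (fc_ss F) r p q x) =
    ss_diff (fc_ss F') r p q (page_map F' f r p q x)"
proof -
  obtain c where c: "c \<in> cyc F r p (p + q)" "x = cls F r p (p + q) c"
    using assms by (auto simp: F.page_carrier)
  have "bdry F (p + q) c \<in> cyc F r (p - int r) (p + q - 1)" using F.cyc_bdry[OF c(1)] .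
  then show ?thesis
    using c assms page_map_cls[of "bdry F (p + q) c" r "p - int r" "q + int r - 1"]
      commute[OF F.cyc_sub[OF c(1)]]
    by (simp add: F.diff_cls F'.diff_cls page_map_cls cyc F.shift_degrees)
qed

lemma page_map_next:
  assumes "x \<in> ss_cycles (fc_ss F) r p q" "1 \<le> r"
  shows "page_map F' f (Suc r) p q (ss_next (fc_ss F) r p q (ss_class (fc_ss F) r p q x)) =
    ss_next (fc_ss F') r p q (ss_class (fc_ss F') r p q (page_map F' f r p q x))"
proof -
  obtain c where c: "c \<in> cyc F (Suc r) p (p + q)" "x = cls F r p (p + q) c"
    using assms by (auto simp: F.ss_cycles)
  have "c \<in> cyc F r p (p + q)" using F.cyc_mono[of p p "Suc r" r] c(1) by auto
  then show ?thesis using c assms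
    by (simp add: page_map_cls F.next_cls F'.next_cls cyc)
qed

end

lemma filtered_iso_ss_isomorphic:
  assumes f: "filtered_map R F F' f" and g: "filtered_map R F' F g"
    and gf: "\<And>n c. c \<in> carrier (chain F n) \<Longrightarrow> g n (f n c) = c"
    and fg: "\<And>n c. c \<in> carrier (chain F' n) \<Longrightarrow> f n (g n c) = c"
  shows "ss_isomorphic R (fc_ss F) (fc_ss F')"
proof -
  interpret f: filtered_map R F F' f by fact
  interpret g: filtered_map R F' F g by fact
  have "bij_betw (page_map F' f r p q) (carrier (page F r p (p + q))) (carrier (page F' r p (p + q)))"
    for r p q
  proof (rule bij_betwI[where g = "page_map F g r p q"])
    show "page_map F' f r p q \<in> carrier (page F r p (p + q)) \<rightarrow> carrier (page F' r p (p + q))"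
      "page_map F g r p q \<in> carrier (page F' r p (p + q)) \<rightarrow> carrier (page F r p (p + q))"
      using f.page_map_linear g.page_map_linear by (auto simp: linear_maps_def)
  qed (auto simp: f.F.page_carrier f.F'.page_carrier f.page_map_cls g.page_map_cls f.cyc g.cyc
      gf[OF f.F.cyc_sub] fg[OF f.F'.cyc_sub])
  then have "page_map F' f \<in> ss_isos R (fc_ss F) (fc_ss F')"
    using f.page_map_linear f.page_map_diff f.page_map_next
    by (simp add: ss_isos_def linear_isos_def)
  then show ?thesis by (auto simp: ss_isomorphic_def)
qed

text \<open>Each boundary of one summand extends by zero to a boundary of the direct sum; hence
  projecting a homology class of the sum gives the whole class in the summand.\<close>

lemma class_direct_sum:
  assumes C: "\<And>i. i \<in> I \<Longrightarrow> filtered_complex R (C i)" and I: "finite I" and i: "i \<in> I"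
    and x: "x \<in> carrier (ss_page (ss_direct_sum I (\<lambda>i. fc_ss (C i))) r p q)"
  shows "(\<lambda>x. x i) ` ss_class (ss_direct_sum I (\<lambda>i. fc_ss (C i))) r p q x =
    ss_class (fc_ss (C i)) r p q (x i)"
proof -
  let ?S = "ss_direct_sum I (\<lambda>i. fc_ss (C i))"
  let ?p = "p + int r" and ?q = "q - int r + 1"
  have page: "ss_page (fc_ss (C j)) r p q = page (C j) r p (p + q)" for j r p q
    by (simp add: fc_ss_def)
  interpret filtered_complex R "C i" using C i by blast
  have b: "(\<lambda>x. x i) ` ss_boundaries ?S r p q = ss_boundaries (fc_ss (C i)) r p q"
  proof (intro Set.equalityI Set.subsetI)
    fix b assume "b \<in> ss_boundaries (fc_ss (C i)) r p q"
    then obtain y where y: "y \<in> carrier (ss_page (fc_ss (C i)) r ?p ?q)"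
      "b = ss_diff (fc_ss (C i)) r ?p ?q y" by (auto simp: ss_boundaries_def)
    let ?y = "\<lambda>j\<in>I. if j = i then y else \<zero>\<^bsub>ss_page (fc_ss (C j)) r ?p ?q\<^esub>"
    have "\<zero>\<^bsub>ss_page (fc_ss (C j)) r ?p ?q\<^esub> \<in> carrier (ss_page (fc_ss (C j)) r ?p ?q)" if "j \<in> I" for j
    proof -
      interpret j: filtered_complex R "C j" using C that by blast
      show ?thesis unfolding page by (rule j.P.zero_closed)
    qed
    then have "?y \<in> carrier (ss_page ?S r ?p ?q)"
      using y(1) I by (auto simp: ss_direct_sum_def direct_sum_def)
    then have "ss_diff ?S r ?p ?q ?y \<in> ss_boundaries ?S r p q" by (simp add: ss_boundaries_def)
    moreover have "b = ss_diff ?S r ?p ?q ?y i" using i y(2) by (simp add: ss_direct_sum_def)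
    ultimately show "b \<in> (\<lambda>x. x i) ` ss_boundaries ?S r p q" by blast
  next
    fix b assume "b \<in> (\<lambda>x. x i) ` ss_boundaries ?S r p q"
    then obtain y where y: "y \<in> carrier (ss_page ?S r ?p ?q)" "b = ss_diff ?S r ?p ?q y i"
      unfolding ss_boundaries_def by blast
    have "y i \<in> carrier (ss_page (fc_ss (C i)) r ?p ?q)"
      using y(1) i unfolding ss_direct_sum_def direct_sum_def by (auto simp del: ss_page)
    moreover have "b = ss_diff (fc_ss (C i)) r ?p ?q (y i)"
      using y(2) i by (simp add: ss_direct_sum_def)
    ultimately show "b \<in> ss_boundaries (fc_ss (C i)) r p q" unfolding ss_boundaries_def by blast
  qed
  have "(h \<oplus>\<^bsub>ss_page ?S r p q\<^esub> x) i = h i \<oplus>\<^bsub>ss_page (fc_ss (C i)) r p q\<^esub> x i" for h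
    using i by (simp add: ss_direct_sum_def direct_sum_def)
  then show ?thesis unfolding ss_class_def b[symmetric] a_r_coset_def' by (simp add: image_UN)
qed

text \<open>
  A direct sum decomposition of a filtered complex, with projections \<open>\<pi>\<close> and inclusions \<open>\<iota>\<close>, gives
  a direct sum decomposition of its spectral sequence. That a chain is the sum of its components
  enters as \<open>gen\<close>: a submodule that contains all components contains the chain. Applied to the
  submodule of boundaries this is injectivity on pages, without any finite sums of chains;
  surjectivity is proved by adding one component at a time.
\<close>

lemma filtered_decomposition_ss_isomorphic:
  assumes F: "filtered_complex R F" and I: "finite I"
    and \<pi>: "\<And>i. i \<in> I \<Longrightarrow> filtered_map R F (C i) (\<pi> i)"
    and \<iota>: "\<And>i. i \<in> I \<Longrightarrow> filtered_map R (C i) F (\<iota> i)"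
    and \<pi>\<iota>: "\<And>i n c. i \<in> I \<Longrightarrow> c \<in> carrier (chain (C i) n) \<Longrightarrow> \<pi> i n (\<iota> i n c) = c"
    and orth: "\<And>i j n c. i \<in> I \<Longrightarrow> j \<in> I \<Longrightarrow> i \<noteq> j \<Longrightarrow> c \<in> carrier (chain (C j) n) \<Longrightarrow>
      \<pi> i n (\<iota> j n c) = \<zero>\<^bsub>chain (C i) n\<^esub>"
    and gen: "\<And>n c N. c \<in> carrier (chain F n) \<Longrightarrow> submodule N R (chain F n) \<Longrightarrow>
      (\<And>i. i \<in> I \<Longrightarrow> \<iota> i n (\<pi> i n c) \<in> N) \<Longrightarrow> c \<in> N"
  shows "ss_isomorphic R (fc_ss F) (ss_direct_sum I (\<lambda>i. fc_ss (C i)))"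
proof -
  let ?S = "ss_direct_sum I (\<lambda>i. fc_ss (C i))"
  let ?f = "\<lambda>r p q x. \<lambda>i\<in>I. page_map (C i) (\<pi> i) r p q x"
  interpret F: filtered_complex R F by fact
  have page: "ss_page (fc_ss (C j)) r p q = page (C j) r p (p + q)" for j r p q
    by (simp add: fc_ss_def)
  have S_page: "ss_page ?S r p q = direct_sum I (\<lambda>i. page (C i) r p (p + q))" for r p q
    by (simp add: ss_direct_sum_def page)
  have C: "filtered_complex R (C i)" if "i \<in> I" for i
    using \<pi>[OF that] by (simp add: filtered_map_def)
  have lin: "page_map (C i) (\<pi> i) r p q \<in> linear_maps R (page F r p (p + q)) (page (C i) r p (p + q))"
    if "i \<in> I" for i r p q
    using filtered_map.page_map_linear[OF \<pi>[OF that]] .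
  have flin: "?f r p q \<in> linear_maps R (page F r p (p + q)) (ss_page ?S r p q)" for r p q
  proof -
    have "?f r p q x \<in> carrier (ss_page ?S r p q)" if "x \<in> carrier (page F r p (p + q))" for x
      using lin that I by (fastforce simp: S_page direct_sum_def linear_maps_def)
    then show ?thesis
      using lin unfolding linear_maps_def S_page direct_sum_def by (auto simp: fun_eq_iff Pi_iff)
  qed
  have inj: "inj_on (?f r p q) (carrier (page F r p (p + q)))" for r p q
  proof (rule inj_onI)
    fix x y assume "x \<in> carrier (page F r p (p + q))" "y \<in> carrier (page F r p (p + q))"
    then obtain c d where c: "c \<in> cyc F r p (p + q)" "x = cls F r p (p + q) c"
      and d: "d \<in> cyc F r p (p + q)" "y = cls F r p (p + q) d" by (auto simp: F.page_carrier)
    assume eq: "?f r p q x = ?f r p q y"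
    let ?c = "c \<ominus>\<^bsub>chain F (p + q)\<^esub> d"
    have "?c \<in> bnd F r p (p + q)"
    proof (rule gen[OF _ F.bnd_submodule])
      show "?c \<in> carrier (chain F (p + q))" using F.cyc_minus[OF c(1) d(1)] F.cyc_sub by blast
      fix i assume i: "i \<in> I"
      interpret \<pi>: filtered_map R F "C i" "\<pi> i" using \<pi>[OF i] .
      interpret \<iota>: filtered_map R "C i" F "\<iota> i" using \<iota>[OF i] .
      have "page_map (C i) (\<pi> i) r p q x = page_map (C i) (\<pi> i) r p q y"
        using fun_cong[OF eq, of i] i by simp
      then have "\<pi> i (p + q) c \<ominus>\<^bsub>chain (C i) (p + q)\<^esub> \<pi> i (p + q) d \<in> bnd (C i) r p (p + q)"
        using c d by (simp add: \<pi>.page_map_cls \<pi>.F'.cls_eq_iff \<pi>.cyc)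
      then have "\<pi> i (p + q) ?c \<in> bnd (C i) r p (p + q)"
        using c d F.cyc_sub by (simp add: \<pi>.minus)
      then show "\<iota> i (p + q) (\<pi> i (p + q) ?c) \<in> bnd F r p (p + q)" by (rule \<iota>.bnd)
    qed
    then show "x = y" using c d by (simp add: F.cls_eq_iff)
  qed
  have surj: "\<exists>x\<in>carrier (page F r p (p + q)). ?f r p q x = y"
    if y: "y \<in> carrier (ss_page ?S r p q)" for r p q y
  proof -
    let ?n = "p + q"
    have "\<forall>i\<in>I. \<exists>c. c \<in> cyc (C i) r p ?n \<and> y i = cls (C i) r p ?n c"
    proof
      fix i assume i: "i \<in> I"
      have "y i \<in> carrier (page (C i) r p ?n)"
        using y i unfolding S_page direct_sum_def by auto
      then show "\<exists>c. c \<in> cyc (C i) r p ?n \<and> y i = cls (C i) r p ?n c"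
        unfolding filtered_complex.page_carrier[OF C[OF i]] by blast
    qed
    then obtain c where "\<forall>i\<in>I. c i \<in> cyc (C i) r p ?n \<and> y i = cls (C i) r p ?n (c i)"
      by (rule bchoice[THEN exE])
    then have c: "c i \<in> cyc (C i) r p ?n" "y i = cls (C i) r p ?n (c i)" if "i \<in> I" for i
      using that by blast+
    have "\<exists>x\<in>cyc F r p ?n. \<forall>i\<in>I. \<pi> i ?n x = (if i \<in> J then c i else \<zero>\<^bsub>chain (C i) ?n\<^esub>)"
      if "finite J" "J \<subseteq> I" for J
      using that
    proof (induction J)
      case empty
      have "\<pi> i ?n \<zero>\<^bsub>chain F ?n\<^esub> = \<zero>\<^bsub>chain (C i) ?n\<^esub>" if "i \<in> I" for i
        using linear_map.zero[OF filtered_map.linear_map[OF \<pi>[OF that]]] .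
      then show ?case by (intro bexI[of _ "\<zero>\<^bsub>chain F ?n\<^esub>"] F.cyc_zero) simp
    next
      case (insert j J)
      then obtain x where x: "x \<in> cyc F r p ?n"
        "\<And>i. i \<in> I \<Longrightarrow> \<pi> i ?n x = (if i \<in> J then c i else \<zero>\<^bsub>chain (C i) ?n\<^esub>)" by auto
      have j: "j \<in> I" using insert by simp
      let ?z = "\<iota> j ?n (c j)"
      have z: "?z \<in> cyc F r p ?n" using filtered_map.cyc[OF \<iota>[OF j] c(1)[OF j]] .
      have "\<pi> i ?n (x \<oplus>\<^bsub>chain F ?n\<^esub> ?z) = (if i \<in> insert j J then c i else \<zero>\<^bsub>chain (C i) ?n\<^esub>)"
        if i: "i \<in> I" for i
      proof -
        interpret \<pi>: filtered_map R F "C i" "\<pi> i" using \<pi>[OF i] .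
        have cj: "c j \<in> carrier (chain (C j) ?n)"
          using filtered_complex.cyc_sub[OF C[OF j] c(1)[OF j]] .
        have ci: "c i \<in> carrier (chain (C i) ?n)" using \<pi>.F'.cyc_sub[OF c(1)[OF i]] .
        have e: "\<pi> i ?n (x \<oplus>\<^bsub>chain F ?n\<^esub> ?z) = \<pi> i ?n x \<oplus>\<^bsub>chain (C i) ?n\<^esub> \<pi> i ?n ?z"
          using \<pi>.add[OF F.cyc_sub[OF x(1)] F.cyc_sub[OF z]] .
        show ?thesis
        proof (cases "i = j")
          case True
          have "\<pi> i ?n ?z = c i" using \<pi>\<iota>[OF j cj] True by simp
          moreover have "\<pi> i ?n x = \<zero>\<^bsub>chain (C i) ?n\<^esub>" using x(2)[OF i] True insert.hyps by simp
          ultimately show ?thesis unfolding e using \<pi>.F'.C.M.l_zero[OF ci] True by simp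
        next
          case False
          have "\<pi> i ?n x \<in> carrier (chain (C i) ?n)" using \<pi>.closed[OF F.cyc_sub[OF x(1)]] .
          then have "\<pi> i ?n x \<oplus>\<^bsub>chain (C i) ?n\<^esub> \<pi> i ?n ?z = \<pi> i ?n x"
            unfolding orth[OF i j False cj] by (rule \<pi>.F'.C.M.r_zero)
          then show ?thesis unfolding e using x(2)[OF i] False by simp
        qed
      qed
      then show ?case using F.cyc_add[OF x(1) z] by blast
    qed
    from this[OF I subset_refl] obtain x
      where x: "x \<in> cyc F r p ?n" "\<And>i. i \<in> I \<Longrightarrow> \<pi> i ?n x = c i" by auto
    have "?f r p q (cls F r p ?n x) i = y i" for i
    proof (cases "i \<in> I")
      case True
      then show ?thesis
        using filtered_map.page_map_cls[OF \<pi>[OF True] x(1)] x(2)[OF True] c(2)[OF True] by simp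
    next
      case False
      have "y \<in> Pi\<^sub>E I (\<lambda>i. carrier (page (C i) r p ?n))"
        using y unfolding S_page direct_sum_def by simp
      from PiE_arb[OF this False] show ?thesis using False by simp
    qed
    then show ?thesis by (intro bexI[OF _ F.cls_closed[OF x(1)]] ext)
  qed
  have "?f r p q \<in> linear_isos R (page F r p (p + q)) (ss_page ?S r p q)" for r p q
    using flin inj surj unfolding linear_isos_def bij_betw_def
    by (fastforce simp: linear_maps_def)
  moreover have "?f r (p - int r) (q + int r - 1) (ss_diff (fc_ss F) r p q x) = ss_diff ?S r p q (?f r p q x)"
    if "1 \<le> r" "x \<in> carrier (page F r p (p + q))" for r p q x
    using filtered_map.page_map_diff[OF \<pi>] that
    by (auto simp: ss_direct_sum_def cong: restrict_cong)
  moreover have "?f (Suc r) p q (ss_next (fc_ss F) r p q (ss_class (fc_ss F) r p q x)) =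
      ss_next ?S r p q (ss_class ?S r p q (?f r p q x))"
    if r: "1 \<le> r" and x: "x \<in> ss_cycles (fc_ss F) r p q" for r p q x
  proof -
    have "x \<in> carrier (page F r p (p + q))" using x by (simp add: ss_cycles_def)
    moreover have "?f r p q \<in> carrier (page F r p (p + q)) \<rightarrow> carrier (ss_page ?S r p q)"
      using flin[of r p q] unfolding linear_maps_def by blast
    ultimately have fx: "?f r p q x \<in> carrier (ss_page ?S r p q)" by (rule funcset_mem[rotated])
    have "ss_next ?S r p q (ss_class ?S r p q (?f r p q x)) =
        (\<lambda>i\<in>I. ss_next (fc_ss (C i)) r p q (ss_class (fc_ss (C i)) r p q (?f r p q x i)))"
      using class_direct_sum[OF C I _ fx]
      by (simp add: ss_direct_sum_def cong: restrict_cong)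
    then show ?thesis using filtered_map.page_map_next[OF \<pi> x r] by (auto simp: fun_eq_iff)
  qed
  ultimately have "?f \<in> ss_isos R (fc_ss F) ?S" by (simp add: ss_isos_def)
  then show ?thesis by (auto simp: ss_isomorphic_def)
qed

subsection \<open>Contracting homotopies\<close>

text \<open>If \<open>c = \<partial>h c + h \<partial>c\<close> is a cycle of page \<open>m + 1\<close>, then \<open>\<partial>c\<close> has dropped by \<open>m + 1\<close>
  filtration steps and \<open>h\<close> regains only \<open>m\<close> of them. So \<open>h \<partial>c\<close> lies one step lower than \<open>c\<close>, and
  \<open>c\<close> is the sum of the two kinds of boundaries of that page.\<close>

lemma (in filtered_complex) page_trivial_if_contractible:
  assumes h_filt: "\<And>p n c. c \<in> filt F p n \<Longrightarrow> h n c \<in> filt F (p + int m) (n + 1)"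
    and h: "\<And>n c. c \<in> carrier (chain F n) \<Longrightarrow>
      c = bdry F (n + 1) (h n c) \<oplus>\<^bsub>chain F n\<^esub> h (n - 1) (bdry F n c)"
  shows "carrier (page F (Suc m) p n) = {\<zero>\<^bsub>page F (Suc m) p n\<^esub>}"
proof -
  have "c \<in> bnd F (Suc m) p n" if c: "c \<in> cyc F (Suc m) p n" for c
  proof -
    let ?a = "h (n - 1) (bdry F n c)" and ?b = "h n c"
    have cF: "c \<in> filt F p n" "bdry F n c \<in> filt F (p - int (Suc m)) (n - 1)"
      using c by (auto simp: cyc_def)
    have a: "?a \<in> filt F (p - 1) n" using h_filt[OF cF(2)] by simp
    have b: "?b \<in> filt F (p + int m) (n + 1)" using h_filt[OF cF(1)] .
    have b': "bdry F (n + 1) ?b \<in> carrier (chain F n)" using bdry_closed'[OF filt_sub[OF b]] .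
    note e = h[OF cyc_sub[OF c]]
    \<comment> \<open>\<open>?a\<close> has the same boundary as \<open>c\<close>, which therefore drops far enough.\<close>
    have "bdry F n c = bdry F n (bdry F (n + 1) ?b) \<oplus>\<^bsub>chain F (n - 1)\<^esub> bdry F n ?a"
      using d.add[OF b' filt_sub[OF a]] e by simp
    then have "bdry F n ?a = bdry F n c"
      using bdry_bdry'[OF filt_sub[OF b]] filt_sub[OF a] by simp
    then have ac: "?a \<in> cyc F m (p - 1) n" using a cF by (simp add: cyc_def algebra_simps)
    have "c \<ominus>\<^bsub>chain F n\<^esub> ?a = bdry F (n + 1) ?b"
      using b' filt_sub[OF a] by (subst e) (simp add: a_minus_def C.M.a_assoc C.M.r_neg)
    moreover have "c \<ominus>\<^bsub>chain F n\<^esub> ?a \<in> filt F p n"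
      using cF(1) a filt_Suc by (intro C.submodule_minus[OF filt_submodule]) auto
    ultimately have bc: "?b \<in> cyc F m (p + int m) (n + 1)" using b by (simp add: cyc_def)
    have "c = ?a \<oplus>\<^bsub>chain F n\<^esub> bdry F (n + 1) ?b"
      using e b' filt_sub[OF a] by (simp add: C.M.a_comm)
    then show ?thesis using ac bc by (auto simp: mem_bnd)
  qed
  then have "cls F (Suc m) p n c = \<zero>\<^bsub>page F (Suc m) p n\<^esub>" if "c \<in> cyc F (Suc m) p n" for c
    using cls_eq_zero_iff that by blast
  then show ?thesis using cyc_zero by (force simp: page_carrier)
qed

subsection \<open>Subcomplexes\<close>

definition sub_cx :: "('k, 'c) filtered_cx \<Rightarrow> (int \<Rightarrow> 'c set) \<Rightarrow> ('k, 'c) filtered_cx" where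
  "sub_cx F K = \<lparr>chain = (\<lambda>n. (chain F n)\<lparr>carrier := K n\<rparr>),
     filt = (\<lambda>p n. filt F p n \<inter> K n), bdry = bdry F\<rparr>"

lemma sub_cx_simps [simp]:
  "chain (sub_cx F K) n = (chain F n)\<lparr>carrier := K n\<rparr>"
  "filt (sub_cx F K) p n = filt F p n \<inter> K n" "bdry (sub_cx F K) = bdry F"
  by (simp_all add: sub_cx_def)

lemma (in filtered_complex) filtered_sub_cx:
  assumes K: "\<And>n. submodule (K n) R (chain F n)"
    and bK: "\<And>n c. c \<in> K n \<Longrightarrow> bdry F n c \<in> K (n - 1)"
  shows "filtered_complex R (sub_cx F K)"
proof (rule filtered_complex.intro)
  show "Module.module R (chain (sub_cx F K) n)" for n
    using submodule.submodule_is_module[OF K chain_module] by simp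
  show "submodule (filt (sub_cx F K) p n) R (chain (sub_cx F K) n)" for p n
  proof -
    have "submodule (filt F p n \<inter> K n) R (chain F n)"
      using C.submoduleE[OF filt_submodule] C.submoduleE[OF K] C.submodule_zero[OF K]
        C.submodule_zero[OF filt_submodule]
      by (intro C.submoduleI) auto
    then show ?thesis using C.submodule_in_submodule[OF K] by simp
  qed
  show "bdry (sub_cx F K) n \<in> linear_maps R (chain (sub_cx F K) n) (chain (sub_cx F K) (n - 1))" for n
    using bdry_linear[of n] bK C.submodule_sub[OF K] by (auto simp: linear_maps_def)
qed (use filt_Suc bK bdry_filt bdry_bdry C.submodule_sub[OF K] in auto)

section \<open>Splitting a filtered complex by idempotents\<close>

lemma filtered_map_compose:
  assumes f: "filtered_map R F F' f" and g: "filtered_map R F' F'' g"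
  shows "filtered_map R F F'' (\<lambda>n c. g n (f n c))"
proof -
  interpret f: filtered_map R F F' f by fact
  interpret g: filtered_map R F' F'' g by fact
  show ?thesis
  proof (intro filtered_map.intro filtered_map_axioms.intro)
    show "(\<lambda>c. g n (f n c)) \<in> linear_maps R (chain F n) (chain F'' n)" for n
      using f.linear[of n] g.linear[of n] unfolding linear_maps_def by (auto simp: Pi_iff)
  qed (simp_all add: f.F.filtered_complex_axioms g.F'.filtered_complex_axioms f.filt g.filt
      f.commute g.commute f.closed)
qed

lemma filtered_map_minus:
  assumes f: "filtered_map R F F' f" and g: "filtered_map R F F' g"
  shows "filtered_map R F F' (\<lambda>n c. f n c \<ominus>\<^bsub>chain F' n\<^esub> g n c)"
proof -
  interpret f: filtered_map R F F' f by fact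
  interpret g: filtered_map R F F' g by fact
  show ?thesis
  proof (intro filtered_map.intro filtered_map_axioms.intro)
    show "(\<lambda>c. f n c \<ominus>\<^bsub>chain F' n\<^esub> g n c) \<in> linear_maps R (chain F n) (chain F' n)" for n
    proof -
      have "(f n x \<oplus>\<^bsub>chain F' n\<^esub> f n y) \<ominus>\<^bsub>chain F' n\<^esub> (g n x \<oplus>\<^bsub>chain F' n\<^esub> g n y) =
          (f n x \<ominus>\<^bsub>chain F' n\<^esub> g n x) \<oplus>\<^bsub>chain F' n\<^esub> (f n y \<ominus>\<^bsub>chain F' n\<^esub> g n y)"
        if "x \<in> carrier (chain F n)" "y \<in> carrier (chain F n)" for x y
        using f.closed g.closed that
        by (simp add: a_minus_def f.F'.C.M.minus_add f.F'.C.M.a_ac)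
      moreover have "(a \<odot>\<^bsub>chain F' n\<^esub> f n x) \<ominus>\<^bsub>chain F' n\<^esub> (a \<odot>\<^bsub>chain F' n\<^esub> g n x) =
          a \<odot>\<^bsub>chain F' n\<^esub> (f n x \<ominus>\<^bsub>chain F' n\<^esub> g n x)"
        if "x \<in> carrier (chain F n)" "a \<in> carrier R" for x a
        using f.closed g.closed that
        by (simp add: a_minus_def f.F'.C.smult_r_distr f.F'.C.smult_r_minus)
      ultimately show ?thesis
        using f.closed g.closed
        by (auto simp: linear_maps_def f.add g.add f.smult g.smult)
    qed
    show "f n c \<ominus>\<^bsub>chain F' n\<^esub> g n c \<in> filt F' p n" if "c \<in> filt F p n" for c p n
      using f.filt[OF that] g.filt[OF that] by (rule f.F'.C.submodule_minus[OF f.F'.filt_submodule])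
    show "f (n - 1) (bdry F n c) \<ominus>\<^bsub>chain F' (n - 1)\<^esub> g (n - 1) (bdry F n c) =
        bdry F' n (f n c \<ominus>\<^bsub>chain F' n\<^esub> g n c)" if "c \<in> carrier (chain F n)" for c n
      using f.F'.d.minus[OF f.closed[OF that] g.closed[OF that]] f.commute[OF that] g.commute[OF that]
      by simp
  qed (simp_all add: f.F.filtered_complex_axioms f.F'.filtered_complex_axioms)
qed

lemma filtered_map_into_sub_cx:
  assumes f: "filtered_map R F F' f" and K: "filtered_complex R (sub_cx F' K)"
    and fK: "\<And>n c. c \<in> carrier (chain F n) \<Longrightarrow> f n c \<in> K n"
  shows "filtered_map R F (sub_cx F' K) f"
proof -
  interpret f: filtered_map R F F' f by fact
  show ?thesis
  proof (intro filtered_map.intro filtered_map_axioms.intro)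
    show "f n \<in> linear_maps R (chain F n) (chain (sub_cx F' K) n)" for n
      using f.linear[of n] fK by (simp add: linear_maps_def)
  qed (simp_all add: f.F.filtered_complex_axioms K f.filt f.commute fK f.F.filt_sub)
qed

lemma filtered_map_from_sub_cx:
  assumes f: "filtered_map R F F' f" and K: "filtered_complex R (sub_cx F K)"
    and KF: "\<And>n. K n \<subseteq> carrier (chain F n)"
  shows "filtered_map R (sub_cx F K) F' f"
proof -
  interpret f: filtered_map R F F' f by fact
  show ?thesis
  proof (intro filtered_map.intro filtered_map_axioms.intro)
    show "f n \<in> linear_maps R (chain (sub_cx F K) n) (chain F' n)" for n
      using f.linear[of n] KF[of n] by (simp add: linear_maps_def subset_iff Pi_iff)
  qed (use subsetD[OF KF] in \<open>auto simp: f.F'.filtered_complex_axioms K f.filt f.commute\<close>)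
qed

definition fixed_cx ::
    "('k, 'c) filtered_cx \<Rightarrow> (int \<Rightarrow> 'c \<Rightarrow> 'c) \<Rightarrow> ('k, 'c) filtered_cx" where
  "fixed_cx F e = sub_cx F (\<lambda>n. {c \<in> carrier (chain F n). e n c = c})"

lemma fixed_cx_simps [simp]:
  "carrier (chain (fixed_cx F e) n) = {c \<in> carrier (chain F n). e n c = c}"
  "\<zero>\<^bsub>chain (fixed_cx F e) n\<^esub> = \<zero>\<^bsub>chain F n\<^esub>"
  "c \<oplus>\<^bsub>chain (fixed_cx F e) n\<^esub> c' = c \<oplus>\<^bsub>chain F n\<^esub> c'"
  "filt (fixed_cx F e) p n = filt F p n \<inter> {c \<in> carrier (chain F n). e n c = c}"
  "bdry (fixed_cx F e) = bdry F"
  by (simp_all add: fixed_cx_def)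

lemma filtered_complex_fixed_cx:
  assumes "filtered_map R F F e"
  shows "filtered_complex R (fixed_cx F e)"
proof -
  interpret e: filtered_map R F F e by fact
  have "submodule {c \<in> carrier (chain F n). e n c = c} R (chain F n)" for n
    using linear_map.zero[OF e.linear_map] linear_map.neg[OF e.linear_map]
    by (intro e.F.C.submoduleI) (auto simp: e.add e.smult)
  then show ?thesis
    unfolding fixed_cx_def by (rule e.F.filtered_sub_cx) (auto simp: e.commute)
qed

lemma filtered_map_into_fixed_cx:
  assumes f: "filtered_map R F F' f" and e: "filtered_map R F' F' e"
    and idem: "\<And>n c. c \<in> carrier (chain F' n) \<Longrightarrow> e n (e n c) = e n c"
  shows "filtered_map R F (fixed_cx F' e) (\<lambda>n c. e n (f n c))"
  unfolding fixed_cx_def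
  using filtered_map_compose[OF f e] filtered_complex_fixed_cx[OF e]
    filtered_map.closed[OF f] filtered_map.closed[OF e] idem
  by (intro filtered_map_into_sub_cx) (auto simp: fixed_cx_def)

lemma filtered_map_from_fixed_cx:
  assumes f: "filtered_map R F F' f" and e: "filtered_map R F F e"
  shows "filtered_map R (fixed_cx F e) F' f"
  using f filtered_complex_fixed_cx[OF e] unfolding fixed_cx_def
  by (intro filtered_map_from_sub_cx) auto

text \<open>The decomposition of \<open>F\<close> is given by idempotents of another complex \<open>F'\<close>, of which \<open>F\<close> is a
  retract via \<open>\<alpha>\<close> and \<open>\<beta>\<close>. The complex \<open>F'\<close> may have further summands: only those on which
  \<open>\<alpha> \<beta>\<close> is the identity, in the sense of \<open>absorb\<close>, are used for \<open>F\<close>.\<close>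

lemma idempotents_ss_isomorphic:
  assumes \<alpha>: "filtered_map R F F' \<alpha>" and \<beta>: "filtered_map R F' F \<beta>" and I: "finite I"
    and e: "\<And>i. i \<in> I \<Longrightarrow> filtered_map R F' F' (e i)"
    and idem: "\<And>i n c. i \<in> I \<Longrightarrow> c \<in> carrier (chain F' n) \<Longrightarrow> e i n (e i n c) = e i n c"
    and orth: "\<And>i j n c. i \<in> I \<Longrightarrow> j \<in> I \<Longrightarrow> i \<noteq> j \<Longrightarrow> c \<in> carrier (chain F' n) \<Longrightarrow>
      e i n (e j n c) = \<zero>\<^bsub>chain F' n\<^esub>"
    and absorb: "\<And>i n c. i \<in> I \<Longrightarrow> c \<in> carrier (chain F' n) \<Longrightarrow> e i n (\<alpha> n (\<beta> n c)) = e i n c"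
    and gen: "\<And>n c N. c \<in> carrier (chain F n) \<Longrightarrow> submodule N R (chain F n) \<Longrightarrow>
      (\<And>i. i \<in> I \<Longrightarrow> \<beta> n (e i n (\<alpha> n c)) \<in> N) \<Longrightarrow> c \<in> N"
  shows "ss_isomorphic R (fc_ss F) (ss_direct_sum I (\<lambda>i. fc_ss (fixed_cx F' (e i))))"
proof (rule filtered_decomposition_ss_isomorphic[where \<pi> = "\<lambda>i n c. e i n (\<alpha> n c)" and \<iota> = "\<lambda>i. \<beta>"])
  show "filtered_complex R F" using \<alpha> by (simp add: filtered_map_def)
  show "filtered_map R F (fixed_cx F' (e i)) (\<lambda>n c. e i n (\<alpha> n c))" if "i \<in> I" for i
    using \<alpha> e[OF that] idem[OF that] by (rule filtered_map_into_fixed_cx)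
  show "filtered_map R (fixed_cx F' (e i)) F \<beta>" if "i \<in> I" for i
    using \<beta> e[OF that] by (rule filtered_map_from_fixed_cx)
  show "e i n (\<alpha> n (\<beta> n c)) = \<zero>\<^bsub>chain (fixed_cx F' (e i)) n\<^esub>"
    if "i \<in> I" "j \<in> I" "i \<noteq> j" "c \<in> carrier (chain (fixed_cx F' (e j)) n)" for i j n c
    using orth[OF that(1-3), of c n] that absorb by simp
qed (use I absorb gen in auto)

text \<open>A homotopy from \<open>e\<close> to zero need not preserve the subcomplex fixed by \<open>e\<close>; composed with \<open>e\<close>
  it does, and there \<open>e\<close> is the identity.\<close>

lemma fixed_cx_page_trivial:
  assumes e: "filtered_map R F F e"
    and idem: "\<And>n c. c \<in> carrier (chain F n) \<Longrightarrow> e n (e n c) = e n c"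
    and h_filt: "\<And>p n c. c \<in> filt F p n \<Longrightarrow> h n c \<in> filt F (p + int m) (n + 1)"
    and h_closed: "\<And>n c. c \<in> carrier (chain F n) \<Longrightarrow> h n c \<in> carrier (chain F (n + 1))"
    and h: "\<And>n c. c \<in> carrier (chain F n) \<Longrightarrow>
      e n c = bdry F (n + 1) (h n c) \<oplus>\<^bsub>chain F n\<^esub> h (n - 1) (bdry F n c)"
  shows "carrier (page (fixed_cx F e) (Suc m) p n) = {\<zero>\<^bsub>page (fixed_cx F e) (Suc m) p n\<^esub>}"
proof -
  interpret e: filtered_map R F F e by fact
  show ?thesis
  proof (rule filtered_complex.page_trivial_if_contractible[OF filtered_complex_fixed_cx[OF e],
        where h = "\<lambda>n c. e (n + 1) (h n c)"])
    show "e (n + 1) (h n c) \<in> filt (fixed_cx F e) (p + int m) (n + 1)"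
      if "c \<in> filt (fixed_cx F e) p n" for p n c
      using that e.filt h_filt h_closed idem e.closed by simp
    fix n c assume "c \<in> carrier (chain (fixed_cx F e) n)"
    then have c: "c \<in> carrier (chain F n)" "e n c = c" by auto
    have dc: "bdry F n c \<in> carrier (chain F (n - 1))" using e.F.d.closed[OF c(1)] .
    have hd: "h (n - 1) (bdry F n c) \<in> carrier (chain F n)" using h_closed[OF dc] by simp
    have dh: "bdry F (n + 1) (h n c) \<in> carrier (chain F n)"
      using e.F.bdry_closed'[OF h_closed[OF c(1)]] .
    have "c = e n (e n c)" using c by simp
    also have "\<dots> = e n (bdry F (n + 1) (h n c)) \<oplus>\<^bsub>chain F n\<^esub> e n (h (n - 1) (bdry F n c))"
      unfolding h[OF c(1)] using dh hd by (rule e.add)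
    also have "e n (bdry F (n + 1) (h n c)) = bdry F (n + 1) (e (n + 1) (h n c))"
      using e.commute[OF h_closed[OF c(1)]] by simp
    finally show "c = bdry (fixed_cx F e) (n + 1) (e (n + 1) (h n c)) \<oplus>\<^bsub>chain (fixed_cx F e) n\<^esub>
        e (n - 1 + 1) (h (n - 1) (bdry (fixed_cx F e) n c))" by simp
  qed
qed

section \<open>Formal sums of walks\<close>

text \<open>
  A walk may be empty or stand still. Recursions on lists pass through such lists, although only
  the regular ones are basis elements of the normalized complex.
\<close>

definition walk :: "'a qspace \<Rightarrow> 'a list \<Rightarrow> bool" where
  "walk X t \<longleftrightarrow> set t \<subseteq> points X \<and> successively (\<lambda>x y. qdist X x y < \<infinity>) t"

definition regular :: "'a list \<Rightarrow> bool" where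
  "regular t \<longleftrightarrow> t \<noteq> [] \<and> distinct_adj t"

definition cons_chain :: "'a \<Rightarrow> ('a list \<Rightarrow>\<^sub>0 int) \<Rightarrow> ('a list \<Rightarrow>\<^sub>0 int)" where
  "cons_chain x c = frag_extend (\<lambda>t. frag_of (x # t)) c"

text \<open>
  The boundary of the augmented complex, in which the empty list is the boundary of a list of
  length one. It satisfies \<open>\<partial>(x t) = t - x \<partial>t\<close>.
\<close>

fun bd :: "'a list \<Rightarrow> ('a list \<Rightarrow>\<^sub>0 int)" where
  "bd [] = 0"
| "bd (x # t) = frag_of t - cons_chain x (bd t)"

definition map_chain :: "('a \<Rightarrow> 'b) \<Rightarrow> 'a list \<Rightarrow> ('b list \<Rightarrow>\<^sub>0 int)" where
  "map_chain \<phi> t = frag_of (map \<phi> t)"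

text \<open>
  The alternating sum of the lists \<open>\<phi> t\<^sub>0, \<dots>, \<phi> t\<^sub>i, \<psi> t\<^sub>i, \<dots>, \<psi> t\<^sub>n\<close>, which is a chain homotopy
  between the maps induced by \<open>\<phi>\<close> and \<open>\<psi>\<close>.
\<close>

fun prism :: "('a \<Rightarrow> 'b) \<Rightarrow> ('a \<Rightarrow> 'b) \<Rightarrow> 'a list \<Rightarrow> ('b list \<Rightarrow>\<^sub>0 int)" where
  "prism \<phi> \<psi> [] = 0"
| "prism \<phi> \<psi> (x # t) = frag_of (\<phi> x # \<psi> x # map \<psi> t) - cons_chain (\<phi> x) (prism \<phi> \<psi> t)"

text \<open>
  The integral matrices that act on normalized chains: they shift the degree by \<open>d\<close> and raise the
  filtration by at most \<open>m\<close>. The last condition lets the lists that are not regular form a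
  subobject, so that discarding them is compatible with composition.
\<close>

definition chain_op ::
    "'a qspace \<Rightarrow> 'b qspace \<Rightarrow> int \<Rightarrow> nat \<Rightarrow> ('a list \<Rightarrow> ('b list \<Rightarrow>\<^sub>0 int)) \<Rightarrow> bool" where
  "chain_op X Y d m a \<longleftrightarrow> (\<forall>t. walk X t \<longrightarrow> (\<forall>s\<in>Poly_Mapping.keys (a t).
     walk Y s \<and> int (length s) = int (length t) + d \<and>
     tuple_length Y s \<le> tuple_length X t + of_nat m \<and> (regular s \<longrightarrow> regular t)))"

lemma cons_chain_simps [simp]:
  "cons_chain x 0 = 0" "cons_chain x (frag_of t) = frag_of (x # t)"
  "cons_chain x (a - b) = cons_chain x a - cons_chain x b"
  "cons_chain x (a + b) = cons_chain x a + cons_chain x b"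
  by (simp_all add: cons_chain_def frag_extend_diff frag_extend_add)

lemma keys_cons_chainD:
  assumes "s \<in> Poly_Mapping.keys (cons_chain x c)"
  shows "\<exists>s'\<in>Poly_Mapping.keys c. s = x # s'"
proof -
  have "s \<in> (\<Union>t\<in>Poly_Mapping.keys c. Poly_Mapping.keys (frag_of (x # t)))"
    using assms unfolding cons_chain_def by (rule subsetD[OF keys_frag_extend])
  then show ?thesis by simp
qed

lemma lookup_cons_chain:
  "Poly_Mapping.lookup (cons_chain x c) s =
    (case s of [] \<Rightarrow> 0 | y # s' \<Rightarrow> if y = x then Poly_Mapping.lookup c s' else 0)"
  using subset_UNIV
  by (induction c rule: frag_induction) (auto simp: lookup_minus split: list.splits)

lemma extend_bd_cons: "frag_extend bd (cons_chain x c) = c - cons_chain x (frag_extend bd c)"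
  using subset_UNIV
  by (induction c rule: frag_induction) (auto simp: frag_extend_diff algebra_simps)

lemma extend_map_cons:
  "frag_extend (map_chain \<phi>) (cons_chain x c) = cons_chain (\<phi> x) (frag_extend (map_chain \<phi>) c)"
  using subset_UNIV
  by (induction c rule: frag_induction) (auto simp: frag_extend_diff map_chain_def)

lemma extend_prism_cons:
  "frag_extend (prism \<phi> \<psi>) (cons_chain x c) =
    cons_chain (\<phi> x) (cons_chain (\<psi> x) (frag_extend (map_chain \<psi>) c)) -
    cons_chain (\<phi> x) (frag_extend (prism \<phi> \<psi>) c)"
  using subset_UNIV
proof (induction c rule: frag_induction)
  case (diff a b)
  show ?case unfolding frag_extend_diff cons_chain_simps diff by simp
qed (simp_all add: map_chain_def)

lemma bd_bd: "frag_extend bd (bd t) = 0"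
  by (induction t) (simp_all add: frag_extend_diff extend_bd_cons)

lemma bd_map: "bd (map \<phi> t) = frag_extend (map_chain \<phi>) (bd t)"
  by (induction t) (simp_all add: frag_extend_diff extend_map_cons, simp add: map_chain_def)

text \<open>By induction on the list: everything except the leading lists \<open>\<psi> x \<psi> t\<close> and \<open>\<phi> x \<psi> t\<close> is
  \<open>\<phi> x\<close> prepended to the identity for the tail \<open>t\<close>.\<close>

lemma prism_homotopy:
  "frag_extend bd (prism \<phi> \<psi> t) + frag_extend (prism \<phi> \<psi>) (bd t) = map_chain \<psi> t - map_chain \<phi> t"
proof (induction t)
  case (Cons x t)
  have "frag_extend bd (prism \<phi> \<psi> (x # t)) + frag_extend (prism \<phi> \<psi>) (bd (x # t)) =
      map_chain \<psi> (x # t) - cons_chain (\<phi> x) (map_chain \<psi> t) +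
      cons_chain (\<phi> x) (frag_extend bd (prism \<phi> \<psi> t) + frag_extend (prism \<phi> \<psi>) (bd t))"
    by (simp add: bd_map frag_extend_diff extend_bd_cons extend_prism_cons map_chain_def algebra_simps)
  also have "\<dots> = map_chain \<psi> (x # t) - map_chain \<phi> (x # t)"
    unfolding Cons.IH by (simp add: map_chain_def)
  finally show ?case .
qed (simp add: map_chain_def)

subsection \<open>Size of walks\<close>

lemma walk_simps [simp]:
  "walk X []" "walk X [x] \<longleftrightarrow> x \<in> points X"
  "walk X (x # y # t) \<longleftrightarrow> x \<in> points X \<and> qdist X x y < \<infinity> \<and> walk X (y # t)"
  by (auto simp: walk_def)

lemma walk_ConsD: "walk X (x # t) \<Longrightarrow> x \<in> points X \<and> walk X t"
  by (cases t) auto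

lemma tuple_length_simps [simp]:
  "tuple_length X [] = 0" "tuple_length X [x] = 0"
  "tuple_length X (x # y # t) = qdist X x y + tuple_length X (y # t)"
  by (simp_all add: tuple_length_def sum.lessThan_Suc_shift del: sum.lessThan_Suc)

lemma walk_mono:
  assumes X: "quasimetric X" and w: "walk X (x # y # u)"
  shows "walk X (x # u)" "tuple_length X (x # u) \<le> tuple_length X (x # y # u)"
proof -
  have tri: "qdist X x z \<le> qdist X x y + qdist X y z" if "z \<in> points X" for z
  proof -
    have "x \<in> points X" "y \<in> points X" using w walk_ConsD[of X y u] by simp_all
    then show ?thesis using X that unfolding quasimetric_def by blast
  qed
  show "walk X (x # u)"
  proof (cases u)
    case (Cons z v)
    then have z: "z \<in> points X" using w walk_ConsD[of X z v] by auto
    have "qdist X x y + qdist X y z < \<infinity>" using w Cons by simp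
    then have "qdist X x z < \<infinity>" using tri[OF z] by (rule le_less_trans[rotated])
    then show ?thesis using w Cons by simp
  qed (use w in auto)
  show "tuple_length X (x # u) \<le> tuple_length X (x # y # u)"
  proof (cases u)
    case (Cons z v)
    then have z: "z \<in> points X" using w walk_ConsD[of X z v] by auto
    show ?thesis using add_mono[OF tri[OF z] order_refl[of "tuple_length X (z # v)"]] Cons
      by (simp add: add.assoc)
  qed simp
qed

lemma bd_keysD:
  assumes "s \<in> Poly_Mapping.keys (bd (y # u))"
  shows "s = u \<or> (\<exists>s'\<in>Poly_Mapping.keys (bd u). s = y # s')"
proof -
  have "s \<in> Poly_Mapping.keys (frag_of u) \<union> Poly_Mapping.keys (cons_chain y (bd u))"
    using assms keys_diff[of "frag_of u" "cons_chain y (bd u)"] unfolding bd.simps by (rule subsetD[rotated])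
  then show ?thesis using keys_cons_chainD[of s y "bd u"] by auto
qed

text \<open>Deleting the vertex after \<open>x\<close> is controlled by the triangle inequality. The last conjunct is
  what the induction needs: a new first vertex can be put in front of a list and of its faces
  alike, although the faces need not start with the same vertex.\<close>

lemma bd_walk:
  assumes X: "quasimetric X"
  shows "walk X t \<Longrightarrow> s \<in> Poly_Mapping.keys (bd t) \<Longrightarrow>
    walk X s \<and> tuple_length X s \<le> tuple_length X t \<and> length t = Suc (length s) \<and>
    (\<forall>x. walk X (x # t) \<longrightarrow> walk X (x # s) \<and> tuple_length X (x # s) \<le> tuple_length X (x # t))"
proof (induction t arbitrary: s)
  case (Cons y u)
  consider "s = u" | s' where "s' \<in> Poly_Mapping.keys (bd u)" "s = y # s'"
    using bd_keysD[OF Cons.prems(2)] by blast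
  then show ?case
  proof cases
    case 1
    have "tuple_length X u \<le> tuple_length X (y # u)"
      by (cases u) (auto intro: le_add_same_cancel2[THEN iffD2])
    moreover have "walk X u" using walk_ConsD[OF Cons.prems(1)] by simp
    moreover have "walk X (x # u) \<and> tuple_length X (x # u) \<le> tuple_length X (x # y # u)"
      if "walk X (x # y # u)" for x
      using walk_mono[OF X that] by (rule conjI)
    ultimately show ?thesis unfolding 1 by (intro conjI allI impI; blast | simp)
  next
    case 2
    have "walk X u" using walk_ConsD[OF Cons.prems(1)] by simp
    note IH = Cons.IH[OF this 2(1)]
    have w: "walk X (y # s')" "tuple_length X (y # s') \<le> tuple_length X (y # u)"
      using IH Cons.prems(1) by blast+
    then show ?thesis using IH unfolding 2(2)
      by (intro conjI allI impI) (simp_all add: add_left_mono)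
  qed
qed simp

lemma regular_Cons: "regular (x # t) \<longleftrightarrow> t = [] \<or> x \<noteq> hd t \<and> regular t"
  by (cases t) (simp_all add: regular_def)

lemma not_regular_cases:
  assumes "\<not> regular t" "t \<noteq> []"
  obtains (repeat) x u where "t = x # x # u" | (later) x u where "t = x # u" "u \<noteq> []" "\<not> regular u"
proof -
  obtain x u where t: "t = x # u" using assms(2) by (cases t) simp_all
  then have u: "u \<noteq> []" "x = hd u \<or> \<not> regular u" using assms(1) by (simp_all add: regular_Cons)
  then consider "u = x # tl u" | "\<not> regular u" by (metis list.collapse)
  then show ?thesis using t u(1) that by cases metis+
qed

text \<open>The two faces of \<open>x x u\<close> that omit one of the repeated vertices cancel; every other face of a
  list with a repetition has a repetition.\<close>

lemma bd_degenerate: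
  "t \<noteq> [] \<Longrightarrow> \<not> regular t \<Longrightarrow> s \<in> Poly_Mapping.keys (bd t) \<Longrightarrow> s \<noteq> [] \<and> \<not> regular s"
proof (induction t arbitrary: s rule: length_induct)
  case (1 t)
  from \<open>\<not> regular t\<close> \<open>t \<noteq> []\<close> show ?case
  proof (cases rule: not_regular_cases)
    case (repeat x u)
    have "s \<in> Poly_Mapping.keys (cons_chain x (cons_chain x (bd u)))"
      using "1.prems"(3) by (simp add: repeat)
    then obtain s' where "s' \<in> Poly_Mapping.keys (cons_chain x (bd u))" "s = x # s'"
      by (blast dest: keys_cons_chainD)
    then have "\<exists>s''. s = x # x # s''" by (blast dest: keys_cons_chainD)
    then show ?thesis by (auto simp: regular_Cons)
  next
    case (later x u)
    have "s' \<noteq> [] \<and> \<not> regular s'" if "s' \<in> Poly_Mapping.keys (bd u)" for s'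
      using "1.IH"[rule_format, of u s'] later that by simp
    moreover have "s = u \<or> (\<exists>s'\<in>Poly_Mapping.keys (bd u). s = x # s')"
      using bd_keysD[of s x u] "1.prems"(3) later by simp
    ultimately show ?thesis using later by (auto simp: regular_Cons)
  qed
qed

lemma chain_op_bd:
  assumes "quasimetric X" shows "chain_op X X (-1) 0 bd"
  unfolding chain_op_def
proof (intro allI impI ballI)
  fix t s assume t: "walk X t" "s \<in> Poly_Mapping.keys (bd t)"
  then have "t \<noteq> []" by auto
  then show "walk X s \<and> int (length s) = int (length t) + - 1 \<and>
      tuple_length X s \<le> tuple_length X t + of_nat 0 \<and> (regular s \<longrightarrow> regular t)"
    using bd_walk[OF assms t] bd_degenerate t(2) by auto
qed

lemma short_walk:
  assumes "\<phi> \<in> short_maps X Y" "walk X t"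
  shows "walk Y (map \<phi> t) \<and> tuple_length Y (map \<phi> t) \<le> tuple_length X t"
  using assms(2)
proof (induction t rule: induct_list012)
  case (3 x y t)
  have xy: "x \<in> points X" "y \<in> points X" using 3 walk_ConsD[of X y t] by auto
  then have "qdist Y (\<phi> x) (\<phi> y) \<le> qdist X x y" "\<phi> x \<in> points Y"
    using assms(1) by (auto simp: short_maps_def)
  then show ?case using 3 by (auto intro: add_mono le_less_trans)
qed (use assms(1) in \<open>auto simp: short_maps_def\<close>)

lemma regular_mapD: "regular (map \<phi> t) \<Longrightarrow> regular t"
  by (auto simp: regular_def dest: distinct_adj_mapD)

lemma chain_op_map: "\<phi> \<in> short_maps X Y \<Longrightarrow> chain_op X Y 0 0 (map_chain \<phi>)"
  using short_walk[of \<phi> X Y] by (auto simp: chain_op_def map_chain_def dest: regular_mapD)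

lemma prism_keysD:
  assumes "s \<in> Poly_Mapping.keys (prism \<phi> \<psi> (y # u))"
  shows "s = \<phi> y # \<psi> y # map \<psi> u \<or> (\<exists>s'\<in>Poly_Mapping.keys (prism \<phi> \<psi> u). s = \<phi> y # s')"
proof -
  have "s \<in> Poly_Mapping.keys (frag_of (\<phi> y # \<psi> y # map \<psi> u)) \<union>
      Poly_Mapping.keys (cons_chain (\<phi> y) (prism \<phi> \<psi> u))"
    using assms keys_diff[of "frag_of (\<phi> y # \<psi> y # map \<psi> u)" "cons_chain (\<phi> y) (prism \<phi> \<psi> u)"]
    unfolding prism.simps by (rule subsetD[rotated])
  then show ?thesis using keys_cons_chainD[of s "\<phi> y" "prism \<phi> \<psi> u"] by auto
qed

text \<open>Each term crosses once from \<open>\<phi>\<close> to \<open>\<psi>\<close>, at the price of one distance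
  \<open>d(\<phi> x, \<psi> x) \<le> m\<close>. It starts at the image under \<open>\<phi>\<close> of the first vertex, which bounds the
  distance to a vertex that the induction puts in front.\<close>

lemma prism_walk:
  assumes \<phi>: "\<phi> \<in> short_maps X Y" and \<psi>: "\<psi> \<in> short_maps X Y"
    and m: "\<And>x. x \<in> points X \<Longrightarrow> qdist Y (\<phi> x) (\<psi> x) \<le> of_nat m"
  shows "walk X t \<Longrightarrow> s \<in> Poly_Mapping.keys (prism \<phi> \<psi> t) \<Longrightarrow>
    walk Y s \<and> tuple_length Y s \<le> tuple_length X t + of_nat m \<and> length s = Suc (length t) \<and>
    (\<exists>s'. s = \<phi> (hd t) # s')"
proof (induction t arbitrary: s)
  case (Cons y u)
  have y: "y \<in> points X" "walk X u" using walk_ConsD[OF Cons.prems(1)] by simp_all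
  have \<phi>y: "\<phi> y \<in> points Y" "\<psi> y \<in> points Y" using \<phi> \<psi> y by (auto simp: short_maps_def)
  consider "s = \<phi> y # \<psi> y # map \<psi> u" | s' where "s' \<in> Poly_Mapping.keys (prism \<phi> \<psi> u)" "s = \<phi> y # s'"
    using prism_keysD[OF Cons.prems(2)] by blast
  then show ?case
  proof cases
    case 1
    have "qdist Y (\<phi> y) (\<psi> y) < \<infinity>" using m[OF y(1)] by (simp add: of_nat_less_top le_less_trans)
    moreover have "walk Y (\<psi> y # map \<psi> u)" "tuple_length Y (\<psi> y # map \<psi> u) \<le> tuple_length X (y # u)"
      using short_walk[OF \<psi> Cons.prems(1)] by auto
    ultimately show ?thesis
      using 1 \<phi>y add_mono[OF m[OF y(1)], of "tuple_length Y (\<psi> y # map \<psi> u)" "tuple_length X (y # u)"]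
      by (simp add: add.commute)
  next
    case 2
    have "u \<noteq> []" using 2 by auto
    then obtain z v where u: "u = z # v" by (cases u) auto
    obtain s'' where s'': "s' = \<phi> z # s''" using Cons.IH[OF y(2) 2(1)] u by auto
    have z: "z \<in> points X" using walk_ConsD[of X z v] y(2) u by simp
    have d: "qdist Y (\<phi> y) (\<phi> z) \<le> qdist X y z" using \<phi> y z by (auto simp: short_maps_def)
    moreover have "qdist X y z < \<infinity>" using Cons.prems(1) u by simp
    ultimately have "qdist Y (\<phi> y) (\<phi> z) < \<infinity>" by (rule le_less_trans)
    moreover have "tuple_length Y (\<phi> y # s') \<le> tuple_length X (y # u) + of_nat m"
      using Cons.IH[OF y(2) 2(1)] add_mono[OF d, of "tuple_length Y s'" "tuple_length X u + of_nat m"]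
      by (simp add: s'' u add.assoc)
    moreover have "walk Y s'" "length s' = Suc (length u)" using Cons.IH[OF y(2) 2(1)] by blast+
    ultimately show ?thesis using 2(2) s'' \<phi>y by simp
  qed
qed simp

lemma prism_degenerate:
  "\<not> regular t \<Longrightarrow> s \<in> Poly_Mapping.keys (prism \<phi> \<psi> t) \<Longrightarrow> s \<noteq> [] \<and> \<not> regular s"
proof (induction t arbitrary: s rule: length_induct)
  case (1 t)
  have "t \<noteq> []" using 1 by auto
  with \<open>\<not> regular t\<close> show ?case
  proof (cases rule: not_regular_cases)
    case (repeat x u)
    consider "s = \<phi> x # \<psi> x # \<psi> x # map \<psi> u" |
      s' where "s' \<in> Poly_Mapping.keys (prism \<phi> \<psi> (x # u))" "s = \<phi> x # s'"
      using prism_keysD[of s \<phi> \<psi> x "x # u"] "1.prems"(2) unfolding repeat list.map by blast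
    then show ?thesis
    proof cases
      case 2
      obtain s'' where "s' = \<phi> x # s''" using prism_keysD[OF 2(1)] by blast
      then show ?thesis using 2 by (simp add: regular_Cons)
    qed (simp add: regular_Cons)
  next
    case (later x u)
    have deg: "s' \<noteq> [] \<and> \<not> regular s'" if "s' \<in> Poly_Mapping.keys (prism \<phi> \<psi> u)" for s'
      using "1.IH"[rule_format, of u s'] later that by simp
    have "s = \<phi> x # \<psi> x # map \<psi> u \<or> (\<exists>s'\<in>Poly_Mapping.keys (prism \<phi> \<psi> u). s = \<phi> x # s')"
      using prism_keysD[of s \<phi> \<psi> x u] "1.prems"(2) later by simp
    moreover have "\<not> regular (\<phi> x # \<psi> x # map \<psi> u)"
      using later regular_mapD[of \<psi> u] by (auto simp: regular_Cons)
    ultimately show ?thesis using deg by (auto simp: regular_Cons)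
  qed
qed

lemma chain_op_prism:
  assumes "\<phi> \<in> short_maps X Y" "\<psi> \<in> short_maps X Y"
    and "\<And>x. x \<in> points X \<Longrightarrow> qdist Y (\<phi> x) (\<psi> x) \<le> of_nat m"
  shows "chain_op X Y 1 m (prism \<phi> \<psi>)"
  using prism_walk[OF assms] prism_degenerate unfolding chain_op_def by fastforce

lemma chain_op_add:
  assumes "chain_op X Y d m a" "chain_op X Y d m b"
  shows "chain_op X Y d m (\<lambda>t. a t + b t)"
  unfolding chain_op_def
proof (intro allI impI ballI)
  fix t s assume w: "walk X t" and "s \<in> Poly_Mapping.keys (a t + b t)"
  from this(2) keys_add[of "a t" "b t"]
  have "s \<in> Poly_Mapping.keys (a t) \<union> Poly_Mapping.keys (b t)" by (rule subsetD[rotated])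
  then show "walk Y s \<and> int (length s) = int (length t) + d \<and>
      tuple_length Y s \<le> tuple_length X t + of_nat m \<and> (regular s \<longrightarrow> regular t)"
    using assms w unfolding chain_op_def by blast
qed

lemma chain_op_neg: "chain_op X Y d m a \<Longrightarrow> chain_op X Y d m (\<lambda>t. - a t)"
  by (simp add: chain_op_def)

lemma chain_op_zero: "chain_op X Y d m (\<lambda>t. 0)"
  by (simp add: chain_op_def)

section \<open>Integers in a ring\<close>

definition int_in :: "('k, 'm) ring_scheme \<Rightarrow> int \<Rightarrow> 'k" where
  "int_in R k = [k] \<cdot>\<^bsub>R\<^esub> \<one>\<^bsub>R\<^esub>"

context cring
begin

lemma int_in_closed [simp]: "int_in R k \<in> carrier R"
  unfolding int_in_def by (rule add.int_pow_closed) simp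

lemma int_in_0 [simp]: "int_in R 0 = \<zero>" and int_in_1 [simp]: "int_in R 1 = \<one>"
  by (simp_all add: int_in_def add_pow_def int_pow_def2)

lemma int_in_add: "int_in R (k + l) = int_in R k \<oplus> int_in R l"
  unfolding int_in_def by (rule add.int_pow_mult) simp

lemma int_in_neg: "int_in R (- k) = \<ominus> int_in R k"
  unfolding int_in_def by (rule add.int_pow_neg) simp

lemma int_in_mult: "int_in R (k * l) = int_in R k \<otimes> int_in R l"
proof -
  have "int_in R k \<otimes> int_in R l = [k] \<cdot> ([l] \<cdot> \<one>)"
    unfolding int_in_def using add_pow_ldistr_int[of \<one> "[l] \<cdot> \<one>" k] add.int_pow_closed by simp
  also have "\<dots> = int_in R (l * k)"
    unfolding int_in_def by (rule add.int_pow_pow) simp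
  finally show ?thesis by (simp add: mult.commute)
qed

lemma int_in_power: "int_in R (k ^ i) = int_in R k [^] i"
  by (induction i) (simp_all add: int_in_mult m_comm)

lemma int_in_sum: "finite A \<Longrightarrow> int_in R (\<Sum>i\<in>A. f i) = (\<Oplus>i\<in>A. int_in R (f i))"
  by (induction A rule: finite_induct) (simp_all add: int_in_add)

lemma finsum_swap:
  assumes "finite A" "finite B" "\<And>a b. a \<in> A \<Longrightarrow> b \<in> B \<Longrightarrow> f a b \<in> carrier R"
  shows "(\<Oplus>a\<in>A. \<Oplus>b\<in>B. f a b) = (\<Oplus>b\<in>B. \<Oplus>a\<in>A. f a b)"
  using assms(1,3)
proof (induction A rule: finite_induct)
  case (insert x A)
  have "(\<Oplus>b\<in>B. \<Oplus>a\<in>insert x A. f a b) = (\<Oplus>b\<in>B. f x b \<oplus> (\<Oplus>a\<in>A. f a b))"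
    using insert by (intro finsum_cong') (auto intro!: finsum_closed finsum_insert)
  also have "\<dots> = (\<Oplus>b\<in>B. f x b) \<oplus> (\<Oplus>b\<in>B. \<Oplus>a\<in>A. f a b)"
    using insert by (intro finsum_addf) (auto intro!: finsum_closed)
  finally show ?case using insert by (subst finsum_insert) (auto intro!: finsum_closed)
qed (simp add: assms)

lemma finsum_support:
  assumes "finite A" "{t. c t \<noteq> \<zero>} \<subseteq> A" "\<And>t. c t \<in> carrier R" "\<And>t. f t \<in> carrier R"
  shows "(\<Oplus>t\<in>{t. c t \<noteq> \<zero>}. c t \<otimes> f t) = (\<Oplus>t\<in>A. c t \<otimes> f t)"
  using assms by (intro add.finprod_mono_neutral_cong_left) auto

end

section \<open>Chains of a quasimetric space\<close>

definition rc :: "'k ring \<Rightarrow> 'a qspace \<Rightarrow> ('k, 'a list \<Rightarrow> 'k) filtered_cx" where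
  "rc R X = \<lparr>chain = RC R X, filt = RC_filt R X, bdry = boundary R X\<rparr>"

lemma rc_simps [simp]:
  "chain (rc R X) = RC R X" "filt (rc R X) = RC_filt R X" "bdry (rc R X) = boundary R X"
  by (simp_all add: rc_def)

lemma mpss_space_eq: "mpss_space R X = fc_ss (rc R X)"
proof -
  have cyc: "mpss_Z R X r p q = cyc (rc R X) r p (p + q)" for r p q
    by (simp add: mpss_Z_def cyc_def)
  have bnd: "mpss_B R X r p q = bnd (rc R X) r p (p + q)" for r p q
    by (simp add: mpss_B_def bnd_def cyc algebra_simps)
  show ?thesis
    by (simp add: mpss_space_def fc_ss_def page_def cls_def cyc bnd algebra_simps)
qed

lemma regular_tuples_iff:
  "t \<in> regular_tuples X n \<longleftrightarrow> walk X t \<and> regular t \<and> int (length t) = n + 1"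
  by (auto simp: regular_tuples_def walk_def regular_def successively_conv_nth distinct_adj_conv_nth)

text \<open>The linear extension of an integral matrix to chains with coefficients in \<open>R\<close>, followed by
  the projection that discards all lists other than basis elements of \<open>Y\<close>.\<close>

definition realize ::
    "'k ring \<Rightarrow> 'b qspace \<Rightarrow> ('a list \<Rightarrow> ('b list \<Rightarrow>\<^sub>0 int)) \<Rightarrow> ('a list \<Rightarrow> 'k) \<Rightarrow> ('b list \<Rightarrow> 'k)" where
  "realize R Y a c = (\<lambda>s. if walk Y s \<and> regular s
     then \<Oplus>\<^bsub>R\<^esub>t\<in>{t. c t \<noteq> \<zero>\<^bsub>R\<^esub>}. c t \<otimes>\<^bsub>R\<^esub> int_in R (Poly_Mapping.lookup (a t) s)
     else \<zero>\<^bsub>R\<^esub>)"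

context
  fixes R :: "'k ring"
  assumes R: "cring R"
begin

interpretation R: cring R by (rule R)

subsection \<open>Free modules\<close>

lemma free_module_simps [simp]:
  "\<zero>\<^bsub>free_module R T\<^esub> = (\<lambda>t. \<zero>\<^bsub>R\<^esub>)" "c \<oplus>\<^bsub>free_module R T\<^esub> c' = (\<lambda>t. c t \<oplus>\<^bsub>R\<^esub> c' t)"
  "a \<odot>\<^bsub>free_module R T\<^esub> c = (\<lambda>t. a \<otimes>\<^bsub>R\<^esub> c t)"
  by (simp_all add: free_module_def)

lemma free_module_module: "Module.module R (free_module R T)"
proof (rule moduleI)
  let ?M = "free_module R T"
  have add: "c \<oplus>\<^bsub>?M\<^esub> c' \<in> carrier ?M" if "c \<in> carrier ?M" "c' \<in> carrier ?M" for c c'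
  proof -
    have "{t. c t \<oplus>\<^bsub>R\<^esub> c' t \<noteq> \<zero>\<^bsub>R\<^esub>} \<subseteq> {t. c t \<noteq> \<zero>\<^bsub>R\<^esub>} \<union> {t. c' t \<noteq> \<zero>\<^bsub>R\<^esub>}" by auto
    then show ?thesis using that by (auto simp: free_module_def intro: finite_subset)
  qed
  show "abelian_group ?M"
  proof (rule abelian_groupI)
    fix c assume c: "c \<in> carrier ?M"
    have "{t. \<ominus>\<^bsub>R\<^esub> c t \<noteq> \<zero>\<^bsub>R\<^esub>} \<subseteq> {t. c t \<noteq> \<zero>\<^bsub>R\<^esub>}" by auto
    then have "(\<lambda>t. \<ominus>\<^bsub>R\<^esub> c t) \<in> carrier ?M"
      using c by (auto simp: free_module_def intro: finite_subset)
    moreover have "(\<lambda>t. \<ominus>\<^bsub>R\<^esub> c t) \<oplus>\<^bsub>?M\<^esub> c = \<zero>\<^bsub>?M\<^esub>"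
      using c by (auto simp: free_module_def R.l_neg)
    ultimately show "\<exists>y\<in>carrier ?M. y \<oplus>\<^bsub>?M\<^esub> c = \<zero>\<^bsub>?M\<^esub>" by blast
  qed (use add in \<open>auto simp: free_module_def R.a_ac\<close>)
  show "a \<odot>\<^bsub>?M\<^esub> c \<in> carrier ?M" if "a \<in> carrier R" "c \<in> carrier ?M" for a c
  proof -
    have "{t. a \<otimes>\<^bsub>R\<^esub> c t \<noteq> \<zero>\<^bsub>R\<^esub>} \<subseteq> {t. c t \<noteq> \<zero>\<^bsub>R\<^esub>}" using that by auto
    then show ?thesis using that by (auto simp: free_module_def intro: finite_subset)
  qed
qed (auto simp: free_module_def R.l_distr R.r_distr R.m_assoc R.is_cring)

lemma free_module_neg:
  assumes "c \<in> carrier (free_module R T)"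
  shows "\<ominus>\<^bsub>free_module R T\<^esub> c = (\<lambda>t. \<ominus>\<^bsub>R\<^esub> c t)"
proof -
  interpret M: Module.module R "free_module R T" by (rule free_module_module)
  have "c t \<in> carrier R" for t using assms by (simp add: free_module_def)
  then have "(\<ominus>\<^bsub>R\<^esub> \<one>\<^bsub>R\<^esub>) \<odot>\<^bsub>free_module R T\<^esub> c = (\<lambda>t. \<ominus>\<^bsub>R\<^esub> c t)"
    by (simp add: R.l_minus)
  then show ?thesis
    using M.smult_l_minus[OF R.one_closed assms] M.smult_one[OF assms] by (simp only:)
qed

lemma RC_module: "Module.module R (RC R X n)"
  unfolding RC_def by (rule free_module_module)

lemma RC_iff: "c \<in> carrier (RC R X n) \<longleftrightarrow> (\<forall>t. c t \<in> carrier R) \<and> finite {t. c t \<noteq> \<zero>\<^bsub>R\<^esub>} \<and>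
    (\<forall>t. c t \<noteq> \<zero>\<^bsub>R\<^esub> \<longrightarrow> walk X t \<and> regular t \<and> int (length t) = n + 1)"
  by (auto simp: RC_def free_module_def regular_tuples_iff subset_iff)

lemma RC_ops [simp]:
  "\<zero>\<^bsub>RC R X n\<^esub> = (\<lambda>t. \<zero>\<^bsub>R\<^esub>)" "c \<oplus>\<^bsub>RC R X n\<^esub> c' = (\<lambda>t. c t \<oplus>\<^bsub>R\<^esub> c' t)"
  "a \<odot>\<^bsub>RC R X n\<^esub> c = (\<lambda>t. a \<otimes>\<^bsub>R\<^esub> c t)"
  by (simp_all add: RC_def)

lemma RC_neg: "c \<in> carrier (RC R X n) \<Longrightarrow> \<ominus>\<^bsub>RC R X n\<^esub> c = (\<lambda>t. \<ominus>\<^bsub>R\<^esub> c t)"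
  unfolding RC_def by (rule free_module_neg)

lemma realize_support:
  assumes c: "c \<in> carrier (RC R X n)" and s: "realize R Y a c s \<noteq> \<zero>\<^bsub>R\<^esub>"
  shows "walk Y s \<and> regular s \<and> (\<exists>t. c t \<noteq> \<zero>\<^bsub>R\<^esub> \<and> s \<in> Poly_Mapping.keys (a t))"
proof (rule ccontr)
  assume n: "\<not> ?thesis"
  have "walk Y s \<and> regular s" using s by (auto simp: realize_def split: if_splits)
  with n have 0: "Poly_Mapping.lookup (a t) s = 0" if "c t \<noteq> \<zero>\<^bsub>R\<^esub>" for t
    using that by (auto simp: in_keys_iff)
  have "(\<Oplus>\<^bsub>R\<^esub>t\<in>{t. c t \<noteq> \<zero>\<^bsub>R\<^esub>}. c t \<otimes>\<^bsub>R\<^esub> int_in R (Poly_Mapping.lookup (a t) s)) =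
      (\<Oplus>\<^bsub>R\<^esub>t\<in>{t. c t \<noteq> \<zero>\<^bsub>R\<^esub>}. \<zero>\<^bsub>R\<^esub>)"
    using c 0 by (intro R.finsum_cong') (auto simp: RC_iff)
  then show False using s by (auto simp: realize_def split: if_splits)
qed

lemma realize_closed [simp]:
  assumes "c \<in> carrier (RC R X n)" shows "realize R Y a c s \<in> carrier R"
  using assms by (auto simp: realize_def RC_iff intro!: R.finsum_closed)

lemma realize_finite:
  assumes c: "c \<in> carrier (RC R X n)"
  shows "finite {s. realize R Y a c s \<noteq> \<zero>\<^bsub>R\<^esub>}"
proof (rule finite_subset)
  show "{s. realize R Y a c s \<noteq> \<zero>\<^bsub>R\<^esub>} \<subseteq> (\<Union>t\<in>{t. c t \<noteq> \<zero>\<^bsub>R\<^esub>}. Poly_Mapping.keys (a t))"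
    using realize_support[OF c] by fast
  show "finite (\<Union>t\<in>{t. c t \<noteq> \<zero>\<^bsub>R\<^esub>}. Poly_Mapping.keys (a t))" using c by (simp add: RC_iff)
qed

lemma realize_RC:
  assumes a: "chain_op X Y d m a" and c: "c \<in> carrier (RC R X n)"
  shows "realize R Y a c \<in> carrier (RC R Y (n + d))"
  unfolding RC_iff
proof (intro conjI allI impI)
  fix s assume "realize R Y a c s \<noteq> \<zero>\<^bsub>R\<^esub>"
  from realize_support[OF c this]
  obtain t where t: "c t \<noteq> \<zero>\<^bsub>R\<^esub>" "s \<in> Poly_Mapping.keys (a t)" "walk Y s" "regular s" by blast
  then have "walk X t" "int (length t) = n + 1" using c by (auto simp: RC_iff)
  then show "walk Y s" "regular s" "int (length s) = n + d + 1"
    using t a by (auto simp: chain_op_def)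
qed (use c realize_finite in auto)

lemma realize_filt:
  assumes a: "chain_op X Y d m a" and c: "c \<in> RC_filt R X p n"
  shows "realize R Y a c \<in> RC_filt R Y (p + int m) (n + d)"
proof -
  have c': "c \<in> carrier (RC R X n)" using c by (simp add: RC_filt_def)
  have "enn2ereal (tuple_length Y s) \<le> ereal (of_int (p + int m))" if s: "realize R Y a c s \<noteq> \<zero>\<^bsub>R\<^esub>" for s
  proof -
    obtain t where t: "c t \<noteq> \<zero>\<^bsub>R\<^esub>" "s \<in> Poly_Mapping.keys (a t)"
      using realize_support[OF c' s] by blast
    have "walk X t" using c' t by (auto simp: RC_iff)
    then have "tuple_length Y s \<le> tuple_length X t + of_nat m" using t a by (auto simp: chain_op_def)
    then have "enn2ereal (tuple_length Y s) \<le> enn2ereal (tuple_length X t) + ereal (real m)"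
      by (simp add: less_eq_ennreal.rep_eq plus_ennreal.rep_eq)
    also have "\<dots> \<le> ereal (of_int p) + ereal (real m)"
      using c t by (intro add_right_mono) (simp add: RC_filt_def)
    finally show ?thesis by simp
  qed
  then show ?thesis using realize_RC[OF a c'] by (simp add: RC_filt_def)
qed

lemma realize_sum:
  assumes "c \<in> carrier (RC R X n)" "finite A" "{t. c t \<noteq> \<zero>\<^bsub>R\<^esub>} \<subseteq> A" "walk Y s" "regular s"
  shows "realize R Y a c s = (\<Oplus>\<^bsub>R\<^esub>t\<in>A. c t \<otimes>\<^bsub>R\<^esub> int_in R (Poly_Mapping.lookup (a t) s))"
proof -
  have "realize R Y a c s =
      (\<Oplus>\<^bsub>R\<^esub>t\<in>{t. c t \<noteq> \<zero>\<^bsub>R\<^esub>}. c t \<otimes>\<^bsub>R\<^esub> int_in R (Poly_Mapping.lookup (a t) s))"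
    using assms by (simp add: realize_def)
  also have "\<dots> = (\<Oplus>\<^bsub>R\<^esub>t\<in>A. c t \<otimes>\<^bsub>R\<^esub> int_in R (Poly_Mapping.lookup (a t) s))"
    using assms by (intro R.finsum_support) (auto simp: RC_iff)
  finally show ?thesis .
qed

lemma realize_linear:
  assumes a: "chain_op X Y d m a"
  shows "realize R Y a \<in> linear_maps R (RC R X n) (RC R Y (n + d))"
proof -
  interpret M: Module.module R "RC R X n" by (rule RC_module)
  have "realize R Y a (c \<oplus>\<^bsub>RC R X n\<^esub> c') s = realize R Y a c s \<oplus>\<^bsub>R\<^esub> realize R Y a c' s"
    if c: "c \<in> carrier (RC R X n)" "c' \<in> carrier (RC R X n)" for c c' s
  proof (cases "walk Y s \<and> regular s")
    case True
    let ?A = "{t. c t \<noteq> \<zero>\<^bsub>R\<^esub>} \<union> {t. c' t \<noteq> \<zero>\<^bsub>R\<^esub>}"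
    have A: "finite ?A" using c by (simp add: RC_iff)
    have "realize R Y a (c \<oplus>\<^bsub>RC R X n\<^esub> c') s =
        (\<Oplus>\<^bsub>R\<^esub>t\<in>?A. (c t \<oplus>\<^bsub>R\<^esub> c' t) \<otimes>\<^bsub>R\<^esub> int_in R (Poly_Mapping.lookup (a t) s))"
    proof -
      have "{t. (c \<oplus>\<^bsub>RC R X n\<^esub> c') t \<noteq> \<zero>\<^bsub>R\<^esub>} \<subseteq> ?A" by auto
      from realize_sum[OF M.M.a_closed[OF c] A this, of Y s a] True show ?thesis by simp
    qed
    also have "\<dots> = (\<Oplus>\<^bsub>R\<^esub>t\<in>?A. c t \<otimes>\<^bsub>R\<^esub> int_in R (Poly_Mapping.lookup (a t) s) \<oplus>\<^bsub>R\<^esub>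
        c' t \<otimes>\<^bsub>R\<^esub> int_in R (Poly_Mapping.lookup (a t) s))"
      using c by (intro R.finsum_cong') (auto simp: RC_iff R.l_distr)
    also have "\<dots> = realize R Y a c s \<oplus>\<^bsub>R\<^esub> realize R Y a c' s"
      using c True realize_sum[OF c(1) A, of Y s a] realize_sum[OF c(2) A, of Y s a]
      by (subst R.finsum_addf) (auto simp: RC_iff)
    finally show ?thesis .
  qed (auto simp: realize_def)
  moreover have "realize R Y a (k \<odot>\<^bsub>RC R X n\<^esub> c) s = k \<otimes>\<^bsub>R\<^esub> realize R Y a c s"
    if c: "c \<in> carrier (RC R X n)" and k: "k \<in> carrier R" for c k s
  proof (cases "walk Y s \<and> regular s")
    case True
    let ?A = "{t. c t \<noteq> \<zero>\<^bsub>R\<^esub>}"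
    have A: "finite ?A" using c by (simp add: RC_iff)
    have "realize R Y a (k \<odot>\<^bsub>RC R X n\<^esub> c) s =
        (\<Oplus>\<^bsub>R\<^esub>t\<in>?A. k \<otimes>\<^bsub>R\<^esub> c t \<otimes>\<^bsub>R\<^esub> int_in R (Poly_Mapping.lookup (a t) s))"
    proof -
      have "{t. (k \<odot>\<^bsub>RC R X n\<^esub> c) t \<noteq> \<zero>\<^bsub>R\<^esub>} \<subseteq> ?A" using k by auto
      from realize_sum[OF M.smult_closed[OF k c] A this, of Y s a] True show ?thesis by simp
    qed
    also have "\<dots> = (\<Oplus>\<^bsub>R\<^esub>t\<in>?A. k \<otimes>\<^bsub>R\<^esub> (c t \<otimes>\<^bsub>R\<^esub> int_in R (Poly_Mapping.lookup (a t) s)))"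
      using c k by (intro R.finsum_cong') (auto simp: RC_iff R.m_assoc)
    also have "\<dots> = k \<otimes>\<^bsub>R\<^esub> realize R Y a c s"
      using c k True A by (subst R.finsum_rdistr[symmetric]) (auto simp: RC_iff realize_def)
    finally show ?thesis .
  qed (use k in \<open>auto simp: realize_def\<close>)
  ultimately show ?thesis
    using realize_RC[OF a] by (auto simp: linear_maps_def fun_eq_iff)
qed

text \<open>The projection between the two factors loses nothing: a walk \<open>u\<close> that it discards is not
  regular, and \<open>b\<close> sends \<open>u\<close> to walks that are not regular either.\<close>

lemma realize_compose:
  assumes a: "chain_op X Y d m a" and b: "chain_op Y Z d' m' b" and c: "c \<in> carrier (RC R X n)"
  shows "realize R Z b (realize R Y a c) = realize R Z (\<lambda>t. frag_extend b (a t)) c"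
proof
  fix s
  show "realize R Z b (realize R Y a c) s = realize R Z (\<lambda>t. frag_extend b (a t)) c s"
  proof (cases "walk Z s \<and> regular s")
    case True
    let ?T = "{t. c t \<noteq> \<zero>\<^bsub>R\<^esub>}"
    \<comment> \<open>A common finite index set for the intermediate tuples, uniform in \<open>t\<close>.\<close>
    let ?U = "{u \<in> \<Union>t\<in>?T. Poly_Mapping.keys (a t). walk Y u \<and> regular u}"
    let ?a = "\<lambda>t u. Poly_Mapping.lookup (a t) u" and ?b = "\<lambda>u. Poly_Mapping.lookup (b u) s"
    have T: "finite ?T" and U: "finite ?U" using c by (simp_all add: RC_iff)
    have cR: "c t \<in> carrier R" for t using c by (simp add: RC_iff)
    have sub: "{u. realize R Y a c u \<noteq> \<zero>\<^bsub>R\<^esub>} \<subseteq> ?U" using realize_support[OF c] by fast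
    have "realize R Z b (realize R Y a c) s =
        (\<Oplus>\<^bsub>R\<^esub>u\<in>?U. realize R Y a c u \<otimes>\<^bsub>R\<^esub> int_in R (?b u))"
      using realize_sum[OF realize_RC[OF a c] U sub] True by blast
    also have "\<dots> = (\<Oplus>\<^bsub>R\<^esub>u\<in>?U. \<Oplus>\<^bsub>R\<^esub>t\<in>?T. c t \<otimes>\<^bsub>R\<^esub> int_in R (?a t u * ?b u))"
    proof (intro R.finsum_cong' refl)
      fix u assume u: "u \<in> ?U"
      have "realize R Y a c u \<otimes>\<^bsub>R\<^esub> int_in R (?b u) =
          (\<Oplus>\<^bsub>R\<^esub>t\<in>?T. c t \<otimes>\<^bsub>R\<^esub> int_in R (?a t u) \<otimes>\<^bsub>R\<^esub> int_in R (?b u))"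
        using u T cR by (subst R.finsum_ldistr[symmetric]) (auto simp: realize_def)
      also have "\<dots> = (\<Oplus>\<^bsub>R\<^esub>t\<in>?T. c t \<otimes>\<^bsub>R\<^esub> int_in R (?a t u * ?b u))"
        using cR by (intro R.finsum_cong') (auto simp: R.int_in_mult R.m_assoc)
      finally show "realize R Y a c u \<otimes>\<^bsub>R\<^esub> int_in R (?b u) =
          (\<Oplus>\<^bsub>R\<^esub>t\<in>?T. c t \<otimes>\<^bsub>R\<^esub> int_in R (?a t u * ?b u))" .
    qed (use cR in \<open>auto intro!: R.finsum_closed\<close>)
    also have "\<dots> = (\<Oplus>\<^bsub>R\<^esub>t\<in>?T. \<Oplus>\<^bsub>R\<^esub>u\<in>?U. c t \<otimes>\<^bsub>R\<^esub> int_in R (?a t u * ?b u))"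
      using T U cR by (intro R.finsum_swap) auto
    also have "\<dots> = (\<Oplus>\<^bsub>R\<^esub>t\<in>?T. c t \<otimes>\<^bsub>R\<^esub> int_in R (Poly_Mapping.lookup (frag_extend b (a t)) s))"
    proof (intro R.finsum_cong' refl)
      fix t assume t: "t \<in> ?T"
      have w: "walk X t" using c t by (auto simp: RC_iff)
      have "Poly_Mapping.lookup (frag_extend b (a t)) s = (\<Sum>u\<in>Poly_Mapping.keys (a t). ?a t u * ?b u)"
        by (simp add: frag_extend_def lookup_sum)
      also have "\<dots> = (\<Sum>u\<in>?U. ?a t u * ?b u)"
      proof (rule sum.mono_neutral_cong[OF U])
        show "?a t u * ?b u = 0" if "u \<in> Poly_Mapping.keys (a t) - ?U" for u
        proof -
          have "walk Y u" "\<not> regular u" using that t a w by (auto simp: chain_op_def)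
          then have "s \<notin> Poly_Mapping.keys (b u)" using b True by (auto simp: chain_op_def)
          then show ?thesis by (simp add: in_keys_iff)
        qed
      qed (auto simp: in_keys_iff)
      finally have "int_in R (Poly_Mapping.lookup (frag_extend b (a t)) s) =
          (\<Oplus>\<^bsub>R\<^esub>u\<in>?U. int_in R (?a t u * ?b u))" using U by (simp add: R.int_in_sum)
      then show "(\<Oplus>\<^bsub>R\<^esub>u\<in>?U. c t \<otimes>\<^bsub>R\<^esub> int_in R (?a t u * ?b u)) =
          c t \<otimes>\<^bsub>R\<^esub> int_in R (Poly_Mapping.lookup (frag_extend b (a t)) s)"
        using U cR by (simp add: R.finsum_rdistr Pi_def)
    qed (use cR in auto)
    also have "\<dots> = realize R Z (\<lambda>t. frag_extend b (a t)) c s" using True by (simp add: realize_def)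
    finally show ?thesis .
  qed (auto simp: realize_def)
qed

lemma realize_cong:
  assumes c: "c \<in> carrier (RC R X n)"
    and "\<And>t. walk X t \<Longrightarrow> a t = b t"
  shows "realize R Y a c = realize R Y b c"
  unfolding realize_def
proof (intro ext if_cong refl R.finsum_cong')
  show "c t \<otimes>\<^bsub>R\<^esub> int_in R (Poly_Mapping.lookup (a t) s) = c t \<otimes>\<^bsub>R\<^esub> int_in R (Poly_Mapping.lookup (b t) s)"
    if "t \<in> {t. c t \<noteq> \<zero>\<^bsub>R\<^esub>}" for s t
    using c that assms(2)[of t] by (auto simp: RC_iff)
qed (use c in \<open>auto simp: RC_iff\<close>)

lemma realize_add:
  assumes c: "c \<in> carrier (RC R X n)"
  shows "realize R Y (\<lambda>t. a t + b t) c = (\<lambda>s. realize R Y a c s \<oplus>\<^bsub>R\<^esub> realize R Y b c s)"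
proof
  fix s
  have cR: "c t \<in> carrier R" for t using c by (simp add: RC_iff)
  have "(\<Oplus>\<^bsub>R\<^esub>t\<in>{t. c t \<noteq> \<zero>\<^bsub>R\<^esub>}. c t \<otimes>\<^bsub>R\<^esub> int_in R (Poly_Mapping.lookup (a t + b t) s)) =
    (\<Oplus>\<^bsub>R\<^esub>t\<in>{t. c t \<noteq> \<zero>\<^bsub>R\<^esub>}. c t \<otimes>\<^bsub>R\<^esub> int_in R (Poly_Mapping.lookup (a t) s) \<oplus>\<^bsub>R\<^esub>
      c t \<otimes>\<^bsub>R\<^esub> int_in R (Poly_Mapping.lookup (b t) s))"
    using cR by (intro R.finsum_cong') (auto simp: lookup_add R.int_in_add R.r_distr)
  then show "realize R Y (\<lambda>t. a t + b t) c s = realize R Y a c s \<oplus>\<^bsub>R\<^esub> realize R Y b c s"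
    using cR by (simp add: realize_def R.finsum_addf)
qed

lemma realize_zero:
  assumes c: "c \<in> carrier (RC R X n)"
  shows "realize R Y (\<lambda>t. 0) c = (\<lambda>s. \<zero>\<^bsub>R\<^esub>)"
  using realize_support[OF c, of Y "\<lambda>t. 0"] by auto

lemma realize_id:
  assumes c: "c \<in> carrier (RC R X n)"
  shows "realize R X frag_of c = c"
proof
  fix s
  have cR: "c t \<in> carrier R" for t using c by (simp add: RC_iff)
  show "realize R X frag_of c s = c s"
  proof (cases "c s = \<zero>\<^bsub>R\<^esub>")
    case True
    then show ?thesis using realize_support[OF c, of X frag_of s] by auto
  next
    case False
    let ?T = "{t. c t \<noteq> \<zero>\<^bsub>R\<^esub>}"
    have "realize R X frag_of c s = (\<Oplus>\<^bsub>R\<^esub>t\<in>?T. c t \<otimes>\<^bsub>R\<^esub> int_in R (if s = t then 1 else 0))"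
      using c False by (auto simp: realize_def RC_iff)
    also have "\<dots> = (\<Oplus>\<^bsub>R\<^esub>t\<in>?T. if s = t then c t else \<zero>\<^bsub>R\<^esub>)"
      using cR by (intro R.finsum_cong') auto
    also have "\<dots> = c s" using c False cR by (intro R.finsum_singleton) (auto simp: RC_iff)
    finally show ?thesis .
  qed
qed

lemma lookup_bd:
  "Poly_Mapping.lookup (bd t) s = (\<Sum>i\<in>{i. i < length t \<and> delete_nth i t = s}. (-1) ^ i)"
proof (induction t arbitrary: s)
  case (Cons x t)
  let ?I = "{i. i < length t \<and> x # delete_nth i t = s}"
  have I: "{i. i < length (x # t) \<and> delete_nth i (x # t) = s} = (if t = s then {0} else {}) \<union> Suc ` ?I"
  proof (rule Set.set_eqI)
    fix i show "i \<in> {i. i < length (x # t) \<and> delete_nth i (x # t) = s} \<longleftrightarrow>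
      i \<in> (if t = s then {0} else {}) \<union> Suc ` ?I"
      by (cases i) (auto simp: delete_nth_def)
  qed
  have "(\<Sum>i\<in>{i. i < length (x # t) \<and> delete_nth i (x # t) = s}. (-1) ^ i :: int) =
      (if t = s then 1 else 0) + (\<Sum>i\<in>Suc ` ?I. (-1) ^ i)"
    unfolding I by (subst sum.union_disjoint) auto
  also have "(\<Sum>i\<in>Suc ` ?I. (-1) ^ i :: int) = - (\<Sum>i\<in>?I. (-1) ^ i)"
    by (simp add: sum.reindex sum_negf)
  also have "(\<Sum>i\<in>?I. (-1) ^ i) = Poly_Mapping.lookup (cons_chain x (bd t)) s"
    by (auto simp: lookup_cons_chain Cons.IH split: list.split)
  finally show ?case by (auto simp: lookup_minus)
qed simp

text \<open>A regular tuple \<open>s\<close> of the wrong length has coefficient zero on the left by definition and on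
  the right because faces are one vertex shorter.\<close>

lemma boundary_realize:
  assumes X: "quasimetric X" and c: "c \<in> carrier (RC R X n)"
  shows "boundary R X n c = realize R X bd c"
proof
  fix s
  have cR: "c t \<in> carrier R" for t using c by (simp add: RC_iff)
  have coeff: "boundary_coeff R X n t s = int_in R (Poly_Mapping.lookup (bd t) s)"
    if t: "c t \<noteq> \<zero>\<^bsub>R\<^esub>" and s: "walk X s" "regular s" for t
  proof -
    have tX: "walk X t" "int (length t) = n + 1" using c t by (auto simp: RC_iff)
    show ?thesis
    proof (cases "int (length s) = n")
      case True
      then have "s \<in> regular_tuples X (n - 1)" using s by (simp add: regular_tuples_iff)
      then show ?thesis
        by (simp add: boundary_coeff_def lookup_bd R.int_in_sum R.int_in_power R.int_in_neg)
    next
      case False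
      then have "s \<notin> Poly_Mapping.keys (bd t)"
        using chain_op_bd[OF X] tX unfolding chain_op_def by force
      then show ?thesis using False
        by (simp add: boundary_coeff_def regular_tuples_iff in_keys_iff)
    qed
  qed
  show "boundary R X n c s = realize R X bd c s"
  proof (cases "walk X s \<and> regular s")
    case True
    then show ?thesis using cR coeff
      by (simp add: boundary_def realize_def) (intro R.finsum_cong'; auto)
  next
    case False
    then have "s \<notin> regular_tuples X (n - 1)" by (auto simp: regular_tuples_iff)
    then have "boundary R X n c s = (\<Oplus>\<^bsub>R\<^esub>t\<in>{t. c t \<noteq> \<zero>\<^bsub>R\<^esub>}. \<zero>\<^bsub>R\<^esub>)"
      unfolding boundary_def boundary_coeff_def using cR by (intro R.finsum_cong') auto
    then show ?thesis using False by (auto simp: realize_def)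
  qed
qed

lemma filt_submodule_RC: "submodule (RC_filt R X p n) R (RC R X n)"
proof -
  interpret M: Module.module R "RC R X n" by (rule RC_module)
  show ?thesis
  proof (rule M.submoduleI)
    show "\<ominus>\<^bsub>RC R X n\<^esub> c \<in> RC_filt R X p n" if "c \<in> RC_filt R X p n" for c
    proof -
      have c: "c \<in> carrier (RC R X n)" using that by (simp add: RC_filt_def)
      have "c t \<noteq> \<zero>\<^bsub>R\<^esub>" if "\<ominus>\<^bsub>R\<^esub> c t \<noteq> \<zero>\<^bsub>R\<^esub>" for t using that by auto
      then show ?thesis
        using that RC_neg[OF c] M.M.a_inv_closed[OF c] by (auto simp: RC_filt_def)
    qed
    fix c c' assume c: "c \<in> RC_filt R X p n" "c' \<in> RC_filt R X p n"
    then have "c \<oplus>\<^bsub>RC R X n\<^esub> c' \<in> carrier (RC R X n)"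
      by (intro M.M.a_closed) (simp_all add: RC_filt_def)
    moreover have "c t \<noteq> \<zero>\<^bsub>R\<^esub> \<or> c' t \<noteq> \<zero>\<^bsub>R\<^esub>" if "c t \<oplus>\<^bsub>R\<^esub> c' t \<noteq> \<zero>\<^bsub>R\<^esub>" for t using that by auto
    ultimately show "c \<oplus>\<^bsub>RC R X n\<^esub> c' \<in> RC_filt R X p n" using c by (auto simp: RC_filt_def)
  next
    fix k c assume k: "k \<in> carrier R" "c \<in> RC_filt R X p n"
    then have "k \<odot>\<^bsub>RC R X n\<^esub> c \<in> carrier (RC R X n)"
      by (intro M.smult_closed) (simp_all add: RC_filt_def)
    moreover have "c t \<noteq> \<zero>\<^bsub>R\<^esub>" if "k \<otimes>\<^bsub>R\<^esub> c t \<noteq> \<zero>\<^bsub>R\<^esub>" for t using that k by auto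
    ultimately show "k \<odot>\<^bsub>RC R X n\<^esub> c \<in> RC_filt R X p n" using k by (auto simp: RC_filt_def)
  qed (use M.M.zero_closed in \<open>auto simp: RC_filt_def\<close>)
qed

lemma filtered_complex_rc:
  assumes X: "quasimetric X" shows "filtered_complex R (rc R X)"
proof (rule filtered_complex.intro; simp only: rc_simps)
  note bd = chain_op_bd[OF X]
  show "boundary R X n \<in> linear_maps R (RC R X n) (RC R X (n - 1))" for n
  proof -
    interpret M: Module.module R "RC R X n" by (rule RC_module)
    show ?thesis
      using realize_linear[OF bd, of n] M.M.a_closed M.smult_closed
      by (auto simp: linear_maps_def boundary_realize[OF X] simp del: RC_ops)
  qed
  show "boundary R X n c \<in> RC_filt R X p (n - 1)" if "c \<in> RC_filt R X p n" for c p n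
    using realize_filt[OF bd that] that by (simp add: boundary_realize[OF X] RC_filt_def)
  show "boundary R X (n - 1) (boundary R X n c) = \<zero>\<^bsub>RC R X (n - 1 - 1)\<^esub>"
    if c: "c \<in> carrier (RC R X n)" for n c
    using realize_RC[OF bd c] realize_compose[OF bd bd c] realize_zero[OF c] c
    by (simp add: boundary_realize[OF X] bd_bd)
  show "RC_filt R X (p - 1) n \<subseteq> RC_filt R X p n" for p n
    by (auto simp: RC_filt_def intro: order_trans)
qed (rule RC_module filt_submodule_RC)+

end

section \<open>Short maps and homotopies on chains\<close>

definition push :: "'k ring \<Rightarrow> 'b qspace \<Rightarrow> ('a \<Rightarrow> 'b) \<Rightarrow> ('a list \<Rightarrow> 'k) \<Rightarrow> ('b list \<Rightarrow> 'k)" where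
  "push R Y \<phi> = realize R Y (map_chain \<phi>)"

lemma push_compose:
  assumes "cring R" "\<phi> \<in> short_maps X Y" "\<psi> \<in> short_maps Y Z" "c \<in> carrier (RC R X n)"
  shows "push R Z \<psi> (push R Y \<phi> c) = push R Z (\<lambda>x. \<psi> (\<phi> x)) c"
proof -
  have "frag_extend (map_chain \<psi>) (map_chain \<phi> t) = map_chain (\<lambda>x. \<psi> (\<phi> x)) t" for t
    by (simp add: map_chain_def comp_def)
  then show ?thesis
    unfolding push_def
    using realize_compose[OF assms(1) chain_op_map[OF assms(2)] chain_op_map[OF assms(3)] assms(4)]
    by simp
qed

lemma push_cong:
  assumes "cring R" "c \<in> carrier (RC R X n)" "\<And>x. x \<in> points X \<Longrightarrow> \<phi> x = \<psi> x"
  shows "push R Y \<phi> c = push R Y \<psi> c"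
  unfolding push_def
proof (rule realize_cong[OF assms(1,2)])
  fix t assume "walk X t"
  then have "map \<phi> t = map \<psi> t" using assms(3) by (auto simp: walk_def)
  then show "map_chain \<phi> t = map_chain \<psi> t" unfolding map_chain_def by (rule arg_cong)
qed

lemma push_id:
  fixes X :: "'a qspace"
  assumes "cring R" "c \<in> carrier (RC R X n)" "\<And>x. x \<in> points X \<Longrightarrow> \<phi> x = x"
  shows "push R X \<phi> c = c"
proof -
  have "push R X \<phi> c = push R X (\<lambda>x. x) c" using assms by (rule push_cong)
  also have "map_chain (\<lambda>x :: 'a. x) = frag_of" by (auto simp: map_chain_def)
  then have "push R X (\<lambda>x. x) c = c" unfolding push_def using realize_id[OF assms(1,2)] by simp
  finally show ?thesis .
qed

lemma filtered_map_push:
  assumes R: "cring R" and X: "quasimetric X" and Y: "quasimetric Y" and \<phi>: "\<phi> \<in> short_maps X Y"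
  shows "filtered_map R (rc R X) (rc R Y) (\<lambda>n. push R Y \<phi>)"
proof (intro filtered_map.intro filtered_map_axioms.intro filtered_complex_rc R X Y; simp only: rc_simps)
  note m = chain_op_map[OF \<phi>]
  show "push R Y \<phi> \<in> linear_maps R (RC R X n) (RC R Y n)" for n
    using realize_linear[OF R m, of n] by (simp add: push_def)
  show "push R Y \<phi> c \<in> RC_filt R Y p n" if "c \<in> RC_filt R X p n" for c p n
    using realize_filt[OF R m that] by (simp add: push_def)
  show "push R Y \<phi> (boundary R X n c) = boundary R Y n (push R Y \<phi> c)"
    if c: "c \<in> carrier (RC R X n)" for n c
  proof -
    have "push R Y \<phi> c \<in> carrier (RC R Y n)" using realize_RC[OF R m c] by (simp add: push_def)
    then have "boundary R Y n (push R Y \<phi> c) = realize R Y bd (push R Y \<phi> c)"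
      by (rule boundary_realize[OF R Y])
    also have "\<dots> = realize R Y (\<lambda>t. frag_extend bd (map_chain \<phi> t)) c"
      unfolding push_def by (rule realize_compose[OF R m chain_op_bd[OF Y] c])
    also have "(\<lambda>t. frag_extend bd (map_chain \<phi> t)) = (\<lambda>t. frag_extend (map_chain \<phi>) (bd t))"
      using bd_map by (auto simp: map_chain_def)
    also have "realize R Y \<dots> c = push R Y \<phi> (realize R X bd c)"
      unfolding push_def by (rule realize_compose[OF R chain_op_bd[OF X] m c, symmetric])
    finally show ?thesis by (simp add: boundary_realize[OF R X c])
  qed
qed

definition integral_qspace :: "'a qspace \<Rightarrow> bool" where
  "integral_qspace X \<longleftrightarrow>
     (\<forall>x\<in>points X. \<forall>y\<in>points X. qdist X x y < \<infinity> \<longrightarrow> (\<exists>k. qdist X x y = of_nat k))"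

lemma integral_Q: "integral_qspace (Q G)"
  unfolding integral_qspace_def by (metis Q_dist_attained)

lemma frag_extend_op:
  "frag_extend (\<lambda>t. - h t) c = - frag_extend h c"
  "frag_extend (\<lambda>t. h t + h' t) c = frag_extend h c + frag_extend h' c"
  using subset_UNIV by (induction c rule: frag_induction) (simp_all add: frag_extend_diff)

text \<open>Existence of an integral homotopy operator is an equivalence relation on short maps, so it
  is enough to treat a generating pair, for which the prism operator serves. Since distances are
  integers, a distance of at most \<open>r\<close> is at most the integral part of \<open>r\<close>.\<close>

lemma r_homotopic_chain_homotopy:
  assumes \<phi>\<psi>: "(\<phi>, \<psi>) \<in> r_homotopic r X Y" and Y: "integral_qspace Y" and r: "0 \<le> r"
  shows "\<exists>h. chain_op X Y 1 (nat \<lfloor>r\<rfloor>) h \<and>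
    (\<forall>t. frag_extend bd (h t) + frag_extend h (bd t) = map_chain \<psi> t - map_chain \<phi> t)"
proof -
  let ?P = "\<lambda>\<phi> \<psi> h. chain_op X Y 1 (nat \<lfloor>r\<rfloor>) h \<and>
    (\<forall>t. frag_extend bd (h t) + frag_extend h (bd t) = map_chain \<psi> t - map_chain \<phi> t)"
  let ?S = "short_maps X Y"
  let ?E = "{(\<phi>, \<psi>) \<in> ?S \<times> ?S. \<exists>h. ?P \<phi> \<psi> h}"
  have "equiv ?S ?E"
  proof (rule equivI)
    have "?P \<phi> \<phi> (\<lambda>t. 0)" for \<phi>
      by (simp add: chain_op_zero frag_extend_def)
    then show "refl_on ?S ?E" unfolding refl_on_def by blast
    have "?P \<psi> \<phi> (\<lambda>t. - h t)" if "?P \<phi> \<psi> h" for \<phi> \<psi> h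
    proof (intro conjI allI)
      show "chain_op X Y 1 (nat \<lfloor>r\<rfloor>) (\<lambda>t. - h t)" using that chain_op_neg by blast
      fix t
      have "frag_extend bd (- h t) + frag_extend (\<lambda>t. - h t) (bd t) =
          - (frag_extend bd (h t) + frag_extend h (bd t))"
        by (simp add: frag_extend_op frag_extend_minus)
      then show "frag_extend bd (- h t) + frag_extend (\<lambda>t. - h t) (bd t) = map_chain \<phi> t - map_chain \<psi> t"
        using that by simp
    qed
    then show "sym ?E" unfolding sym_def by blast
    have "?P \<phi> \<chi> (\<lambda>t. h t + h' t)" if "?P \<phi> \<psi> h" "?P \<psi> \<chi> h'" for \<phi> \<psi> \<chi> h h'
    proof (intro conjI allI)
      show "chain_op X Y 1 (nat \<lfloor>r\<rfloor>) (\<lambda>t. h t + h' t)" using that chain_op_add by blast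
      fix t
      have "frag_extend bd (h t + h' t) + frag_extend (\<lambda>t. h t + h' t) (bd t) =
          (frag_extend bd (h t) + frag_extend h (bd t)) + (frag_extend bd (h' t) + frag_extend h' (bd t))"
        by (simp add: frag_extend_op frag_extend_add)
      then show "frag_extend bd (h t + h' t) + frag_extend (\<lambda>t. h t + h' t) (bd t) =
          map_chain \<chi> t - map_chain \<phi> t"
        using that by simp
    qed
    then show "trans ?E" unfolding trans_def by blast
  qed auto
  moreover have "(\<phi>, \<psi>) \<in> ?E"
    if s: "\<phi> \<in> ?S" "\<psi> \<in> ?S" and d: "map_dist X Y \<phi> \<psi> \<le> ennreal r" for \<phi> \<psi>
  proof -
    have "qdist Y (\<phi> x) (\<psi> x) \<le> of_nat (nat \<lfloor>r\<rfloor>)" if x: "x \<in> points X" for x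
    proof -
      have le: "qdist Y (\<phi> x) (\<psi> x) \<le> ennreal r"
        using SUP_upper[OF x, of "\<lambda>x. qdist Y (\<phi> x) (\<psi> x)"] d unfolding map_dist_def by (rule order_trans)
      then have "qdist Y (\<phi> x) (\<psi> x) < \<infinity>" by (rule le_less_trans) simp
      moreover have "\<phi> x \<in> points Y" "\<psi> x \<in> points Y" using s x by (auto simp: short_maps_def)
      ultimately obtain k where k: "qdist Y (\<phi> x) (\<psi> x) = of_nat k"
        using Y unfolding integral_qspace_def by blast
      then have "real k \<le> r" using le r by (simp add: ennreal_of_nat_eq_real_of_nat)
      then have "k \<le> nat \<lfloor>r\<rfloor>" by (simp add: le_nat_floor)
      then show ?thesis unfolding k by simp
    qed
    then have "?P \<phi> \<psi> (prism \<phi> \<psi>)" using chain_op_prism[OF s] prism_homotopy by blast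
    then show ?thesis using s by blast
  qed
  ultimately have "(\<phi>, \<psi>) \<in> ?E" using r_homotopic_induct[OF \<phi>\<psi>] by blast
  then show ?thesis by blast
qed

section \<open>Minimal spaces\<close>

lemma short_maps_mem: "f \<in> short_maps X Y \<Longrightarrow> x \<in> points X \<Longrightarrow> f x \<in> points Y"
  by (auto simp: short_maps_def)

lemma r_homotopic_refl: "f \<in> short_maps X Y \<Longrightarrow> (f, f) \<in> r_homotopic r X Y"
  using equiv_r_homotopic[of X Y r] by (simp add: equiv_def refl_on_def)

lemma r_homotopic_trans:
  "(f, g) \<in> r_homotopic r X Y \<Longrightarrow> (g, h) \<in> r_homotopic r X Y \<Longrightarrow> (f, h) \<in> r_homotopic r X Y"
  using equiv_r_homotopic[of X Y r] unfolding equiv_def by (blast dest: transD)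

lemma r_homotopic_mono: "r \<le> r' \<Longrightarrow> r_homotopic r X Y \<subseteq> r_homotopic r' X Y"
proof
  fix z assume le: "r \<le> r'" and z: "z \<in> r_homotopic r X Y"
  obtain f g where fg: "z = (f, g)" by (cases z)
  have "(f, g) \<in> r_homotopic r' X Y"
  proof (rule r_homotopic_induct[OF z[unfolded fg] equiv_r_homotopic])
    fix \<phi> \<psi> assume "\<phi> \<in> short_maps X Y" "\<psi> \<in> short_maps X Y" "map_dist X Y \<phi> \<psi> \<le> ennreal r"
    moreover have "ennreal r \<le> ennreal r'" using le by (rule ennreal_leI)
    ultimately show "(\<phi>, \<psi>) \<in> r_homotopic r' X Y" by (blast intro: r_homotopic_base order_trans)
  qed
  then show "z \<in> r_homotopic r' X Y" using fg by simp
qed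

text \<open>Among the finitely many powers of \<open>f\<close> one is idempotent. Being homotopic to the identity, it
  retracts the space onto a deformation retract, which by minimality is everything; and an
  idempotent surjection is the identity.\<close>

lemma r_minimal_periodic:
  assumes M: "r_minimal r M" and f: "f \<in> short_maps M M" and hf: "(f, id_map M) \<in> r_homotopic r M M"
  shows "\<exists>N\<ge>1. \<forall>x\<in>points M. (f ^^ N) x = x"
proof -
  let ?P = "points M"
  let ?g = "\<lambda>n. \<lambda>x\<in>?P. (f ^^ n) x"
  have fin: "finite ?P" using M by (simp add: r_minimal_def)
  have fP: "(f ^^ n) x \<in> ?P" if "x \<in> ?P" for n x
    by (induction n) (simp_all add: that short_maps_mem[OF f])
  have g0: "?g 0 = id_map M" by (simp add: id_map_def)
  have gS: "?g (Suc n) = compose ?P f (?g n)" for n by (auto simp: compose_def)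
  have gshort: "?g n \<in> short_maps M M" for n
  proof (induction n)
    case 0
    then show ?case unfolding g0 by simp
  next
    case (Suc n)
    then show ?case unfolding gS using f by (rule compose_short)
  qed
  have ghom: "(?g n, id_map M) \<in> r_homotopic r M M" for n
  proof (induction n)
    case 0
    then show ?case unfolding g0 by (rule r_homotopic_refl) simp
  next
    case (Suc n)
    have "(compose ?P f (compose ?P (?g n) (id_map M)), compose ?P f (compose ?P (id_map M) (id_map M)))
        \<in> r_homotopic r M M"
      using Suc id_short f by (rule r_homotopic_compose)
    moreover have "compose ?P f (compose ?P (?g n) (id_map M)) = ?g (Suc n)"
      by (auto simp: compose_def id_map_def)
    moreover have "compose ?P f (compose ?P (id_map M) (id_map M)) = f"
      using f by (auto simp: compose_def id_map_def short_maps_def fun_eq_iff PiE_iff extensional_def)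
    ultimately have "(?g (Suc n), f) \<in> r_homotopic r M M" by (simp only:)
    then show ?case using hf by (rule r_homotopic_trans)
  qed
  have "\<exists>N\<ge>1. \<forall>x\<in>?P. (f ^^ (N + N)) x = (f ^^ N) x"
  proof -
    have "range ?g \<subseteq> ?P \<rightarrow>\<^sub>E ?P" using fP by auto
    moreover have "finite (?P \<rightarrow>\<^sub>E ?P)" using fin by (intro finite_PiE)
    ultimately have "finite (range ?g)" by (rule finite_subset)
    then have "\<not> inj ?g" using finite_imageD[of ?g UNIV] infinite_UNIV_nat by blast
    then have "\<exists>a b. a < b \<and> ?g a = ?g b" using linorder_injI[of ?g] by blast
    then obtain a b where ab: "a < b" "?g a = ?g b" by blast
    define p where "p = b - a"
    have p: "1 \<le> p" "b = p + a" using ab(1) by (simp_all add: p_def)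
    have ab': "(f ^^ b) x = (f ^^ a) x" if "x \<in> ?P" for x using fun_cong[OF ab(2), of x] that by simp
    have per: "(f ^^ (p + m)) x = (f ^^ m) x" if "a \<le> m" "x \<in> ?P" for m x
    proof -
      have "(f ^^ (p + m)) x = (f ^^ (m - a)) ((f ^^ b) x)"
        using that p(2) by (simp add: funpow_add[symmetric, THEN fun_cong, unfolded comp_def] add.commute)
      also have "\<dots> = (f ^^ m) x"
        using that ab' by (simp add: funpow_add[symmetric, THEN fun_cong, unfolded comp_def])
      finally show ?thesis .
    qed
    have per': "(f ^^ (k * p + m)) x = (f ^^ m) x" if "a \<le> m" "x \<in> ?P" for k m x
    proof (induction k)
      case (Suc k)
      have "(f ^^ (Suc k * p + m)) x = (f ^^ (p + (k * p + m))) x" by (simp add: add.assoc)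
      also have "\<dots> = (f ^^ (k * p + m)) x" using that by (intro per) auto
      finally show ?case using Suc by simp
    qed simp
    \<comment> \<open>A positive multiple of the period that is not below the preperiod.\<close>
    let ?N = "Suc a * p"
    have "a \<le> a * p" using p(1) by simp
    then have "a \<le> ?N" unfolding mult_Suc by (rule trans_le_add2)
    from per'[OF this, of _ "Suc a"] have "\<forall>x\<in>?P. (f ^^ (?N + ?N)) x = (f ^^ ?N) x" by (rule ballI)
    moreover have "1 \<le> ?N" using p(1) by simp
    ultimately show ?thesis by (intro exI[of _ ?N] conjI)
  qed
  then obtain N where N1: "N \<ge> 1" and NN: "\<forall>x\<in>?P. (f ^^ (N + N)) x = (f ^^ N) x" by blast
  have N: "N \<ge> 1" "\<And>x. x \<in> ?P \<Longrightarrow> (f ^^ N) ((f ^^ N) x) = (f ^^ N) x"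
    using N1 NN by (simp_all add: funpow_add)
  let ?A = "(f ^^ N) ` ?P"
  have A: "?A \<subseteq> ?P" using fP by auto
  have "r_deformation_retract r M ?A"
    unfolding r_deformation_retract_def
  proof (intro conjI bexI[of _ "?g N"] A)
    show "?g N \<in> short_maps M (qsubspace M ?A)" using gshort[of N] by (auto simp: short_maps_def)
    show "compose ?A (?g N) (id_map (qsubspace M ?A)) = id_map (qsubspace M ?A)"
      using A N(2) by (auto simp: compose_def id_map_def fun_eq_iff)
    have "compose ?P (id_map (qsubspace M ?A)) (?g N) = ?g N"
      by (auto simp: compose_def id_map_def fun_eq_iff)
    then show "(compose ?P (id_map (qsubspace M ?A)) (?g N), id_map M) \<in> r_homotopic r M M"
      using ghom[of N] by simp
  qed
  then have AP: "?A = ?P" using M unfolding r_minimal_def by blast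
  have "(f ^^ N) x = x" if "x \<in> ?P" for x
  proof -
    have "x \<in> ?A" using that unfolding AP .
    then obtain y where "y \<in> ?P" "x = (f ^^ N) y" by (rule imageE)
    then show ?thesis using N(2)[of y] by simp
  qed
  then show ?thesis using N(1) by (intro exI[of _ N]) simp
qed

text \<open>
  Restricting a homotopy equivalence of \<open>X\<close> and \<open>H\<close> gives maps \<open>u\<close> from \<open>A\<close> to \<open>H\<close> and \<open>v\<close> back,
  both composites of which have a power equal to the identity. Hence \<open>v\<close> is an isometry of \<open>H\<close> with
  \<open>A\<close>; its inverse is \<open>u\<close> followed by a power of \<open>u v\<close>.
\<close>

lemma minimal_retract_isometric:
  assumes A: "A \<subseteq> points X" and s: "s \<in> short_maps X X" "\<And>x. x \<in> points X \<Longrightarrow> s x \<in> A"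
    "\<And>x. x \<in> A \<Longrightarrow> s x = x" "(s, id_map X) \<in> r_homotopic r X X"
    and min: "r_minimal r (qsubspace X A)" and H: "is_M r X H"
  shows "\<exists>\<alpha>\<in>short_maps H X. \<exists>\<beta>\<in>short_maps X H.
    (\<forall>y\<in>points H. \<beta> (\<alpha> y) = y) \<and> (\<forall>x\<in>points X. \<alpha> (\<beta> x) = s x)"
proof -
  let ?A = "qsubspace X A"
  have minH: "r_minimal r H" using H by (simp add: is_M_def)
  obtain \<phi> \<psi> where \<phi>: "\<phi> \<in> short_maps X H" and \<psi>: "\<psi> \<in> short_maps H X"
    and \<psi>\<phi>: "(compose (points X) \<psi> \<phi>, id_map X) \<in> r_homotopic r X X"
    and \<phi>\<psi>: "(compose (points H) \<phi> \<psi>, id_map H) \<in> r_homotopic r H H"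
    using H unfolding is_M_def r_homotopy_equivalent_def by blast
  have sA: "s \<in> short_maps X ?A" using s(1,2) by (auto simp: short_maps_def)
  have iA: "id_map ?A \<in> short_maps ?A X" using A by (rule id_map_short)
  note mem = short_maps_mem[OF \<phi>] short_maps_mem[OF \<psi>] s(2) subsetD[OF A]
  define u where "u = compose A \<phi> (id_map ?A)"
  define v where "v = compose (points H) s \<psi>"
  have u: "u \<in> short_maps ?A H" using compose_short[OF iA \<phi>] by (simp add: u_def)
  have v: "v \<in> short_maps H ?A" using compose_short[OF \<psi> sA] by (simp add: v_def)
  have ux: "u a = \<phi> a" if "a \<in> A" for a using that by (simp add: u_def compose_def id_map_def)
  have vx: "v y = s (\<psi> y)" if "y \<in> points H" for y using that by (simp add: v_def compose_def)
  let ?f = "compose (points H) u v" and ?g = "compose A v u"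
  have f: "?f \<in> short_maps H H" using v u by (rule compose_short)
  have g: "?g \<in> short_maps ?A ?A" using compose_short[OF u v] by simp
  have "(compose (points H) \<phi> (compose (points H) s \<psi>),
    compose (points H) \<phi> (compose (points H) (id_map X) \<psi>))
      \<in> r_homotopic r H H"
    using s(4) \<psi> \<phi> by (rule r_homotopic_compose)
  moreover have "compose (points H) \<phi> (compose (points H) s \<psi>) = ?f"
    by (auto simp: compose_def fun_eq_iff vx ux mem)
  moreover have "compose (points H) \<phi> (compose (points H) (id_map X) \<psi>) = compose (points H) \<phi> \<psi>"
    by (auto simp: compose_def fun_eq_iff id_map_def mem)
  ultimately have hf: "(?f, id_map H) \<in> r_homotopic r H H" using \<phi>\<psi> r_homotopic_trans by metis
  have "(compose (points ?A) s (compose (points ?A) (compose (points X) \<psi> \<phi>) (id_map ?A)),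
      compose (points ?A) s (compose (points ?A) (id_map X) (id_map ?A))) \<in> r_homotopic r ?A ?A"
    using \<psi>\<phi> iA sA by (rule r_homotopic_compose)
  moreover have "compose (points ?A) s (compose (points ?A) (compose (points X) \<psi> \<phi>) (id_map ?A)) = ?g"
    by (auto simp: compose_def fun_eq_iff vx ux mem id_map_def)
  moreover have "compose (points ?A) s (compose (points ?A) (id_map X) (id_map ?A)) = id_map ?A"
    using s(3) by (auto simp: compose_def fun_eq_iff id_map_def mem)
  ultimately have hg: "(?g, id_map ?A) \<in> r_homotopic r ?A ?A" by simp
  obtain N where N: "N \<ge> 1" "\<And>y. y \<in> points H \<Longrightarrow> (?f ^^ N) y = y"
    using r_minimal_periodic[OF minH f hf] by blast
  obtain K where K: "K \<ge> 1" "\<And>a. a \<in> A \<Longrightarrow> (?g ^^ K) a = a"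
    using r_minimal_periodic[OF min g hg] by auto
  have NS: "N = Suc (N - 1)" and KS: "K = Suc (K - 1)" using N(1) K(1) by simp_all
  have fH: "(?f ^^ n) y \<in> points H" if "y \<in> points H" for n y
    by (induction n) (simp_all add: that short_maps_mem[OF f])
  have gA: "(?g ^^ n) a \<in> A" if "a \<in> A" for n a
    using short_maps_mem[OF g] by (induction n) (simp_all add: that)
  define w where "w = (\<lambda>y\<in>points H. (?f ^^ (N - 1)) y)"
  have w: "w \<in> short_maps H H"
  proof -
    have "(\<lambda>y\<in>points H. (?f ^^ n) y) \<in> short_maps H H" for n
    proof (induction n)
      case 0
      have "(\<lambda>y\<in>points H. (?f ^^ 0) y) = id_map H" by (simp add: id_map_def)
      then show ?case by simp
    next
      case (Suc n)
      have "(\<lambda>y\<in>points H. (?f ^^ Suc n) y) = compose (points H) ?f (\<lambda>y\<in>points H. (?f ^^ n) y)"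
        by (auto simp: compose_def[of _ ?f])
      then show ?case using compose_short[OF Suc f] by (simp only:)
    qed
    then show ?thesis by (simp add: w_def)
  qed
  \<comment> \<open>\<open>w\<close> is the inverse of \<open>u v\<close>, so \<open>w u\<close> is a left inverse of \<open>v\<close>.\<close>
  let ?\<beta> = "compose (points X) w (compose (points X) u s)"
  have \<beta>: "?\<beta> \<in> short_maps X H"
    using compose_short[OF compose_short[OF sA u] w] .
  have v': "v \<in> short_maps H X" using v A by (auto simp: short_maps_def)
  have vA: "v y \<in> A" if "y \<in> points H" for y using short_maps_mem[OF v that] by simp
  have uH: "u a \<in> points H" if "a \<in> A" for a using short_maps_mem[OF u] that by simp
  have fy: "?f y = u (v y)" if "y \<in> points H" for y using that by (simp add: compose_def)
  have ga: "?g a = v (u a)" if "a \<in> A" for a using that by (simp add: compose_def)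
  have \<beta>x: "?\<beta> x = (?f ^^ (N - 1)) (u (s x))" if "x \<in> points X" for x
  proof -
    have "u (s x) \<in> points H" using uH[OF s(2)[OF that]] .
    then show ?thesis unfolding compose_eq[OF that] w_def by (rule restrict_apply'[of _ _ "?f ^^ (N - 1)"])
  qed
  have "?\<beta> (v y) = y" if y: "y \<in> points H" for y
  proof -
    have "?\<beta> (v y) = (?f ^^ (N - 1)) (?f y)"
      using \<beta>x[of "v y"] vA[OF y] A s(3) fy[OF y] by auto
    also have "\<dots> = (?f ^^ N) y" by (subst NS) (simp only: funpow_Suc_right comp_apply)
    finally show ?thesis using N(2)[OF y] by simp
  qed
  moreover have "v (?\<beta> x) = s x" if x: "x \<in> points X" for x
  proof -
    have sx: "s x \<in> A" using s(2) x .
    \<comment> \<open>A preimage of \<open>s x\<close> under \<open>v\<close>, which exists because \<open>v u\<close> is invertible on \<open>A\<close>.\<close>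
    let ?y = "u ((?g ^^ (K - 1)) (s x))"
    have y: "?y \<in> points H" using uH gA[OF sx] by blast
    have "(?g ^^ K) (s x) = ?g ((?g ^^ (K - 1)) (s x))" by (subst KS) simp
    then have sy: "s x = v ?y" using K(2)[OF sx] ga[OF gA[OF sx]] by simp
    have "?\<beta> x = (?f ^^ (N - 1)) (?f ?y)" using \<beta>x[OF x] fy[OF y] sy by simp
    also have "\<dots> = (?f ^^ N) ?y" by (subst NS) (simp only: funpow_Suc_right comp_apply)
    also have "\<dots> = ?y" using N(2)[OF y] .
    finally show ?thesis using sy by simp
  qed
  ultimately show ?thesis using v' \<beta> by blast
qed

section \<open>A tower of retractions\<close>

text \<open>
  \<open>A k\<close> is a minimal deformation retract of \<open>A (k - 1)\<close> at scale \<open>r k\<close>, and \<open>s k\<close> composes the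
  retractions from \<open>X\<close> down to \<open>A k\<close>. The homotopy between consecutive retractions is obtained on
  \<open>A k\<close> and carried to \<open>X\<close> by composing with \<open>s k\<close> and the inclusion.
\<close>

lemma ex_retraction_tower:
  fixes X :: "'a qspace" and r :: "nat \<Rightarrow> real"
  assumes fin: "finite (points X)"
  shows "\<exists>s A. (\<forall>x\<in>points X. s 0 x = x) \<and>
    (\<forall>j k. \<forall>x\<in>points X. s j (s k x) = s (max j k) x) \<and>
    (\<forall>k. A k \<subseteq> points X \<and> s k \<in> short_maps X X \<and>
      (\<forall>x\<in>points X. s k x \<in> A k) \<and> (\<forall>x\<in>A k. s k x = x) \<and>
      (s (Suc k), s k) \<in> r_homotopic (r (Suc k)) X X \<and>
      r_minimal (r (Suc k)) (qsubspace X (A (Suc k))))"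
proof -
  have ex: "\<exists>B. r_deformation_retract t (qsubspace X B') B \<and> r_minimal t (qsubspace X B)"
    if "finite B'" for t B'
    using ex_r_minimal_retract[of "qsubspace X B'" t] that by (simp add: qsubspace_def)
  define A where "A = rec_nat (points X)
    (\<lambda>k B'. SOME B. r_deformation_retract (r (Suc k)) (qsubspace X B') B \<and>
      r_minimal (r (Suc k)) (qsubspace X B))"
  have A0: "A 0 = points X" by (simp add: A_def)
  have ASuc: "A (Suc k) = (SOME B. r_deformation_retract (r (Suc k)) (qsubspace X (A k)) B \<and>
      r_minimal (r (Suc k)) (qsubspace X B))" for k by (simp add: A_def)
  have step: "r_deformation_retract (r (Suc k)) (qsubspace X (A k)) (A (Suc k)) \<and>
      r_minimal (r (Suc k)) (qsubspace X (A (Suc k)))" if "finite (A k)" for k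
    unfolding ASuc by (rule someI_ex[OF ex[OF that]])
  have finA: "finite (A k)" for k
  proof (cases k)
    case 0
    then show ?thesis using fin A0 by simp
  next
    case (Suc l)
    have "finite (A l)" 
    proof (induction l)
      case (Suc l)
      then show ?case using step[of l] by (simp add: r_minimal_def)
    qed (use fin A0 in simp)
    then show ?thesis using step[of l] Suc by (simp add: r_minimal_def)
  qed
  have AS: "A (Suc k) \<subseteq> A k" for k
    using step[OF finA[of k]] unfolding r_deformation_retract_def by simp
  have Amono: "A k \<subseteq> A j" if "j \<le> k" for j k
    by (rule lift_Suc_antimono_le[of A, OF AS that])
  have "\<exists>\<rho>\<in>short_maps (qsubspace X (A k)) (qsubspace X (A (Suc k))).
      compose (A (Suc k)) \<rho> (id_map (qsubspace X (A (Suc k)))) = id_map (qsubspace X (A (Suc k))) \<and>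
      (compose (A k) (id_map (qsubspace X (A (Suc k)))) \<rho>, id_map (qsubspace X (A k)))
        \<in> r_homotopic (r (Suc k)) (qsubspace X (A k)) (qsubspace X (A k))" for k
    using step[OF finA[of k]] unfolding r_deformation_retract_def by (auto simp: qsubspace_def)
  then obtain \<rho> where \<rho>: "\<rho> k \<in> short_maps (qsubspace X (A k)) (qsubspace X (A (Suc k)))"
    and \<rho>1: "compose (A (Suc k)) (\<rho> k) (id_map (qsubspace X (A (Suc k)))) = id_map (qsubspace X (A (Suc k)))"
    and \<rho>2: "(compose (A k) (id_map (qsubspace X (A (Suc k)))) (\<rho> k), id_map (qsubspace X (A k)))
        \<in> r_homotopic (r (Suc k)) (qsubspace X (A k)) (qsubspace X (A k))" for k
    by metis
  have \<rho>fix: "\<rho> k x = x" if "x \<in> A (Suc k)" for k x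
    using fun_cong[OF \<rho>1[of k], of x] that by (simp add: compose_def id_map_def)
  have \<rho>A: "\<rho> k x \<in> A (Suc k)" if "x \<in> A k" for k x using short_maps_mem[OF \<rho>, of x k] that by simp
  define s where "s = rec_nat (id_map X) (\<lambda>k. compose (points X) (\<rho> k))"
  have s0: "s 0 = id_map X" and sS: "s (Suc k) = compose (points X) (\<rho> k) (s k)" for k
    by (simp_all add: s_def)
  have AX: "A k \<subseteq> points X" for k using Amono[of 0 k] A0 by simp
  have sA: "s k \<in> short_maps X (qsubspace X (A k))" for k
  proof (induction k)
    case 0
    have "qsubspace X (A 0) = X" by (simp add: A0 qsubspace_def)
    then show ?case by (simp add: s0)
  next
    case (Suc k)
    then show ?case unfolding sS using \<rho> by (rule compose_short)
  qed
  have smem: "s k x \<in> A k" if "x \<in> points X" for k x using short_maps_mem[OF sA that] by simp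
  have sSx: "s (Suc k) x = \<rho> k (s k x)" if "x \<in> points X" for k x
    using that by (simp add: sS compose_def)
  have sfix: "s k x = x" if "x \<in> A k" for k x
    using that
  proof (induction k)
    case 0
    then show ?case by (simp add: s0 A0 id_map_def)
  next
    case (Suc k)
    then have "x \<in> A k" "x \<in> points X" using AS AX by blast+
    then show ?case using Suc sSx \<rho>fix by simp
  qed
  have sX: "s k \<in> short_maps X X" for k using sA[of k] AX[of k] by (auto simp: short_maps_def)
  have up: "s (k + d) (s k x) = s (k + d) x" if x: "x \<in> points X" for k d x
  proof (induction d)
    case 0
    then show ?case using sfix[OF smem[OF x]] by simp
  next
    case (Suc d)
    have "s k x \<in> points X" using smem[OF x] AX by blast
    then show ?case using Suc sSx x by simp
  qed
  have comp: "s j (s k x) = s (max j k) x" if x: "x \<in> points X" for j k x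
  proof (cases "j \<le> k")
    case True
    then have "s k x \<in> A j" using smem[OF x] Amono by blast
    then show ?thesis using True sfix by (simp add: max_absorb2)
  next
    case False
    then show ?thesis using up[OF x, of k "j - k"] by (simp add: max_absorb1)
  qed
  have hom: "(s (Suc k), s k) \<in> r_homotopic (r (Suc k)) X X" for k
  proof -
    let ?i = "id_map (qsubspace X (A k))" and ?j = "id_map (qsubspace X (A (Suc k)))"
    have "(compose (points X) ?i (compose (points X) (compose (A k) ?j (\<rho> k)) (s k)),
        compose (points X) ?i (compose (points X) ?i (s k))) \<in> r_homotopic (r (Suc k)) X X"
      using \<rho>2 sA id_map_short[OF AX] by (rule r_homotopic_compose)
    moreover have "compose (points X) ?i (compose (points X) (compose (A k) ?j (\<rho> k)) (s k)) = s (Suc k)"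
    proof
      fix x
      show "compose (points X) ?i (compose (points X) (compose (A k) ?j (\<rho> k)) (s k)) x = s (Suc k) x"
      proof (cases "x \<in> points X")
        case True
        have 1: "s k x \<in> A k" using smem[OF True] .
        have 2: "\<rho> k (s k x) \<in> A (Suc k)" using \<rho>A[OF 1] .
        have 3: "\<rho> k (s k x) \<in> A k" using AS 2 by (rule subsetD)
        show ?thesis
          unfolding compose_eq[OF True] compose_eq[OF 1] sSx[OF True] using 2 3 by (simp add: id_map_def)
      qed (simp add: compose_def sS)
    qed
    moreover have "compose (points X) ?i (compose (points X) ?i (s k)) = s k"
    proof
      fix x
      show "compose (points X) ?i (compose (points X) ?i (s k)) x = s k x"
      proof (cases "x \<in> points X")
        case True
        then show ?thesis unfolding compose_eq[OF True] using smem[OF True] by (simp add: id_map_def)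
      next
        case False
        have "s k \<in> points X \<rightarrow>\<^sub>E points X" using sX[of k] by (simp add: short_maps_def)
        from PiE_arb[OF this False] show ?thesis using False by (simp add: compose_def)
      qed
    qed
    ultimately show ?thesis by (simp only:)
  qed
  have s0x: "s 0 x = x" if "x \<in> points X" for x using that by (simp add: s0 id_map_def)
  have min: "r_minimal (r (Suc k)) (qsubspace X (A (Suc k)))" for k using step[OF finA] by blast
  show ?thesis
    by (intro exI[of _ s] exI[of _ A] conjI allI ballI s0x comp AX sX smem sfix hom min)
qed

section \<open>The decomposition\<close>

locale retraction_tower =
  fixes R :: "'k ring" and X :: "'a qspace" and s :: "nat \<Rightarrow> 'a \<Rightarrow> 'a" and N :: nat
  assumes R: "cring R" and X: "quasimetric X" and s_short: "s k \<in> short_maps X X"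
    and s_0: "x \<in> points X \<Longrightarrow> s 0 x = x"
    and s_s: "x \<in> points X \<Longrightarrow> s j (s k x) = s (max j k) x"
begin

text \<open>The orthogonal idempotents: \<open>P\<^sub>k\<^sub>-\<^sub>1 - P\<^sub>k\<close> for a finite index \<open>k \<ge> 1\<close>, and \<open>P\<^sub>N\<close> for the index
  \<open>\<infinity>\<close>.\<close>

definition proj :: "enat \<Rightarrow> int \<Rightarrow> ('a list \<Rightarrow> 'k) \<Rightarrow> ('a list \<Rightarrow> 'k)" where
  "proj i n c = (case i of
     enat k \<Rightarrow> push R X (s (k - 1)) c \<ominus>\<^bsub>RC R X n\<^esub> push R X (s k) c
   | \<infinity> \<Rightarrow> push R X (s N) c)"

lemma filtered_push: "filtered_map R (rc R X) (rc R X) (\<lambda>n. push R X (s k))"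
  using filtered_map_push[OF R X X s_short] .

lemma push_closed: "c \<in> carrier (RC R X n) \<Longrightarrow> push R X (s k) c \<in> carrier (RC R X n)"
  using filtered_map.closed[OF filtered_push, of c n] by simp

lemma push_minus: "c \<in> carrier (RC R X n) \<Longrightarrow> c' \<in> carrier (RC R X n) \<Longrightarrow>
    push R X (s k) (c \<ominus>\<^bsub>RC R X n\<^esub> c') = push R X (s k) c \<ominus>\<^bsub>RC R X n\<^esub> push R X (s k) c'"
  using filtered_map.minus[OF filtered_push, of c n c'] by simp

lemma push_push: "c \<in> carrier (RC R X n) \<Longrightarrow> push R X (s j) (push R X (s k) c) = push R X (s (max j k)) c"
  by (rule trans[OF push_compose[OF R s_short s_short] push_cong[OF R _ s_s]])

lemma filtered_proj: "filtered_map R (rc R X) (rc R X) (proj i)"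
proof (cases i)
  case (enat k)
  have "proj i = (\<lambda>n c. push R X (s (k - 1)) c \<ominus>\<^bsub>chain (rc R X) n\<^esub> push R X (s k) c)"
    by (simp add: proj_def enat fun_eq_iff)
  then show ?thesis using filtered_map_minus[OF filtered_push filtered_push] by simp
next
  case infinity
  then show ?thesis using filtered_push[of N] by (simp add: proj_def[abs_def])
qed

lemma proj_proj:
  assumes i: "i \<in> enat ` {1..N} \<union> {\<infinity>}" and j: "j \<in> enat ` {1..N} \<union> {\<infinity>}"
    and c: "c \<in> carrier (RC R X n)"
  shows "proj i n (proj j n c) = (if i = j then proj i n c else \<zero>\<^bsub>RC R X n\<^esub>)"
proof -
  interpret M: Module.module R "RC R X n" by (rule RC_module[OF R])
  let ?P = "\<lambda>k. push R X (s k) c"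
  have P: "?P k \<in> carrier (RC R X n)" for k using push_closed[OF c] .
  have PP: "push R X (s k) (?P l) = ?P (max k l)" for k l using push_push[OF c] .
  note minus = push_minus[OF P P]
  have self: "a \<ominus>\<^bsub>RC R X n\<^esub> a = \<zero>\<^bsub>RC R X n\<^esub>" if "a \<in> carrier (RC R X n)" for a
    using that unfolding a_minus_def by (rule M.M.r_neg)
  have z: "a \<ominus>\<^bsub>RC R X n\<^esub> \<zero>\<^bsub>RC R X n\<^esub> = a" if "a \<in> carrier (RC R X n)" for a
    using that by (simp add: a_minus_def del: RC_ops)
  have d: "?P k \<ominus>\<^bsub>RC R X n\<^esub> ?P l \<in> carrier (RC R X n)" for k l using P by (intro M.M.minus_closed)
  have fin: "proj (enat k) n (proj (enat l) n c) =
      (if k = l then proj (enat k) n c else \<zero>\<^bsub>RC R X n\<^esub>)" if "1 \<le> k" "1 \<le> l" for k l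
  proof -
    have e: "proj (enat k) n (proj (enat l) n c) =
        (?P (max (k - 1) (l - 1)) \<ominus>\<^bsub>RC R X n\<^esub> ?P (max (k - 1) l)) \<ominus>\<^bsub>RC R X n\<^esub>
        (?P (max k (l - 1)) \<ominus>\<^bsub>RC R X n\<^esub> ?P (max k l))"
      by (simp only: proj_def enat.case minus PP)
    consider "k = l" | "k < l" | "l < k" by linarith
    then show ?thesis
    proof cases
      case 1
      then have "max (k - 1) (l - 1) = k - 1" "max (k - 1) l = k" "max k (l - 1) = k" "max k l = k"
        using that by linarith+
      moreover have "(k = l) = True" using 1 by simp
      ultimately show ?thesis unfolding e by (simp only: self[OF P] z[OF d] proj_def enat.case if_True)
    next
      case 2
      then have "max (k - 1) (l - 1) = l - 1" "max (k - 1) l = l" "max k (l - 1) = l - 1" "max k l = l"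
        using that by linarith+
      moreover have "(k = l) = False" using 2 by simp
      ultimately show ?thesis unfolding e by (simp only: self[OF d] if_False)
    next
      case 3
      then have "max (k - 1) (l - 1) = k - 1" "max (k - 1) l = k - 1" "max k (l - 1) = k" "max k l = k"
        using that by linarith+
      moreover have "(k = l) = False" using 3 by simp
      ultimately show ?thesis unfolding e by (simp only: self[OF P] z[OF M.M.zero_closed] if_False)
    qed
  qed
  have inf1: "proj \<infinity> n (proj (enat l) n c) = \<zero>\<^bsub>RC R X n\<^esub>" if "l \<le> N" for l
  proof -
    have "max N (l - 1) = N" "max N l = N" using that by linarith+
    then show ?thesis by (simp only: proj_def enat.case minus PP self[OF P])
  qed
  have inf2: "proj (enat k) n (proj \<infinity> n c) = \<zero>\<^bsub>RC R X n\<^esub>" if "k \<le> N" for k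
  proof -
    have "max (k - 1) N = N" "max k N = N" using that by linarith+
    then show ?thesis by (simp only: proj_def enat.case PP self[OF P])
  qed
  have inf3: "proj \<infinity> n (proj \<infinity> n c) = proj \<infinity> n c"
    by (simp only: proj_def enat.case PP max.idem)
  consider k where "i = enat k" "1 \<le> k" "k \<le> N" | "i = \<infinity>" using i by auto
  then show ?thesis
  proof cases
    case 1
    consider l where "j = enat l" "1 \<le> l" "l \<le> N" | "j = \<infinity>" using j by auto
    then show ?thesis using 1 fin inf2 by cases (auto simp del: RC_ops)
  next
    case 2
    consider l where "j = enat l" "1 \<le> l" "l \<le> N" | "j = \<infinity>" using j by auto
    then show ?thesis using 2 inf1 inf3 by cases auto
  qed
qed

definition summand :: "enat \<Rightarrow> ('k, ('a list \<Rightarrow> 'k) set) spectral_seq" where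
  "summand i = fc_ss (fixed_cx (rc R X) (proj i))"

lemma summand_spectral_sequence: "spectral_sequence R (summand i)"
  unfolding summand_def
  using filtered_complex_fixed_cx[OF filtered_proj] by (rule filtered_complex.spectral_sequence)

lemma proj_absorb:
  assumes i: "i \<in> enat ` {j + 1..N} \<union> {\<infinity>}" and j: "j \<le> N" and c: "c \<in> carrier (RC R X n)"
  shows "proj i n (push R X (s j) c) = proj i n c"
proof (cases i)
  case (enat k)
  then have "max (k - 1) j = k - 1" "max k j = k" using i by auto
  then show ?thesis by (simp only: proj_def enat enat.case push_push[OF c])
next
  case infinity
  then show ?thesis using j by (simp add: proj_def push_push[OF c] max_absorb1)
qed

text \<open>
  \<open>Y\<close> is isometric to the image of \<open>s j\<close>, so its complex is the image of \<open>P\<^sub>j\<close>, and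
  \<open>P\<^sub>j = (P\<^sub>j - P\<^sub>j\<^sub>+\<^sub>1) + \<dots> + (P\<^sub>N\<^sub>-\<^sub>1 - P\<^sub>N) + P\<^sub>N\<close>. For \<open>j = 0\<close> and \<open>Y = X\<close> this is the decomposition
  of the spectral sequence of \<open>X\<close> itself.
\<close>

lemma mpss_isomorphic_direct_sum:
  assumes Y: "quasimetric Y" and j: "j \<le> N"
    and \<alpha>: "\<alpha> \<in> short_maps Y X" and \<beta>: "\<beta> \<in> short_maps X Y"
    and \<beta>\<alpha>: "\<And>y. y \<in> points Y \<Longrightarrow> \<beta> (\<alpha> y) = y" and \<alpha>\<beta>: "\<And>x. x \<in> points X \<Longrightarrow> \<alpha> (\<beta> x) = s j x"
  shows "ss_isomorphic R (mpss_space R Y) (ss_direct_sum (enat ` {j + 1..N} \<union> {\<infinity>}) summand)"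
    and "j = N \<Longrightarrow> ss_isomorphic R (mpss_space R Y) (summand \<infinity>)"
proof -
  let ?I = "enat ` {j + 1..N} \<union> {\<infinity>}"
  have I: "i \<in> enat ` {1..N} \<union> {\<infinity>}" if "i \<in> ?I" for i using that by auto
  note fa = filtered_map_push[OF R Y X \<alpha>] and fb = filtered_map_push[OF R X Y \<beta>]
  have a: "push R X \<alpha> c \<in> carrier (RC R X n)" if "c \<in> carrier (RC R Y n)" for c n
    using filtered_map.closed[OF fa, of c n] that by simp
  have ab: "push R X \<alpha> (push R Y \<beta> c) = push R X (s j) c" if "c \<in> carrier (RC R X n)" for c n
    using push_compose[OF R \<beta> \<alpha> that] push_cong[OF R that \<alpha>\<beta>] by simp
  have ba: "push R Y \<beta> (push R X \<alpha> c) = c" if "c \<in> carrier (RC R Y n)" for c n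
    using push_compose[OF R \<alpha> \<beta> that] push_id[OF R that \<beta>\<alpha>] by simp
  have gen: "c \<in> L" if c: "c \<in> carrier (RC R Y n)" and L: "submodule L R (RC R Y n)"
    and i: "\<And>i. i \<in> ?I \<Longrightarrow> push R Y \<beta> (proj i n (push R X \<alpha> c)) \<in> L" for n c L
  proof -
    interpret M: Module.module R "RC R Y n" by (rule RC_module[OF R])
    let ?y = "\<lambda>k. push R Y \<beta> (push R X (s k) (push R X \<alpha> c))"
    have P: "push R X (s k) (push R X \<alpha> c) \<in> carrier (RC R X n)" for k using push_closed[OF a[OF c]] .
    have y: "?y k \<in> carrier (RC R Y n)" for k using filtered_map.closed[OF fb, of _ n] P by simp
    \<comment> \<open>The sum telescopes: starting from \<open>P\<^sub>N\<close>, each difference \<open>P\<^sub>k\<^sub>-\<^sub>1 - P\<^sub>k\<close> leads one step down.\<close>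
    have "?y (N - d) \<in> L" if "d \<le> N - j" for d
      using that
    proof (induction d)
      case 0
      then show ?case using i[of \<infinity>] by (simp add: proj_def)
    next
      case (Suc d)
      let ?k = "N - d"
      have k: "?k \<in> {j + 1..N}" "N - Suc d = ?k - 1" using Suc.prems by auto
      have "?y (?k - 1) \<ominus>\<^bsub>RC R Y n\<^esub> ?y ?k \<in> L"
        using i[of "enat ?k"] k(1) filtered_map.minus[OF fb, of _ n] P by (simp add: proj_def)
      moreover have "?y ?k \<in> L" using Suc by simp
      ultimately have "(?y (?k - 1) \<ominus>\<^bsub>RC R Y n\<^esub> ?y ?k) \<oplus>\<^bsub>RC R Y n\<^esub> ?y ?k \<in> L"
        using M.submoduleE(5)[OF L] by blast
      also have "(?y (?k - 1) \<ominus>\<^bsub>RC R Y n\<^esub> ?y ?k) \<oplus>\<^bsub>RC R Y n\<^esub> ?y ?k = ?y (?k - 1)"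
        unfolding a_minus_def using y[of "?k - 1"] y[of ?k] M.M.a_inv_closed[OF y[of ?k]]
          M.M.a_assoc M.M.l_neg M.M.r_zero by metis
      finally show ?case unfolding k(2) .
    qed
    from this[of "N - j"] have "?y j \<in> L" using j by simp
    moreover have "?y j = c"
      using ab[OF a[OF c], symmetric] ba[OF c] by simp
    ultimately show ?thesis by simp
  qed
  have "ss_isomorphic R (fc_ss (rc R Y)) (ss_direct_sum ?I (\<lambda>i. fc_ss (fixed_cx (rc R X) (proj i))))"
  proof (rule idempotents_ss_isomorphic[OF fa fb])
    show "proj i n (push R X \<alpha> (push R Y \<beta> c)) = proj i n c"
      if "i \<in> ?I" "c \<in> carrier (chain (rc R X) n)" for i n c
      using proj_absorb[OF that(1) j] ab that(2) by simp
    show "filtered_map R (rc R X) (rc R X) (proj i)" for i by (rule filtered_proj)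
  qed (use I proj_proj gen in \<open>auto simp del: RC_ops\<close>)
  then show "ss_isomorphic R (mpss_space R Y) (ss_direct_sum ?I summand)"
    unfolding mpss_space_eq summand_def .
  assume jN: "j = N"
  have idem: "proj \<infinity> n (proj \<infinity> n c) = proj \<infinity> n c" if "c \<in> carrier (chain (rc R X) n)" for n c
    using proj_proj[of \<infinity> \<infinity>] that by simp
  show "ss_isomorphic R (mpss_space R Y) (summand \<infinity>)"
    unfolding mpss_space_eq summand_def
  proof (rule filtered_iso_ss_isomorphic)
    show "filtered_map R (rc R Y) (fixed_cx (rc R X) (proj \<infinity>)) (\<lambda>n c. proj \<infinity> n (push R X \<alpha> c))"
      using fa filtered_proj idem by (rule filtered_map_into_fixed_cx)
    show "filtered_map R (fixed_cx (rc R X) (proj \<infinity>)) (rc R Y) (\<lambda>n. push R Y \<beta>)"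
      using fb filtered_proj by (rule filtered_map_from_fixed_cx)
    show "push R Y \<beta> (proj \<infinity> n (push R X \<alpha> c)) = c" if "c \<in> carrier (chain (rc R Y) n)" for n c
      using that ab[OF a, of c n] ba[of c n] jN by (simp add: proj_def)
    show "proj \<infinity> n (push R X \<alpha> (push R Y \<beta> c)) = c"
      if "c \<in> carrier (chain (fixed_cx (rc R X) (proj \<infinity>)) n)" for n c
      using that ab[of c n] jN by (auto simp: proj_def push_push)
  qed
qed

lemma summand_page_trivial:
  assumes int: "integral_qspace X" and r: "0 \<le> r" and k: "k \<in> {1..N}"
    and hom: "(s k, s (k - 1)) \<in> r_homotopic r X X"
  shows "carrier (ss_page (summand (enat k)) (Suc (nat \<lfloor>r\<rfloor>)) p q) =
    {\<zero>\<^bsub>ss_page (summand (enat k)) (Suc (nat \<lfloor>r\<rfloor>)) p q\<^esub>}"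
proof -
  let ?m = "nat \<lfloor>r\<rfloor>"
  obtain h where h: "chain_op X X 1 ?m h"
    and hh: "\<And>t. frag_extend bd (h t) + frag_extend h (bd t) = map_chain (s (k - 1)) t - map_chain (s k) t"
    using r_homotopic_chain_homotopy[OF hom int r] by blast
  note bd = chain_op_bd[OF X]
  have "carrier (page (fixed_cx (rc R X) (proj (enat k))) (Suc ?m) p (p + q)) =
      {\<zero>\<^bsub>page (fixed_cx (rc R X) (proj (enat k))) (Suc ?m) p (p + q)\<^esub>}"
  proof (rule fixed_cx_page_trivial[where h = "\<lambda>n. realize R X h"])
    show "filtered_map R (rc R X) (rc R X) (proj (enat k))" by (rule filtered_proj)
    show "proj (enat k) n (proj (enat k) n c) = proj (enat k) n c"
      if "c \<in> carrier (chain (rc R X) n)" for n c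
      using proj_proj[of "enat k" "enat k" c n] k that by (simp del: RC_ops)
    show "realize R X h c \<in> filt (rc R X) (p + int ?m) (n + 1)" if "c \<in> filt (rc R X) p n" for p n c
      using realize_filt[OF R h] that by simp
    show "realize R X h c \<in> carrier (chain (rc R X) (n + 1))" if "c \<in> carrier (chain (rc R X) n)" for n c
      using realize_RC[OF R h] that by simp
    fix n c assume "c \<in> carrier (chain (rc R X) n)"
    then have c: "c \<in> carrier (RC R X n)" by simp
    have 1: "boundary R X (n + 1) (realize R X h c) = realize R X (\<lambda>t. frag_extend bd (h t)) c"
      using boundary_realize[OF R X realize_RC[OF R h c]] realize_compose[OF R h bd c] by simp
    have 2: "realize R X h (boundary R X n c) = realize R X (\<lambda>t. frag_extend h (bd t)) c"
      using boundary_realize[OF R X c] realize_compose[OF R bd h c] by simp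
    interpret cring R by (rule R)
    interpret M: Module.module R "RC R X n" by (rule RC_module[OF R])
    let ?d = "realize R X (\<lambda>t. map_chain (s (k - 1)) t - map_chain (s k) t) c"
    have "push R X (s (k - 1)) c =
      realize R X (\<lambda>t. (map_chain (s (k - 1)) t - map_chain (s k) t) + map_chain (s k) t) c"
      by (simp add: push_def)
    also have "\<dots> = ?d \<oplus>\<^bsub>RC R X n\<^esub> push R X (s k) c"
      unfolding push_def RC_ops[OF R] by (rule realize_add[OF R c])
    finally have e: "push R X (s (k - 1)) c = ?d \<oplus>\<^bsub>RC R X n\<^esub> push R X (s k) c" .
    have d: "?d = boundary R X (n + 1) (realize R X h c) \<oplus>\<^bsub>RC R X n\<^esub> realize R X h (boundary R X n c)"
      unfolding 1 2 hh[symmetric] RC_ops[OF R] by (rule realize_add[OF R c])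
    have "boundary R X (n + 1) (realize R X h c) \<in> carrier (RC R X n)"
      using filtered_complex.bdry_closed'[OF filtered_complex_rc[OF R X], of _ n] realize_RC[OF R h c]
      by simp
    moreover have "boundary R X n c \<in> carrier (RC R X (n - 1))"
      using realize_RC[OF R bd c] boundary_realize[OF R X c] by simp
    then have "realize R X h (boundary R X n c) \<in> carrier (RC R X n)"
      using realize_RC[OF R h, of "boundary R X n c" "n - 1"] by simp
    ultimately have dC: "?d \<in> carrier (RC R X n)" unfolding d by (rule M.M.a_closed)
    have pk: "push R X (s k) c \<in> carrier (RC R X n)" using push_closed[OF c] .
    have "proj (enat k) n c = ?d"
      unfolding proj_def enat.case e a_minus_def
      by (simp only: M.M.a_assoc[OF dC pk M.M.a_inv_closed[OF pk]] M.M.r_neg[OF pk] M.M.r_zero[OF dC])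
    then show "proj (enat k) n c = bdry (rc R X) (n + 1) (realize R X h c) \<oplus>\<^bsub>chain (rc R X) n\<^esub>
        realize R X h (bdry (rc R X) n c)"
      using d by simp
  qed
  then show ?thesis by (simp add: summand_def fc_ss_def)
qed

end

lemma nat_floor_Suc: "0 \<le> r \<Longrightarrow> nat \<lfloor>1 + r :: real\<rfloor> = Suc (nat \<lfloor>r\<rfloor>)"
  by (simp add: floor_add_int[symmetric] nat_add_distrib)

theorem theorem3p3:
  fixes R :: "'k ring" and G :: "'v digraph" and n :: nat and r :: "nat \<Rightarrow> real"
  assumes "cring R"
    and "is_digraph G" and "finite (verts G)"
    and "strict_mono_on {1..n} r" and "hj (Q G) = r ` {1..n}"
  shows "\<exists>S :: enat \<Rightarrow> ('k, ('v list \<Rightarrow> 'k) set) spectral_seq.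
    (\<forall>k \<in> enat ` {1..n} \<union> {\<infinity>}. spectral_sequence R (S k)) \<and>
    ss_isomorphic R (mpss R G) (ss_direct_sum (enat ` {1..n} \<union> {\<infinity>}) S) \<and>
    (\<forall>k\<in>{1..n}. \<forall>p q.
       carrier (ss_page (S (enat k)) (nat \<lfloor>1 + r k\<rfloor>) p q) =
         {\<zero>\<^bsub>ss_page (S (enat k)) (nat \<lfloor>1 + r k\<rfloor>) p q\<^esub>}) \<and>
    (\<forall>j\<in>{1..n}. \<forall>H :: 'v digraph. is_M_digraph (r j) G H \<longrightarrow>
       ss_isomorphic R (mpss R H) (ss_direct_sum (enat ` {j+1..n} \<union> {\<infinity>}) S)) \<and>
    (\<forall>H :: 'v digraph. is_M_stab_digraph G H \<longrightarrow> ss_isomorphic R (mpss R H) (S \<infinity>))"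
proof -
  let ?X = "Q G"
  have fin: "finite (points ?X)" using assms(3) by simp
  obtain s A where T: "(\<forall>x\<in>points ?X. s 0 x = x) \<and>
    (\<forall>j k. \<forall>x\<in>points ?X. s j (s k x) = s (max j k) x) \<and>
    (\<forall>k. A k \<subseteq> points ?X \<and> s k \<in> short_maps ?X ?X \<and>
      (\<forall>x\<in>points ?X. s k x \<in> A k) \<and> (\<forall>x\<in>A k. s k x = x) \<and>
      (s (Suc k), s k) \<in> r_homotopic (r (Suc k)) ?X ?X \<and>
      r_minimal (r (Suc k)) (qsubspace ?X (A (Suc k))))"
    using ex_retraction_tower[OF fin, of r] by (elim exE)
  have s0: "s 0 x = x" if "x \<in> points ?X" for x using T that by blast
  have ss: "s j (s k x) = s (max j k) x" if "x \<in> points ?X" for j k x using T that by blast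
  have A: "A k \<subseteq> points ?X" and s: "s k \<in> short_maps ?X ?X"
    and hom: "(s (Suc k), s k) \<in> r_homotopic (r (Suc k)) ?X ?X"
    and min: "r_minimal (r (Suc k)) (qsubspace ?X (A (Suc k)))" for k using T by blast+
  have sA: "s k x \<in> A k" if "x \<in> points ?X" for k x using T that by blast
  have sfix: "s k x = x" if "x \<in> A k" for k x using T that by blast
  interpret T: retraction_tower R ?X s n
    by (rule retraction_tower.intro) (fact assms(1) quasimetric_Q s s0 ss)+
  have pos: "0 < r k" if "k \<in> {1..n}" for k
  proof -
    have "r k \<in> hj ?X" using assms(5) that by blast
    then show ?thesis by (simp add: hj_def)
  qed
  \<comment> \<open>The steps up to \<open>k\<close> are homotopies at the scales \<open>r 1 \<le> \<dots> \<le> r k\<close>, hence all at the scale \<open>r k\<close>.\<close>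
  have to_id: "(s k, id_map ?X) \<in> r_homotopic (r k) ?X ?X" if "k \<in> {1..n}" for k
    using that
  proof (induction k)
    case (Suc k)
    show ?case
    proof (cases "k = 0")
      case True
      have "s 0 = id_map ?X"
        using s0 s[of 0] by (auto simp: id_map_def short_maps_def fun_eq_iff PiE_iff extensional_def)
      then show ?thesis using hom[of 0] True by simp
    next
      case False
      then have "r k \<le> r (Suc k)"
        using strict_mono_onD[OF assms(4), of k "Suc k"] Suc.prems by simp
      then have "r_homotopic (r k) ?X ?X \<subseteq> r_homotopic (r (Suc k)) ?X ?X" by (rule r_homotopic_mono)
      moreover have "(s k, id_map ?X) \<in> r_homotopic (r k) ?X ?X" using Suc False by simp
      ultimately have "(s k, id_map ?X) \<in> r_homotopic (r (Suc k)) ?X ?X" by (rule subsetD)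
      with hom[of k] show ?thesis by (rule r_homotopic_trans)
    qed
  qed simp
  have iso: "ss_isomorphic R (mpss R H) (ss_direct_sum (enat ` {j+1..n} \<union> {\<infinity>}) T.summand) \<and>
      (j = n \<longrightarrow> ss_isomorphic R (mpss R H) (T.summand \<infinity>))"
    if j: "j \<in> {1..n}" and H: "is_M_digraph (r j) G H" for j and H :: "'v digraph"
  proof -
    obtain k where k: "j = Suc k" using j by (cases j) auto
    have "\<exists>\<alpha>\<in>short_maps (Q H) ?X. \<exists>\<beta>\<in>short_maps ?X (Q H).
        (\<forall>y\<in>points (Q H). \<beta> (\<alpha> y) = y) \<and> (\<forall>x\<in>points ?X. \<alpha> (\<beta> x) = s j x)"
    proof (rule minimal_retract_isometric)
      show "A j \<subseteq> points ?X" "s j \<in> short_maps ?X ?X" by (rule A s)+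
      show "s j x \<in> A j" if "x \<in> points ?X" for x using sA[OF that] .
      show "s j x = x" if "x \<in> A j" for x using sfix[OF that] .
      show "(s j, id_map ?X) \<in> r_homotopic (r j) ?X ?X" using to_id[OF j] .
      show "r_minimal (r j) (qsubspace ?X (A j))" unfolding k by (rule min)
      show "is_M (r j) ?X (Q H)" using H by (simp add: is_M_digraph_def)
    qed
    then obtain \<alpha> \<beta> where \<alpha>: "\<alpha> \<in> short_maps (Q H) ?X" and \<beta>: "\<beta> \<in> short_maps ?X (Q H)"
      and \<beta>\<alpha>: "\<forall>y\<in>points (Q H). \<beta> (\<alpha> y) = y" and \<alpha>\<beta>: "\<forall>x\<in>points ?X. \<alpha> (\<beta> x) = s j x"
      by (elim bexE conjE)
    have "j \<le> n" using j by simp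
    from T.mpss_isomorphic_direct_sum[OF quasimetric_Q this \<alpha> \<beta> bspec[OF \<beta>\<alpha>] bspec[OF \<alpha>\<beta>]]
    show ?thesis unfolding mpss_def by blast
  qed
  have iso0: "ss_isomorphic R (mpss R G) (ss_direct_sum (enat ` {0+1..n} \<union> {\<infinity>}) T.summand)"
    "0 = n \<Longrightarrow> ss_isomorphic R (mpss R G) (T.summand \<infinity>)"
  proof -
    have "s 0 (s 0 x) = x" "s 0 (s 0 x) = s 0 x" if "x \<in> points ?X" for x
      using s0[OF that] by simp_all
    from T.mpss_isomorphic_direct_sum[OF quasimetric_Q le0 s s this]
    show "ss_isomorphic R (mpss R G) (ss_direct_sum (enat ` {0+1..n} \<union> {\<infinity>}) T.summand)"
      "0 = n \<Longrightarrow> ss_isomorphic R (mpss R G) (T.summand \<infinity>)"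
      unfolding mpss_def by blast+
  qed
  have stab: "ss_isomorphic R (mpss R H) (T.summand \<infinity>)" if H: "is_M_stab_digraph G H" for H :: "'v digraph"
  proof (cases "n = 0")
    case True
    then have "H = G" using H assms(5) by (simp add: is_M_stab_digraph_def)
    then show ?thesis using iso0(2) True by simp
  next
    case False
    have "Max (r ` {1..n}) = r n"
    proof (rule Max_eqI)
      fix y assume "y \<in> r ` {1..n}"
      then obtain k where k: "k \<in> {1..n}" "y = r k" by blast
      then show "y \<le> r n" using strict_mono_onD[OF assms(4), of k n] False by (cases "k = n") auto
    qed (use False in auto)
    then have "is_M_digraph (r n) G H"
      using H False assms(5) by (simp add: is_M_stab_digraph_def split: if_splits)
    then show ?thesis using iso[of n H] False by simp
  qed
  have triv: "carrier (ss_page (T.summand (enat k)) (nat \<lfloor>1 + r k\<rfloor>) p q) =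
      {\<zero>\<^bsub>ss_page (T.summand (enat k)) (nat \<lfloor>1 + r k\<rfloor>) p q\<^esub>}" if k: "k \<in> {1..n}" for k p q
  proof -
    have "(s k, s (k - 1)) \<in> r_homotopic (r k) ?X ?X" using hom[of "k - 1"] k by simp
    then show ?thesis
      unfolding nat_floor_Suc[OF less_imp_le[OF pos[OF k]]]
      by (rule T.summand_page_trivial[OF integral_Q less_imp_le[OF pos[OF k]] k])
  qed
  show ?thesis
    using T.summand_spectral_sequence iso0(1) triv iso stab
    by (intro exI[of _ T.summand] conjI) auto
qed

end
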